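(* Let $\mathcal R$ be any rewind oracle for the Line Clifford Simulation task (for all $n$). Then $\mathsf{AC}^0[6]\subseteq(\mathsf{BPAC}^0)^{\mathcal R}$.
   Context: Graph state of the path (line) graph on $N$ vertices $1,\dots,N$: $2^{-N/2}\sum_{x\in\{0,1\}^N}\prod_{k=1}^{N-1}(-1)^{x_kx_{k+1}}|x\rangle$. Measuring in the $X$ (resp. $Y$) basis means measuring the Pauli observable $X$ (resp. $Y$). Line Clifford Simulation task (for each $n$): the initial state is the graph state of the line graph on $6n+4$ vertices. Round 1: the challenge is a pair $A,B\in\{0,1\}^{3n+1}$; for each $i\in[3n+1]$, the $i$-th qubit from the left is measured in the $X$ basis if $A_i=0$ and in the $Y$ basis otherwise, and the $i$-th qubit from the right is measured in the $X$ basis if $B_i=0$ and in the $Y$ basis otherwise (leaving the two middle qubits). Round 2: the challenge is a two-qubit Clifford unitary $C$; it is applied to the two middle qubits, which are then both measured in the $X$ basis. A valid response in a round is an outcome string with nonzero probability (in round 2, conditioned on the round-1 challenge and outcomes) for an honest quantum execution. Rewind oracle $\mathcal R$: answers (i) a round-1 challenge $a$ with a valid round-1 response $o$; (ii) a triple $(a,o,b)$ with a valid round-2 response for challenge $b$ conditioned on $(a,o)$, guaranteed valid only if $\mathcal R$ previously returned $o$ on query $a$ (such queries may be repeated with different $b$); answers may be arbitrary among valid ones. $\mathsf{AC}^0[6]$: polynomial-size constant-depth circuits of unbounded fan-in AND, OR, NOT and $\mathrm{MOD}_6$ gates, where $\mathrm{MOD}_6$ outputs 1 iff the sum of its inputs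 is $0 \bmod 6$. $(\mathsf{BPAC}^0)^{\mathcal R}$: languages decided with probability at least $2/3$ on every input by polynomial-size constant-depth unbounded fan-in AND/OR/NOT circuits with random bits and oracle gates to $\mathcal R$. *)

theory Defs
  imports Complex_Main
begin

text \<open>An N-qubit state is a function on bit strings (bool lists) of length N
  (False = 0, True = 1); qubit k is position k (0-indexed, left to right).\<close>

type_synonym qstate = "bool list \<Rightarrow> complex"
type_synonym mat1 = "bool \<Rightarrow> bool \<Rightarrow> complex"
type_synonym mat2 = "bool \<times> bool \<Rightarrow> bool \<times> bool \<Rightarrow> complex"

definition id1 :: mat1 where "id1 a b = (if a = b then 1 else 0)"
definition pauliX :: mat1 where "pauliX a b = (if a \<noteq> b then 1 else 0)"
definition pauliY :: mat1 where
  "pauliY a b = (if a = b then 0 else if a then \<i> else - \<i>)"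
definition pauliZ :: mat1 where
  "pauliZ a b = (if a = b then (if a then -1 else 1) else 0)"

definition proj_obs :: "mat1 \<Rightarrow> bool \<Rightarrow> mat1" where
  "proj_obs P ob a b = (id1 a b + (if ob then -1 else 1) * P a b) / 2"

definition apply1 :: "nat \<Rightarrow> mat1 \<Rightarrow> qstate \<Rightarrow> qstate" where
  "apply1 k M \<psi> = (\<lambda>x. if k < length x
      then (\<Sum>b\<in>UNIV. M (x ! k) b * \<psi> (x[k := b])) else 0)"

definition apply2 :: "nat \<Rightarrow> mat2 \<Rightarrow> qstate \<Rightarrow> qstate" where
  "apply2 j M \<psi> = (\<lambda>x. if Suc j < length x
      then (\<Sum>p\<in>UNIV. M (x ! j, x ! Suc j) p * \<psi> (x[j := fst p, Suc j := snd p])) else 0)"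

definition graph_state_line :: "nat \<Rightarrow> qstate" where
  "graph_state_line N x = (if length x = N
      then complex_of_real (2 powr (- real N / 2)) *
           (\<Prod>k<N - 1. (if x ! k \<and> x ! Suc k then -1 else 1))
      else 0)"

definition basis_obs :: "bool \<Rightarrow> mat1" where
  "basis_obs b = (if b then pauliY else pauliX)"

text \<open>Round 1 (size parameter n, N = 6n+4, m = 3n+1): the i-th qubit from the left
  (index i-1) is measured in basis A_i with outcome OA_i, the i-th qubit from the
  right (index N-i) in basis B_i with outcome OB_i.  This is the (unnormalised)
  post-measurement state.\<close>
definition round1_proj ::
  "nat \<Rightarrow> bool list \<Rightarrow> bool list \<Rightarrow> bool list \<Rightarrow> bool list \<Rightarrow> qstate \<Rightarrow> qstate" where
  "round1_proj n A B OA OB \<psi> =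
     foldr (\<lambda>i \<phi>. apply1 i (proj_obs (basis_obs (A ! i)) (OA ! i))
                    (apply1 (6 * n + 3 - i) (proj_obs (basis_obs (B ! i)) (OB ! i)) \<phi>))
           [0..<3 * n + 1] \<psi>"

definition valid_round1 ::
  "nat \<Rightarrow> bool list \<Rightarrow> bool list \<Rightarrow> bool list \<Rightarrow> bool list \<Rightarrow> bool" where
  "valid_round1 n A B OA OB \<longleftrightarrow>
     length A = 3 * n + 1 \<and> length B = 3 * n + 1 \<and>
     length OA = 3 * n + 1 \<and> length OB = 3 * n + 1 \<and>
     round1_proj n A B OA OB (graph_state_line (6 * n + 4)) \<noteq> (\<lambda>_. 0)"

text \<open>Round 2: apply C to the two middle qubits (indices 3n+1, 3n+2), measure both
  in the X basis with outcomes c1, c2; valid iff nonzero probability (conditioned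
  on the round-1 data, which is assumed valid).\<close>
definition valid_round2 ::
  "nat \<Rightarrow> bool list \<Rightarrow> bool list \<Rightarrow> bool list \<Rightarrow> bool list \<Rightarrow> mat2 \<Rightarrow> bool \<Rightarrow> bool \<Rightarrow> bool" where
  "valid_round2 n A B OA OB C c1 c2 \<longleftrightarrow>
     apply1 (3 * n + 1) (proj_obs pauliX c1)
       (apply1 (3 * n + 2) (proj_obs pauliX c2)
         (apply2 (3 * n + 1) C (round1_proj n A B OA OB (graph_state_line (6 * n + 4)))))
     \<noteq> (\<lambda>_. 0)"

definition mmul2 :: "mat2 \<Rightarrow> mat2 \<Rightarrow> mat2" where
  "mmul2 M N p q = (\<Sum>r\<in>UNIV. M p r * N r q)"
definition adj2 :: "mat2 \<Rightarrow> mat2" where "adj2 M p q = cnj (M q p)"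
definition id2 :: mat2 where "id2 p q = (if p = q then 1 else 0)"
definition kron :: "mat1 \<Rightarrow> mat1 \<Rightarrow> mat2" where
  "kron M N p q = M (fst p) (fst q) * N (snd p) (snd q)"
definition unitary2 :: "mat2 \<Rightarrow> bool" where "unitary2 C \<longleftrightarrow> mmul2 (adj2 C) C = id2"

definition pauli1 :: "bool \<Rightarrow> bool \<Rightarrow> mat1" where
  "pauli1 x z = (if x \<and> z then pauliY else if x then pauliX else if z then pauliZ else id1)"

definition pauli2 :: "bool list \<Rightarrow> mat2" where
  "pauli2 v p q = (if v ! 4 then -1 else 1) * kron (pauli1 (v ! 0) (v ! 1)) (pauli1 (v ! 2) (v ! 3)) p q"

definition conj2 :: "mat2 \<Rightarrow> mat2 \<Rightarrow> mat2" where "conj2 C P = mmul2 (mmul2 C P) (adj2 C)"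

definition clifford2 :: "mat2 \<Rightarrow> bool" where
  "clifford2 C \<longleftrightarrow> unitary2 C \<and>
     (\<forall>v. length v = 5 \<longrightarrow> (\<exists>w. length w = 5 \<and> conj2 C (pauli2 v) = pauli2 w))"

definition pauli_gens :: "bool list list" where
  "pauli_gens = [[True, False, False, False, False], [False, True, False, False, False],
                 [False, False, True, False, False], [False, False, False, True, False]]"

text \<open>A 20-bit string encodes the Clifford C (up to global phase) by its tableau:
  the images of X(x)I, Z(x)I, I(x)X, I(x)Z under conjugation by C.\<close>
definition encodes_clifford :: "bool list \<Rightarrow> mat2 \<Rightarrow> bool" where
  "encodes_clifford bs C \<longleftrightarrow> length bs = 20 \<and> clifford2 C \<and>
     (\<forall>j<4. conj2 C (pauli2 (pauli_gens ! j)) = pauli2 (take 5 (drop (5 * j) bs)))"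

datatype gkind = GAnd | GOr | GNot | GMod6 | GOrc1 nat | GOrc2 nat

datatype wire = WIn nat | WRnd nat | WGate nat nat

record circuit =
  gates :: "(gkind \<times> wire list) list"
  nrand :: nat
  cout :: wire

type_synonym orc_history = "(gkind \<times> bool list \<times> bool list) list"
text \<open>An orcl (possibly adaptive): answer as a function of the history of all
  previous orcl queries/answers, the query kind and the query bits.\<close>
type_synonym orcl = "orc_history \<Rightarrow> gkind \<Rightarrow> bool list \<Rightarrow> bool list"

fun out_arity :: "gkind \<Rightarrow> nat" where
  "out_arity (GOrc1 n) = 6 * n + 2"
| "out_arity (GOrc2 n) = 2"
| "out_arity _ = 1"

fun in_arity_ok :: "gkind \<Rightarrow> wire list \<Rightarrow> bool" where
  "in_arity_ok GNot ws = (length ws = 1)"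
| "in_arity_ok (GOrc1 n) ws = (length ws = 6 * n + 2)"
| "in_arity_ok (GOrc2 n) ws = (length ws = 12 * n + 24)"
| "in_arity_ok _ ws = True"

definition wire_val :: "bool list \<Rightarrow> bool list \<Rightarrow> bool list list \<Rightarrow> wire \<Rightarrow> bool" where
  "wire_val x \<rho> outs w = (case w of WIn i \<Rightarrow> x ! i | WRnd j \<Rightarrow> \<rho> ! j | WGate g j \<Rightarrow> outs ! g ! j)"

definition gate_step :: "orcl \<Rightarrow> bool list \<Rightarrow> bool list \<Rightarrow>
    bool list list \<times> orc_history \<Rightarrow> gkind \<times> wire list \<Rightarrow> bool list list \<times> orc_history" where
  "gate_step R x \<rho> st gt = (let outs = fst st; h = snd st; k = fst gt;
      vs = map (wire_val x \<rho> outs) (snd gt) in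
     (case k of
        GAnd \<Rightarrow> (outs @ [[\<forall>v\<in>set vs. v]], h)
      | GOr \<Rightarrow> (outs @ [[\<exists>v\<in>set vs. v]], h)
      | GNot \<Rightarrow> (outs @ [[\<not> hd vs]], h)
      | GMod6 \<Rightarrow> (outs @ [[length (filter id vs) mod 6 = 0]], h)
      | GOrc1 n \<Rightarrow> (let a = R h k vs in (outs @ [a], h @ [(k, vs, a)]))
      | GOrc2 n \<Rightarrow> (let a = R h k vs in (outs @ [a], h @ [(k, vs, a)]))))"

definition circ_eval :: "orcl \<Rightarrow> bool list \<Rightarrow> bool list \<Rightarrow> circuit \<Rightarrow> bool" where
  "circ_eval R x \<rho> C =
     wire_val x \<rho> (fst (foldl (gate_step R x \<rho>) ([], []) (gates C))) (cout C)"

definition wf_wire :: "nat \<Rightarrow> nat \<Rightarrow> (gkind \<times> wire list) list \<Rightarrow> wire \<Rightarrow> bool" where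
  "wf_wire k r gs w = (case w of WIn i \<Rightarrow> i < k | WRnd j \<Rightarrow> j < r
      | WGate g j \<Rightarrow> g < length gs \<and> j < out_arity (fst (gs ! g)))"

definition wf_circuit :: "nat \<Rightarrow> circuit \<Rightarrow> bool" where
  "wf_circuit k C \<longleftrightarrow>
     (\<forall>g<length (gates C). in_arity_ok (fst (gates C ! g)) (snd (gates C ! g)) \<and>
        (\<forall>w\<in>set (snd (gates C ! g)). wf_wire k (nrand C) (take g (gates C)) w)) \<and>
     wf_wire k (nrand C) (gates C) (cout C)"

definition wire_depth :: "nat list \<Rightarrow> wire \<Rightarrow> nat" where
  "wire_depth ds w = (case w of WGate g j \<Rightarrow> ds ! g | _ \<Rightarrow> 0)"

definition gate_depths :: "(gkind \<times> wire list) list \<Rightarrow> nat list" where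
  "gate_depths gs = foldl (\<lambda>ds gt. ds @ [Suc (foldr max (map (wire_depth ds) (snd gt)) 0)]) [] gs"

definition circ_depth :: "circuit \<Rightarrow> nat" where
  "circ_depth C = foldr max (gate_depths (gates C)) 0"

definition circ_size :: "circuit \<Rightarrow> nat" where
  "circ_size C = length (gates C) + sum_list (map (length \<circ> snd) (gates C)) + nrand C"

definition AC0_6 :: "bool list set set" where
  "AC0_6 = {L. \<exists>(F :: nat \<Rightarrow> circuit) (c :: nat) (d :: nat). \<forall>k.
      wf_circuit k (F k) \<and>
      (\<forall>gt\<in>set (gates (F k)). fst gt \<in> {GAnd, GOr, GNot, GMod6}) \<and>
      nrand (F k) = 0 \<and> circ_size (F k) \<le> c * (k + 1) ^ c \<and> circ_depth (F k) \<le> d \<and>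
      (\<forall>x. length x = k \<longrightarrow> (circ_eval (\<lambda>_ _ _. []) x [] (F k) \<longleftrightarrow> x \<in> L))}"

definition BPAC0_orcl :: "orcl \<Rightarrow> bool list set set" where
  "BPAC0_orcl R = {L. \<exists>(F :: nat \<Rightarrow> circuit) (c :: nat) (d :: nat). \<forall>k.
      wf_circuit k (F k) \<and>
      (\<forall>gt\<in>set (gates (F k)). fst gt \<noteq> GMod6) \<and>
      circ_size (F k) \<le> c * (k + 1) ^ c \<and> circ_depth (F k) \<le> d \<and>
      (\<forall>x. length x = k \<longrightarrow>
         2 * 2 ^ nrand (F k) \<le>
         3 * card {\<rho>. length \<rho> = nrand (F k) \<and> (circ_eval R x \<rho> (F k) \<longleftrightarrow> x \<in> L)})}"

text \<open>Query format.  GOrc1 n: query A @ B (each 3n+1 bits), answer OA @ OB.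
  GOrc2 n: query a @ o @ bs with a, o round-1 query/answer (6n+2 bits each) and
  bs a 20-bit tableau of a Clifford C; answer [c1, c2].  A round-2 answer is
  guaranteed valid only if (a, o) was previously a round-1 query/answer pair.\<close>
definition rewind_orcl :: "orcl \<Rightarrow> bool" where
  "rewind_orcl R \<longleftrightarrow>
    (\<forall>h n q. length q = 6 * n + 2 \<longrightarrow>
       (let a = R h (GOrc1 n) q in
         valid_round1 n (take (3 * n + 1) q) (drop (3 * n + 1) q)
                        (take (3 * n + 1) a) (drop (3 * n + 1) a))) \<and>
    (\<forall>h n q. length q = 12 * n + 24 \<longrightarrow>
       (let ans = R h (GOrc2 n) q; a = take (6 * n + 2) q;
            ob = take (6 * n + 2) (drop (6 * n + 2) q); bs = drop (12 * n + 4) q in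
         length ans = 2 \<and>
         (\<forall>C. (GOrc1 n, a, ob) \<in> set h \<and>
              valid_round1 n (take (3 * n + 1) a) (drop (3 * n + 1) a)
                             (take (3 * n + 1) ob) (drop (3 * n + 1) ob) \<and>
              encodes_clifford bs C \<longrightarrow>
              valid_round2 n (take (3 * n + 1) a) (drop (3 * n + 1) a)
                             (take (3 * n + 1) ob) (drop (3 * n + 1) ob) C (ans ! 0) (ans ! 1))))"

end

(* The X and Y measurements of round 1 act on the axis (X, Y or Z) of the stabiliser state of each
   half of the line as a transposition and a 3-cycle, which generate S_3, whatever the outcomes are.
   So the query word moves the axis by a product of elements of S_3, and the number of ones modulo 3
   (modulo 2) is encoded by powers of the 3-cycle (of a transposition).

   The two middle qubits are left in CZ (l (x) r) with l on axis P and r on axis Q. Rewinding asks for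
   the outcomes of all six lines of the Mermin square; these cannot be consistent, so some entry gets
   two different values and hence is none of P (x) I, I (x) Q, P (x) Q up to sign.

   Both halves encode the same word, masked by independent uniform g_i in S_3, as
   g_i v_i g_{i-1}^-1. If P_i is the true axis after i letters, then replacing every g_i by g_i t_i,
   where t_i is the transposition fixing P_i, does not change the query, but after unmasking it moves
   the excluded observable by t_i. Whichever observable the oracle sacrifices, the likelihood of each
   wrong axis thus drops by the factor 9/10 on average relative to that of the true one, and
   logarithmically many experiments determine the axis with inverse polynomial error.

   By a union bound over all inputs, a polynomial table of mask samples indexed by logarithmically
   many random bits is as good as uniform samples. All processing outside the oracle is then given by
   functions of O(log k) bits, which have polynomial size disjunctive normal forms. *)

theory Submission
  imports Defs "HOL-Library.FuncSet"
begin

section \<open>The two middle qubits after round 1\<close>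

text \<open>The obstacle is that the oracle is adaptive and decides itself which entry of the square
  it sacrifices, so a fixed statistic of its answers may reveal nothing. What it cannot control is
  which of the masks compatible with its query was used. The two involutions act independently, so
  an excluded observable stands for its whole orbit, and \<open>weight\<close> is tuned so that each
  of the three orbit types yields exactly 9/10. The bound holds for every query history; therefore
  ratios multiply along an adaptive run. Only logarithmically many experiments per gate are
  affordable, because the comparison of likelihoods has to be a small normal form of the answers.
  The remaining inverse polynomial error still allows a union bound over the gates. For a fixed
  input the whole simulation is a deterministic function of the samples, which is why a table fixed
  in advance makes sense despite adaptivity. The table also avoids sampling from a set whose size is
  not a power of two.\<close>

definition sg :: "bool \<Rightarrow> complex" where "sg b = (if b then -1 else 1)"

lemma sg_simps [simp]: "sg True = -1" "sg False = 1"
  by (simp_all add: sg_def)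

lemma sg_nonzero [simp]: "sg b \<noteq> 0"
  by (simp add: sg_def)

text \<open>The unnormalised eigenvector of \<open>basis_obs A\<close> for outcome
  \<open>ob\<close>, as a bra; hence the factor 1/2 whenever it is paired with its
  \<open>ket\<close>.\<close>

definition bra :: "bool \<Rightarrow> bool \<Rightarrow> bool \<Rightarrow> complex" where
  "bra A ob y = (if y then sg ob * (if A then - \<i> else 1) else 1)"

definition ket :: "bool \<Rightarrow> bool \<Rightarrow> bool \<Rightarrow> complex" where
  "ket A ob y = cnj (bra A ob y)"

lemma proj_obs_basis: "proj_obs (basis_obs A) ob a b = ket A ob a * bra A ob b / 2"
  by (cases A; cases ob; cases a; cases b)
     (simp_all add: proj_obs_def basis_obs_def pauliX_def pauliY_def id1_def ket_def bra_def)

text \<open>Contracts a chain qubit in state \<open>v\<close> with its measurement bra and with the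
  controlled-Z edge to the next qubit; what remains is the state teleported to that qubit.\<close>

definition meas_step :: "(bool \<Rightarrow> complex) \<Rightarrow> bool \<times> bool \<Rightarrow> (bool \<Rightarrow> complex)" where
  "meas_step v w = (\<lambda>b. \<Sum>y\<in>UNIV. v y * bra (fst w) (snd w) y * sg (y \<and> b))"

abbreviation chain_vec :: "(bool \<Rightarrow> complex) \<Rightarrow> (bool \<times> bool) list \<Rightarrow> (bool \<Rightarrow> complex)" where
  "chain_vec \<equiv> foldl meas_step"

text \<open>Serves to pull the sum over a freshly projected qubit out of the contraction of the
  qubits behind it.\<close>

lemma chain_vec_linear:
  "chain_vec (\<lambda>b. \<Sum>y\<in>S. c y * u y b) ws b = (\<Sum>y\<in>S. c y * chain_vec (u y) ws b)"
proof (induction ws arbitrary: u)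
  case (Cons w ws)
  have "meas_step (\<lambda>b. \<Sum>y\<in>S. c y * u y b) w = (\<lambda>b. \<Sum>y\<in>S. c y * meas_step (u y) w b)"
    unfolding meas_step_def
    by (rule ext) (simp add: UNIV_bool sum_distrib_left sum_distrib_right sum.distrib algebra_simps)
  then show ?case using Cons.IH by simp
qed simp

text \<open>Amplitude of a half chain whose first \<open>j\<close> qubits are still unmeasured and whose remaining
  qubits have been projected; \<open>v\<close> is the vector on the first qubit, \<open>c\<close> the bit of the middle qubit.\<close>
fun half_chain :: "(bool \<Rightarrow> complex) \<Rightarrow> nat \<Rightarrow> (bool \<times> bool) list \<Rightarrow> bool list \<Rightarrow> bool \<Rightarrow> complex" where
  "half_chain v 0 ws u c =
     (\<Prod>p\<leftarrow>zip ws u. ket (fst (fst p)) (snd (fst p)) (snd p) / 2) * chain_vec v ws c"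
| "half_chain v (Suc j) (w # ws) (a # u) c = v a * half_chain (\<lambda>b. sg (a \<and> b)) j ws u c"
| "half_chain v (Suc j) ws u c = v c"

text \<open>The ket of the projected qubit joins the product in front, and its bra turns the open
  sum over that qubit into one more \<open>meas_step\<close>.\<close>

lemma half_chain_project:
  assumes "j < length ws" "length u = length ws"
  shows "(\<Sum>b\<in>UNIV. proj_obs (basis_obs (fst (ws ! j))) (snd (ws ! j)) (u ! j) b
            * half_chain v (Suc j) ws (u[j := b]) c) = half_chain v j ws u c"
  using assms
proof (induction j arbitrary: v ws u)
  case 0
  then obtain w ws' a u' where *: "ws = w # ws'" "u = a # u'"
    by (cases ws; cases u) auto
  let ?K = "\<Prod>p\<leftarrow>zip ws' u'. ket (fst (fst p)) (snd (fst p)) (snd p) / 2"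
  have "chain_vec (meas_step v w) ws' c =
     (\<Sum>y\<in>UNIV. (v y * bra (fst w) (snd w) y) * chain_vec (\<lambda>b. sg (y \<and> b)) ws' c)"
    by (subst chain_vec_linear[symmetric]) (simp only: meas_step_def)
  then show ?case
    by (simp add: * proj_obs_basis UNIV_bool algebra_simps)
next
  case (Suc j)
  then obtain w ws' a u' where *: "ws = w # ws'" "u = a # u'"
    by (cases ws; cases u) auto
  have "(\<Sum>b\<in>UNIV. proj_obs (basis_obs (fst (ws' ! j))) (snd (ws' ! j)) (u' ! j) b
            * half_chain (\<lambda>b. sg (a \<and> b)) (Suc j) ws' (u'[j := b]) c)
        = half_chain (\<lambda>b. sg (a \<and> b)) j ws' u' c"
    using Suc by (intro Suc.IH) (auto simp: *)
  then show ?case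
    by (simp add: * sum_distrib_left mult.left_commute flip: sum_distrib_left)
qed

section \<open>Edge signs of the line graph state\<close>

fun edge_prod :: "bool list \<Rightarrow> complex" where
  "edge_prod (a # b # xs) = sg (a \<and> b) * edge_prod (b # xs)"
| "edge_prod _ = 1"

lemma edge_prod_eq: "(\<Prod>k<length x - 1. if x ! k \<and> x ! Suc k then -1 else 1) = edge_prod x"
proof (induction x rule: edge_prod.induct)
  case (1 a b xs)
  have "(\<Prod>k<length (a # b # xs) - 1. if (a # b # xs) ! k \<and> (a # b # xs) ! Suc k then -1 else 1)
     = sg (a \<and> b) * (\<Prod>k<length (b # xs) - 1. if (b # xs) ! k \<and> (b # xs) ! Suc k then -1 else (1::complex))"
    by (simp add: prod.lessThan_Suc_shift sg_def del: prod.lessThan_Suc)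
  then show ?case using 1 by simp
qed auto

lemma edge_prod_append: "edge_prod (xs @ y # ys) = edge_prod (xs @ [y]) * edge_prod (y # ys)"
  by (induction xs rule: edge_prod.induct) auto

lemma edge_prod_rev: "edge_prod (rev xs) = edge_prod xs"
proof (induction xs rule: edge_prod.induct)
  case (1 a b xs)
  have "edge_prod (rev (a # b # xs)) = edge_prod (rev xs @ b # [a])"
    by simp
  also have "\<dots> = edge_prod (rev xs @ [b]) * edge_prod [b, a]"
    by (rule edge_prod_append)
  finally show ?case using 1 by (simp add: conj_commute mult.commute)
qed auto

lemma half_chain_unmeasured:
  assumes "length u = length ws"
  shows "half_chain (\<lambda>b. sg (a \<and> b)) (length ws) ws u c = edge_prod (a # u @ [c])"
  using assms
  by (induction ws arbitrary: u a) (auto simp: length_Suc_conv)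

lemma half_chain_unmeasured_plus:
  assumes "length u = length ws"
  shows "half_chain (\<lambda>_. 1) (length ws) ws u c = edge_prod (u @ [c])"
  using half_chain_unmeasured[OF assms, of False c]
  by (cases u) simp_all

lemma rev_drop_update:
  assumes "i < k" "length x = L + k"
  shows "rev (drop L (x[L + k - 1 - i := b])) = (rev (drop L x))[i := b]"
  using assms by (simp add: drop_update_swap rev_update)

text \<open>\<open>foldr\<close> applies the projectors of the largest index first, so the qubits
  next to the middle pair are measured first and the induction runs downwards from the unmeasured
  chain. The right half is read in reverse because its qubits are numbered from the right
  end.\<close>

lemma round1_state:
  assumes len: "length A = 3*n+1" "length B = 3*n+1" "length OA = 3*n+1" "length OB = 3*n+1"
    and x: "length x = 6*n+4" and j: "j \<le> 3*n+1"
  shows "foldr (\<lambda>i \<phi>. apply1 i (proj_obs (basis_obs (A ! i)) (OA ! i))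
                    (apply1 (6 * n + 3 - i) (proj_obs (basis_obs (B ! i)) (OB ! i)) \<phi>))
           [j..<3 * n + 1] (graph_state_line (6*n+4)) x =
     complex_of_real (2 powr (- real (6*n+4) / 2)) *
     half_chain (\<lambda>_. 1) j (zip A OA) (take (3*n+1) x) (x ! (3*n+1)) *
     half_chain (\<lambda>_. 1) j (zip B OB) (rev (drop (3*n+3) x)) (x ! (3*n+2)) *
     sg (x ! (3*n+1) \<and> x ! (3*n+2))"
  using j x
proof (induction j arbitrary: x rule: inc_induct)
  case base
  let ?u = "take (3*n+1) x" and ?v = "drop (3*n+3) x" and ?p = "x ! (3*n+1)" and ?q = "x ! (3*n+2)"
  \<comment> \<open>Splitting around the two middle qubits leaves a single edge between the
    halves.\<close>
  have xe: "x = ?u @ ?p # ?q # ?v"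
  proof (rule nth_equalityI)
    fix i assume "i < length x"
    then consider "i < 3*n+1" | "i = 3*n+1" | "i = 3*n+2" | d where "i = 3*n+3+d"
    proof (cases "3*n+3 \<le> i")
      case True
      then show ?thesis using le_Suc_ex that(4) by blast
    next
      case False
      then have "i < 3*n+1 \<or> i = 3*n+1 \<or> i = 3*n+2" by linarith
      then show ?thesis using that by blast
    qed
    then show "x ! i = (?u @ ?p # ?q # ?v) ! i"
      by cases (auto simp: nth_append base nth_Cons' numeral_eq_Suc)
  qed (simp add: base)
  have "edge_prod x = edge_prod (?u @ ?p # ?q # ?v)"
    by (rule arg_cong[OF xe])
  also have "\<dots> = edge_prod (?u @ [?p]) * sg (?p \<and> ?q) * edge_prod (?q # ?v)"
    by (subst edge_prod_append) simp
  also have "edge_prod (?q # ?v) = edge_prod (rev ?v @ [?q])"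
    using edge_prod_rev[of "?q # ?v"] by simp
  finally have e: "edge_prod x = edge_prod (?u @ [?p]) * sg (?p \<and> ?q) * edge_prod (rev ?v @ [?q])" .
  have "half_chain (\<lambda>_. 1) (3*n+1) (zip A OA) ?u ?p = edge_prod (?u @ [?p])"
    using half_chain_unmeasured_plus[of ?u "zip A OA" ?p] len base by simp
  moreover have "half_chain (\<lambda>_. 1) (3*n+1) (zip B OB) (rev ?v) ?q = edge_prod (rev ?v @ [?q])"
    using half_chain_unmeasured_plus[of "rev ?v" "zip B OB" ?q] len base by simp
  moreover have "graph_state_line (6*n+4) x = complex_of_real (2 powr (- real (6*n+4) / 2)) * edge_prod x"
    using edge_prod_eq[of x] base by (simp add: graph_state_line_def)
  ultimately show ?case
    by (simp add: e)
next
  case (step j)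
  let ?K = "complex_of_real (2 powr (- real (6*n+4) / 2))"
  let ?m = "3*n+1"
  let ?F = "\<lambda>i \<phi>. apply1 i (proj_obs (basis_obs (A ! i)) (OA ! i))
                    (apply1 (6 * n + 3 - i) (proj_obs (basis_obs (B ! i)) (OB ! i)) \<phi>)"
  let ?\<Phi> = "foldr ?F [Suc j..<?m] (graph_state_line (6*n+4))"
  let ?M = "x ! ?m" and ?M' = "x ! (3*n+2)"
  let ?u = "take ?m x" and ?v = "rev (drop (3*n+3) x)"
  let ?PA = "proj_obs (basis_obs (A ! j)) (OA ! j) (x ! j)"
  let ?PB = "proj_obs (basis_obs (B ! j)) (OB ! j) (x ! (6*n+3-j))"
  have jl: "j < ?m" and xl: "length x = 6*n+4" using step by auto
  have "foldr ?F [j..<?m] (graph_state_line (6*n+4)) x = ?F j ?\<Phi> x"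
    by (simp only: upt_conv_Cons[OF jl] foldr_Cons o_apply)
  also have "\<dots> = (\<Sum>b\<in>UNIV. ?PA b * (\<Sum>b'\<in>UNIV. ?PB b' * ?\<Phi> (x[j := b, 6*n+3-j := b'])))"
  proof -
    have "apply1 j P (apply1 (6*n+3-j) Q \<Phi>) x =
       (\<Sum>b\<in>UNIV. P (x!j) b * (\<Sum>b'\<in>UNIV. Q (x!(6*n+3-j)) b' * \<Phi> (x[j := b, 6*n+3-j := b'])))" for P Q \<Phi>
    proof -
      have "6*n+3-j < 6*n+4" "j \<noteq> 6*n+3-j" "j < 6*n+4" using jl by linarith+
      then show ?thesis using xl by (simp add: apply1_def)
    qed
    then show ?thesis by blast
  qed
  also have "\<dots> = (\<Sum>b\<in>UNIV. ?PA b * (\<Sum>b'\<in>UNIV. ?PB b' *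
       (?K * half_chain (\<lambda>_. 1) (Suc j) (zip A OA) (?u[j := b]) ?M *
         half_chain (\<lambda>_. 1) (Suc j) (zip B OB) (?v[j := b']) ?M' * sg (?M \<and> ?M'))))"
  proof -
    have "?\<Phi> (x[j := b, 6*n+3-j := b']) =
         ?K * half_chain (\<lambda>_. 1) (Suc j) (zip A OA) (?u[j := b]) ?M *
         half_chain (\<lambda>_. 1) (Suc j) (zip B OB) (?v[j := b']) ?M' * sg (?M \<and> ?M')" for b b'
    proof -
      have "drop (3*n+3) (x[j := b, 6*n+3-j := b']) = drop (3*n+3) (x[6*n+3-j := b'])"
        using jl by (subst list_update_swap) auto
      then have "rev (drop (3*n+3) (x[j := b, 6*n+3-j := b'])) = ?v[j := b']"
        using rev_drop_update[of j ?m x "3*n+3" b'] jl xl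
        by (simp add: algebra_simps eval_nat_numeral)
      moreover have "take ?m (x[j := b, 6*n+3-j := b']) = ?u[j := b]"
      proof -
        have "?m \<le> 6*n+3-j" using jl by linarith
        then show ?thesis using take_update_cancel take_update_swap by metis
      qed
      ultimately show ?thesis
        using step.IH[of "x[j := b, 6*n+3-j := b']"] jl xl by simp
    qed
    then show ?thesis by simp
  qed
  also have "\<dots> = ?K *
      (\<Sum>b\<in>UNIV. ?PA b * half_chain (\<lambda>_. 1) (Suc j) (zip A OA) (?u[j := b]) ?M) *
      (\<Sum>b'\<in>UNIV. ?PB b' * half_chain (\<lambda>_. 1) (Suc j) (zip B OB) (?v[j := b']) ?M') * sg (?M \<and> ?M')"
    by (simp add: UNIV_bool algebra_simps)
  also have "(\<Sum>b\<in>UNIV. ?PA b * half_chain (\<lambda>_. 1) (Suc j) (zip A OA) (?u[j := b]) ?M)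
      = half_chain (\<lambda>_. 1) j (zip A OA) ?u ?M"
    using half_chain_project[of j "zip A OA" ?u "\<lambda>_. 1" ?M] jl xl len by simp
  also have "(\<Sum>b'\<in>UNIV. ?PB b' * half_chain (\<lambda>_. 1) (Suc j) (zip B OB) (?v[j := b']) ?M')
      = half_chain (\<lambda>_. 1) j (zip B OB) ?v ?M'"
  proof -
    have "?v ! j = x ! (6*n+3-j)"
      using jl xl by (simp add: rev_nth)
    then show ?thesis
      using half_chain_project[of j "zip B OB" ?v "\<lambda>_. 1" ?M'] jl xl len by simp
  qed
  finally show ?case .
qed

section \<open>Stabiliser axes of the half chains\<close>

datatype axis = AX | AY | AZ

text \<open>The vector is an eigenvector of the Pauli matrix of the axis. The sign \<open>s\<close>
  of the eigenvalue stays existential, since it is all that the measurement outcomes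
  influence.\<close>

definition on_axis :: "(bool \<Rightarrow> complex) \<Rightarrow> axis \<Rightarrow> bool" where
  "on_axis l P = (case P of
      AX \<Rightarrow> l False \<noteq> 0 \<and> (\<exists>s. l True = sg s * l False)
    | AY \<Rightarrow> l False \<noteq> 0 \<and> (\<exists>s. l True = sg s * \<i> * l False)
    | AZ \<Rightarrow> (\<exists>s. l s \<noteq> 0 \<and> l (\<not> s) = 0))"

text \<open>Measuring a chain qubit in the \<open>X\<close> (\<open>Y\<close>) basis teleports its state through
  \<open>H\<close> (through \<open>H S\<close>), up to a Pauli operator.\<close>
fun axis_step :: "bool \<Rightarrow> axis \<Rightarrow> axis" where
  "axis_step False AX = AZ" | "axis_step False AY = AY" | "axis_step False AZ = AX"
| "axis_step True AX = AY" | "axis_step True AY = AZ" | "axis_step True AZ = AX"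

lemma sum_UNIV_bool: "(\<Sum>y\<in>UNIV. f y) = f False + (f True :: complex)"
  by (simp add: UNIV_bool add.commute)

text \<open>The outcome enters only as a sign next to that of the eigenvalue and so never changes
  the axis. Where the new amplitudes are 1 + i and 1 - i up to order and a common factor, their
  quotient is i or -i, and the axis is \<open>AY\<close>.\<close>

lemma on_axis_step:
  assumes "on_axis l P"
  shows "on_axis (meas_step l (A, ob)) (axis_step A P)"
proof -
  have m: "meas_step l (A, ob) b = l False + l True * bra A ob True * sg b" for b
    by (simp add: meas_step_def sum_UNIV_bool bra_def)
  show ?thesis
  proof (cases P)
    case AX
    then obtain s where s: "l False \<noteq> 0" "l True = sg s * l False"
      using assms by (auto simp: on_axis_def)
    show ?thesis
    proof (cases A)
      case False
      then have "meas_step l (A, ob) b = l False * (1 + sg s * sg ob * sg b)" for b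
        unfolding m by (simp add: s bra_def algebra_simps)
      with False AX s(1) show ?thesis
        by (auto simp: on_axis_def sg_def)
    next
      case True
      then have "meas_step l (A, ob) b = l False * (1 - sg s * sg ob * sg b * \<i>)" for b
        unfolding m by (simp add: s bra_def algebra_simps)
      then have "meas_step l (A, ob) False = l False * (1 - sg s * sg ob * \<i>)"
        "meas_step l (A, ob) True = l False * (1 + sg s * sg ob * \<i>)" by simp_all
      moreover have "1 + sg s * sg ob * \<i> = sg (s \<noteq> ob) * \<i> * (1 - sg s * sg ob * \<i>)"
        by (auto simp: sg_def algebra_simps)
      moreover have "1 - sg s * sg ob * \<i> \<noteq> 0"
        by (auto simp: sg_def complex_eq_iff)
      ultimately show ?thesis using True AX s(1)
        by (auto simp: on_axis_def intro!: exI[of _ "s \<noteq> ob"])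
    qed
  next
    case AY
    then obtain s where s: "l False \<noteq> 0" "l True = sg s * \<i> * l False"
      using assms by (auto simp: on_axis_def)
    show ?thesis
    proof (cases A)
      case False
      then have "meas_step l (A, ob) b = l False * (1 + sg s * sg ob * sg b * \<i>)" for b
        unfolding m by (simp add: s bra_def algebra_simps)
      then have "meas_step l (A, ob) False = l False * (1 + sg s * sg ob * \<i>)"
        "meas_step l (A, ob) True = l False * (1 - sg s * sg ob * \<i>)" by simp_all
      moreover have "1 - sg s * sg ob * \<i> = sg (s = ob) * \<i> * (1 + sg s * sg ob * \<i>)"
        by (auto simp: sg_def algebra_simps)
      moreover have "1 + sg s * sg ob * \<i> \<noteq> 0"
        by (auto simp: sg_def complex_eq_iff)
      ultimately show ?thesis using False AY s(1)
        by (auto simp: on_axis_def intro!: exI[of _ "s = ob"])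
    next
      case True
      then have "meas_step l (A, ob) b = l False * (1 + sg s * sg ob * sg b)" for b
        unfolding m by (simp add: s bra_def algebra_simps)
      with True AY s(1) show ?thesis
        by (auto simp: on_axis_def sg_def)
    qed
  next
    case AZ
    then obtain s where s: "l s \<noteq> 0" "l (\<not> s) = 0"
      using assms by (auto simp: on_axis_def)
    show ?thesis
    proof (cases s)
      case True
      then have "meas_step l (A, ob) b = l True * bra A ob True * sg b" for b
        unfolding m using s by simp
      moreover have "bra A ob True \<noteq> 0" by (simp add: bra_def)
      ultimately show ?thesis using AZ True s
        by (cases A) (auto simp: on_axis_def intro!: exI[of _ True])
    next
      case False
      then have "meas_step l (A, ob) b = l False" for b
        unfolding m using s by simp
      then show ?thesis using AZ False s
        by (cases A) (auto simp: on_axis_def intro!: exI[of _ False])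
    qed
  qed
qed

definition word_axis :: "bool list \<Rightarrow> axis \<Rightarrow> axis" where
  "word_axis A P = foldl (\<lambda>P a. axis_step a P) P A"

lemma on_axis_chain:
  assumes "on_axis l P" "length OA = length A"
  shows "on_axis (chain_vec l (zip A OA)) (word_axis A P)"
  using assms(2,1)
  by (induction OA A arbitrary: l P rule: list_induct2) (simp_all add: on_axis_step word_axis_def)

section \<open>Clifford words for the magic square\<close>

datatype cliff_gen = GenCZ | GenH1 | GenH2

definition rsqrt2 :: complex where "rsqrt2 = complex_of_real (sqrt 2 / 2)"

lemma rsqrt2_simps [simp]:
  "rsqrt2 * rsqrt2 = 1 / 2" "rsqrt2 * (rsqrt2 * x) = x / 2" "rsqrt2 \<noteq> 0" "cnj rsqrt2 = rsqrt2"
proof -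
  show *: "rsqrt2 * rsqrt2 = 1 / 2"
    unfolding rsqrt2_def of_real_mult[symmetric] by simp
  then show "rsqrt2 * (rsqrt2 * x) = x / 2"
    by (simp flip: mult.assoc)
  show "rsqrt2 \<noteq> 0" "cnj rsqrt2 = rsqrt2"
    by (simp_all add: rsqrt2_def)
qed

definition had :: mat1 where "had a b = rsqrt2 * sg (a \<and> b)"

fun gen_mat :: "cliff_gen \<Rightarrow> mat2" where
  "gen_mat GenCZ = (\<lambda>p q. if p = q then sg (fst p \<and> snd p) else 0)"
| "gen_mat GenH1 = kron had id1"
| "gen_mat GenH2 = kron id1 had"

text \<open>The sign bit is corrected because \<open>pauli1 True True\<close> is
  \<open>pauliY\<close> rather than the product of X and Z; for instance, conjugation by
  \<open>had\<close> maps Y to -Y.\<close>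

fun gen_tab :: "cliff_gen \<Rightarrow> bool list \<Rightarrow> bool list" where
  "gen_tab GenCZ [a, b, c, d, e] = [a, b \<noteq> c, c, d \<noteq> a, e \<noteq> (a \<and> c \<and> b \<noteq> d)]"
| "gen_tab GenH1 [a, b, c, d, e] = [b, a, c, d, e \<noteq> (a \<and> b)]"
| "gen_tab GenH2 [a, b, c, d, e] = [a, b, d, c, e \<noteq> (c \<and> d)]"
| "gen_tab _ v = v"

lemma UNIV_bool2: "(UNIV :: (bool \<times> bool) set) = {(False,False),(False,True),(True,False),(True,True)}"
  by (auto simp: set_eq_iff)

lemma sum_UNIV_bool2:
  "(\<Sum>p\<in>UNIV. f p) = f (False,False) + f (False,True) + f (True,False) + (f (True,True) :: complex)"
  by (simp add: UNIV_bool2 add.assoc)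

lemma mmul2_assoc: "mmul2 (mmul2 A B) C = mmul2 A (mmul2 B C)"
  by (intro ext) (simp add: mmul2_def sum_UNIV_bool2 algebra_simps)

lemma adj2_mmul2: "adj2 (mmul2 A B) = mmul2 (adj2 B) (adj2 A)"
  by (intro ext) (simp add: mmul2_def adj2_def sum_UNIV_bool2 algebra_simps)

lemma mmul2_id2 [simp]: "mmul2 id2 A = A" "mmul2 A id2 = A"
  by (intro ext; auto simp: mmul2_def id2_def sum_UNIV_bool2)+

lemma adj2_id2 [simp]: "adj2 id2 = id2"
  by (intro ext) (auto simp: adj2_def id2_def)

lemma conj2_mmul2: "conj2 (mmul2 A B) P = conj2 A (conj2 B P)"
  by (simp add: conj2_def adj2_mmul2 mmul2_assoc)

lemma unitary2_gen: "unitary2 (gen_mat g)"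
  unfolding unitary2_def
  by (intro ext; cases g)
     (auto simp: mmul2_def adj2_def id2_def sum_UNIV_bool2 kron_def had_def id1_def sg_def)

definition mul1 :: "mat1 \<Rightarrow> mat1 \<Rightarrow> mat1" where
  "mul1 M N a b = M a False * N False b + M a True * N True b"

lemma mat1_eqI:
  "M False False = N False False \<Longrightarrow> M False True = N False True \<Longrightarrow>
   M True False = N True False \<Longrightarrow> M True True = N True True \<Longrightarrow> M = (N :: mat1)"
  by (intro ext, rename_tac a b, case_tac a; case_tac b; simp)

lemma mmul2_kron: "mmul2 (kron A B) (kron C D) = kron (mul1 A C) (mul1 B D)"
  by (intro ext) (simp add: mmul2_def kron_def mul1_def sum_UNIV_bool2 algebra_simps)

lemma conj2_kron:
  assumes "\<And>a b. cnj (A b a) = A a b" "\<And>a b. cnj (B b a) = B a b"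
  shows "conj2 (kron A B) (\<lambda>p q. c * kron P Q p q) =
     (\<lambda>p q. c * kron (mul1 (mul1 A P) A) (mul1 (mul1 B Q) B) p q)"
proof -
  have "adj2 (kron A B) = kron A B"
    by (intro ext) (simp add: adj2_def kron_def assms)
  moreover have "mmul2 M (\<lambda>p q. c * N p q) = (\<lambda>p q. c * mmul2 M N p q)"
    "mmul2 (\<lambda>p q. c * N p q) M = (\<lambda>p q. c * mmul2 N M p q)" for M N
    by (intro ext, simp add: mmul2_def sum_UNIV_bool2 algebra_simps)+
  ultimately show ?thesis
    by (simp add: conj2_def mmul2_kron)
qed

lemma had_conj: "mul1 (mul1 had (pauli1 x z)) had = (\<lambda>a b. (if x \<and> z then -1 else 1) * pauli1 z x a b)"
  by (rule mat1_eqI; cases x; cases z)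
     (simp_all add: mul1_def had_def pauli1_def pauliX_def pauliY_def pauliZ_def id1_def)

lemma id1_conj: "mul1 (mul1 id1 P) id1 = P"
  by (rule mat1_eqI) (simp_all add: mul1_def id1_def)

lemma conj2_GenCZ: "conj2 (gen_mat GenCZ) M p q = sg (fst p \<and> snd p) * M p q * sg (fst q \<and> snd q)"
  by (cases p; cases q; cases "fst p"; cases "snd p"; cases "fst q"; cases "snd q")
     (simp_all add: conj2_def mmul2_def adj2_def sum_UNIV_bool2)

lemma conj2_gen:
  assumes "length v = 5"
  shows "conj2 (gen_mat g) (pauli2 v) = pauli2 (gen_tab g v)"
proof -
  obtain a b c d e where v: "v = [a, b, c, d, e]"
    using assms by (auto simp: length_Suc_conv eval_nat_numeral)
  have p: "pauli2 v = (\<lambda>p q. (if e then -1 else 1) * kron (pauli1 a b) (pauli1 c d) p q)"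
    by (intro ext) (simp add: v pauli2_def)
  have h: "cnj (had b a) = had a b" "cnj (id1 b a) = id1 a b" for a b
    by (simp_all add: had_def id1_def sg_def conj_commute)
  show ?thesis
  proof (cases g)
    case GenCZ
    show ?thesis
    proof (intro ext)
      show "conj2 (gen_mat g) (pauli2 v) p q = pauli2 (gen_tab g v) p q" for p q
        unfolding GenCZ conj2_GenCZ v
        by (cases p; cases q; cases a; cases b; cases c; cases d; cases e)
           (auto simp add: pauli2_def kron_def pauli1_def pauliX_def pauliY_def pauliZ_def id1_def sg_def)
    qed
  next
    case GenH1
    show ?thesis
      unfolding p GenH1 gen_mat.simps conj2_kron[OF h(1) h(2)] had_conj id1_conj
      by (intro ext) (simp add: v pauli2_def kron_def)
  next
    case GenH2
    show ?thesis
      unfolding p GenH2 gen_mat.simps conj2_kron[OF h(2) h(1)] had_conj id1_conj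
      by (intro ext) (simp add: v pauli2_def kron_def)
  qed
qed

lemma length_gen_tab [simp]: "length (gen_tab g v) = length v"
  by (induction g v rule: gen_tab.induct) auto

text \<open>The head of a word acts first, in agreement with the left fold in
  \<open>word_tab\<close>.\<close>

fun word_mat :: "cliff_gen list \<Rightarrow> mat2" where
  "word_mat [] = id2"
| "word_mat (g # gs) = mmul2 (word_mat gs) (gen_mat g)"

definition word_tab :: "cliff_gen list \<Rightarrow> bool list \<Rightarrow> bool list" where
  "word_tab gs v = foldl (\<lambda>v g. gen_tab g v) v gs"

definition word_code :: "cliff_gen list \<Rightarrow> bool list" where
  "word_code gs = concat (map (word_tab gs) pauli_gens)"

lemma length_word_tab [simp]: "length (word_tab gs v) = length v"
  by (induction gs arbitrary: v) (simp_all add: word_tab_def)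

lemma conj2_word:
  assumes "length v = 5"
  shows "conj2 (word_mat gs) (pauli2 v) = pauli2 (word_tab gs v)"
  using assms
proof (induction gs arbitrary: v)
  case Nil
  then show ?case by (simp add: conj2_def word_tab_def)
qed (simp add: word_tab_def conj2_mmul2 conj2_gen)

lemma unitary2_word: "unitary2 (word_mat gs)"
proof (induction gs)
  case (Cons g gs)
  have "mmul2 (adj2 (word_mat (g # gs))) (word_mat (g # gs)) =
     mmul2 (adj2 (gen_mat g)) (mmul2 (mmul2 (adj2 (word_mat gs)) (word_mat gs)) (gen_mat g))"
    by (simp add: adj2_mmul2 mmul2_assoc)
  then show ?case using Cons unitary2_gen[of g] by (simp add: unitary2_def)
qed (simp add: unitary2_def)

text \<open>The round-2 guarantee of the oracle speaks about matrices encoded by the query bits;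
  this supplies such a matrix for each hard-wired word.\<close>

lemma encodes_clifford_word: "encodes_clifford (word_code gs) (word_mat gs)"
proof -
  have "clifford2 (word_mat gs)"
    unfolding clifford2_def using unitary2_word conj2_word length_word_tab by metis
  moreover have "take 5 (drop (5 * j) (word_code gs)) = word_tab gs (pauli_gens ! j)" if "j < 4" for j
  proof -
    have "j \<in> {0, 1, 2, 3}" using that by auto
    then show ?thesis
      by (auto simp: word_code_def pauli_gens_def)
  qed
  ultimately show ?thesis
    by (auto simp: encodes_clifford_def conj2_word pauli_gens_def nth_Cons' word_code_def)
qed

lemma length_word_code [simp]: "length (word_code gs) = 20"
  by (simp add: word_code_def pauli_gens_def)

text \<open>On strings that agree outside the two middle bits the round-1 state is a fixed factor
  times a two-qubit state, and the X projectors have rank one. So every final amplitude is a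
  multiple of this one sum, and if it vanished, the whole state would.\<close>

lemma valid_round2_amp:
  assumes len: "length A = 3*n+1" "length B = 3*n+1" "length OA = 3*n+1" "length OB = 3*n+1"
    and v: "valid_round2 n A B OA OB C c1 c2"
  shows "(\<Sum>p\<in>UNIV. sg (c1 \<and> fst p) * sg (c2 \<and> snd p) * (\<Sum>q\<in>UNIV. C p q *
      (chain_vec (\<lambda>_. 1) (zip A OA) (fst q) * chain_vec (\<lambda>_. 1) (zip B OB) (snd q) * sg (fst q \<and> snd q)))) \<noteq> 0"
    (is "?amp \<noteq> 0")
proof
  assume z: "?amp = 0"
  let ?\<Psi> = "round1_proj n A B OA OB (graph_state_line (6 * n + 4))"
  let ?m = "3*n+1"
  let ?\<Phi> = "apply1 (3 * n + 1) (proj_obs pauliX c1)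
       (apply1 (3 * n + 2) (proj_obs pauliX c2) (apply2 (3 * n + 1) C ?\<Psi>))"
  have "?\<Phi> x = 0" for x
  proof (cases "length x = 6*n+4")
    \<comment> \<open>All operators keep the amplitudes zero off the strings of length 6n +
      4.\<close>
    case False
    have g: "graph_state_line (6 * n + 4) x = 0" if "length x \<noteq> 6*n+4" for x
      using that by (simp add: graph_state_line_def)
    have a: "apply1 k M \<phi> x = 0" if "\<And>x. length x \<noteq> 6*n+4 \<Longrightarrow> \<phi> x = 0" "length x \<noteq> 6*n+4" for k M \<phi> x
      using that by (simp add: apply1_def)
    have f: "foldr (\<lambda>i \<phi>. apply1 i (P i) (apply1 (Q i) (P' i) \<phi>)) is \<phi> x = 0"
      if "\<And>x. length x \<noteq> 6*n+4 \<Longrightarrow> \<phi> x = 0" "length x \<noteq> 6*n+4" for "is" P Q P' \<phi> x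
      using that
    proof (induction "is" arbitrary: x)
      case (Cons i "is")
      show ?case unfolding foldr_Cons o_apply
        by (intro a Cons.IH Cons.prems)
    qed auto
    have r: "?\<Psi> x = 0" if "length x \<noteq> 6*n+4" for x
      unfolding round1_proj_def by (rule f[OF g that])
    have "apply2 (3*n+1) C ?\<Psi> x = 0" if "length x \<noteq> 6*n+4" for x
      using r that by (simp add: apply2_def)
    then show ?thesis by (intro a False)
  next
    case True
    let ?K = "complex_of_real (2 powr (- real (6*n+4) / 2))"
    let ?u = "take (3*n+1) x" and ?v = "rev (drop (3*n+3) x)"
    let ?kl = "\<Prod>p\<leftarrow>zip (zip A OA) ?u. ket (fst (fst p)) (snd (fst p)) (snd p) / 2"
    let ?kr = "\<Prod>p\<leftarrow>zip (zip B OB) ?v. ket (fst (fst p)) (snd (fst p)) (snd p) / 2"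
    let ?l = "chain_vec (\<lambda>_. 1) (zip A OA)" and ?r = "chain_vec (\<lambda>_. 1) (zip B OB)"
    let ?\<psi> = "\<lambda>q. ?l (fst q) * ?r (snd q) * sg (fst q \<and> snd q)"
    have st: "?\<Psi> (x[?m := a, Suc ?m := b]) = ?K * ?kl * ?kr * ?\<psi> (a, b)" for a b
    proof -
      let ?y = "x[?m := a, Suc ?m := b]"
      have "take ?m ?y = ?u" "drop (3*n+3) ?y = drop (3*n+3) x" "?y ! ?m = a" "?y ! (3*n+2) = b"
        using True by simp_all
      then show ?thesis
        using round1_state[OF len, of ?y 0] True unfolding round1_proj_def
        by (simp add: mult_ac)
    qed
    have p: "proj_obs pauliX c a b = sg (c \<and> a) * sg (c \<and> b) / 2" for c a b
      by (cases c; cases a; cases b) (simp_all add: proj_obs_def pauliX_def id1_def)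
    have "?\<Phi> x = (\<Sum>a\<in>UNIV. proj_obs pauliX c1 (x ! ?m) a * (\<Sum>b\<in>UNIV. proj_obs pauliX c2 (x ! Suc ?m) b *
       (\<Sum>q\<in>UNIV. C (a, b) q * ?\<Psi> (x[?m := fst q, Suc ?m := snd q]))))"
    proof -
      have sw: "x[?m := a, Suc ?m := b, ?m := c, Suc ?m := d] = x[?m := c, Suc ?m := d]" for a b c d
        by (metis list_update_overwrite list_update_swap n_not_Suc_n)
      have "apply1 ?m M (apply1 (3*n+2) M' (apply2 ?m C \<Psi>)) x =
         (\<Sum>a\<in>UNIV. M (x ! ?m) a * (\<Sum>b\<in>UNIV. M' (x ! Suc ?m) b *
       (\<Sum>q\<in>UNIV. C (a, b) q * \<Psi> (x[?m := fst q, Suc ?m := snd q]))))" for M M' \<Psi>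
        using True sw by (simp add: apply1_def apply2_def)
      then show ?thesis by blast
    qed
    also have "\<dots> = ?K * ?kl * ?kr * sg (c1 \<and> x ! ?m) * sg (c2 \<and> x ! Suc ?m) / 4 * ?amp"
      unfolding st prod.collapse p by (simp add: sum_UNIV_bool sum_UNIV_bool2 field_simps)
    finally show ?thesis using z by simp
  qed
  then have "?\<Phi> = (\<lambda>_. 0)" by (rule ext)
  with v show False unfolding valid_round2_def by contradiction
qed

definition gen_act :: "cliff_gen \<Rightarrow> (bool \<times> bool \<Rightarrow> complex) \<Rightarrow> (bool \<times> bool \<Rightarrow> complex)" where
  "gen_act g \<phi> = (\<lambda>p. \<Sum>q\<in>UNIV. gen_mat g p q * \<phi> q)"

lemma word_mat_act:
  "(\<Sum>q\<in>UNIV. word_mat gs p q * \<phi> q) = foldl (\<lambda>\<phi> g. gen_act g \<phi>) \<phi> gs p"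
proof (induction gs arbitrary: \<phi>)
  case Nil
  then show ?case by (cases p rule: prod.exhaust; cases "fst p"; cases "snd p") (auto simp: id2_def sum_UNIV_bool2)
next
  case (Cons g gs)
  have "(\<Sum>q\<in>UNIV. word_mat (g # gs) p q * \<phi> q) = (\<Sum>q\<in>UNIV. word_mat gs p q * gen_act g \<phi> q)"
    by (simp add: gen_act_def mmul2_def sum_UNIV_bool2 algebra_simps)
  then show ?case using Cons by simp
qed

text \<open>The rows of the Mermin square are measured by words 0, 1, 2 and its columns by words
  3, 4, 5. Each word starts with \<open>CZ\<close>, which removes the edge between the two middle qubits
  (in word 2 it has cancelled); the rest maps the first two observables of the line to
  \<open>X \<otimes> I\<close> and \<open>I \<otimes> X\<close>:
  rows (XI, IX, XX), (ZI, IZ, ZZ), (XZ, ZX, YY) and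
  columns (XI, IZ, XZ), (ZI, IX, ZX), (XX, ZZ, -YY).\<close>
definition square_words :: "cliff_gen list list" where
  "square_words = [[GenCZ], [GenCZ, GenH1, GenH2], [], [GenCZ, GenH2], [GenCZ, GenH1], [GenCZ, GenH2, GenCZ]]"

definition outcome_amp ::
  "(bool \<Rightarrow> complex) \<Rightarrow> (bool \<Rightarrow> complex) \<Rightarrow> cliff_gen list \<Rightarrow> bool list \<Rightarrow> complex" where
  "outcome_amp l r w cs = (\<Sum>p\<in>UNIV. sg (cs ! 0 \<and> fst p) * sg (cs ! 1 \<and> snd p) *
      (\<Sum>q\<in>UNIV. word_mat w p q * (l (fst q) * r (snd q) * sg (fst q \<and> snd q))))"

lemma gen_act_simps:
  "gen_act GenCZ \<phi> = (\<lambda>p. sg (fst p \<and> snd p) * \<phi> p)"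
  "gen_act GenH1 \<phi> = (\<lambda>p. rsqrt2 * (\<phi> (False, snd p) + sg (fst p) * \<phi> (True, snd p)))"
  "gen_act GenH2 \<phi> = (\<lambda>p. rsqrt2 * (\<phi> (fst p, False) + sg (snd p) * \<phi> (fst p, True)))"
proof -
  have all: "f = g" if "f (False, False) = g (False, False)" "f (False, True) = g (False, True)"
    "f (True, False) = g (True, False)" "f (True, True) = g (True, True)"
    for f g :: "bool \<times> bool \<Rightarrow> complex"
  proof
    show "f p = g p" for p using that by (cases p; cases "fst p"; cases "snd p") auto
  qed
  show "gen_act GenCZ \<phi> = (\<lambda>p. sg (fst p \<and> snd p) * \<phi> p)"
    by (rule all) (simp_all add: gen_act_def sum_UNIV_bool2)
  show "gen_act GenH1 \<phi> = (\<lambda>p. rsqrt2 * (\<phi> (False, snd p) + sg (fst p) * \<phi> (True, snd p)))"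
    by (rule all) (simp_all add: gen_act_def sum_UNIV_bool2 kron_def had_def id1_def algebra_simps)
  show "gen_act GenH2 \<phi> = (\<lambda>p. rsqrt2 * (\<phi> (fst p, False) + sg (snd p) * \<phi> (fst p, True)))"
    by (rule all) (simp_all add: gen_act_def sum_UNIV_bool2 kron_def had_def id1_def algebra_simps)
qed

text \<open>Up to constants these are the overlaps of the product vector with the joint eigenvectors
  of the six lines of the square.\<close>

lemma outcome_amp_simps:
  "outcome_amp l r [GenCZ] cs = (l False + sg (cs!0) * l True) * (r False + sg (cs!1) * r True)"
  "outcome_amp l r [GenCZ, GenH1, GenH2] cs = 2 * l (cs!0) * r (cs!1)"
  "outcome_amp l r [] cs = l False * r False + sg (cs!1) * l False * r True +
      sg (cs!0) * l True * r False - sg (cs!0) * sg (cs!1) * l True * r True"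
  "outcome_amp l r [GenCZ, GenH2] cs = 2 * rsqrt2 * (l False + sg (cs!0) * l True) * r (cs!1)"
  "outcome_amp l r [GenCZ, GenH1] cs = 2 * rsqrt2 * l (cs!0) * (r False + sg (cs!1) * r True)"
  "outcome_amp l r [GenCZ, GenH2, GenCZ] cs =
     2 * rsqrt2 * (l False * r (cs!1) + sg (cs!0) * l True * r (\<not> cs!1))"
  unfolding outcome_amp_def word_mat_act
  by (cases "cs!0"; cases "cs!1"; simp add: gen_act_simps sum_UNIV_bool2; simp add: algebra_simps)+

text \<open>The parity of the disagreements over all nine entries is odd, so if the first eight
  entries agree then \<open>YY\<close> does not.\<close>
definition square_conflict :: "bool list list \<Rightarrow> axis option \<times> axis option" where
  "square_conflict as =
    (if as!0!0 \<noteq> as!3!0 then (Some AX, None)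
     else if as!0!1 \<noteq> as!4!1 then (None, Some AX)
     else if (as!0!0 \<noteq> as!0!1) \<noteq> as!5!0 then (Some AX, Some AX)
     else if as!1!0 \<noteq> as!4!0 then (Some AZ, None)
     else if as!1!1 \<noteq> as!3!1 then (None, Some AZ)
     else if (as!1!0 \<noteq> as!1!1) \<noteq> as!5!1 then (Some AZ, Some AZ)
     else if as!2!0 \<noteq> (as!3!0 \<noteq> as!3!1) then (Some AX, Some AZ)
     else if as!2!1 \<noteq> (as!4!0 \<noteq> as!4!1) then (Some AZ, Some AX)
     else (Some AY, Some AY))"

text \<open>An observable that stabilises the product state up to sign has a determined value, so
  outcomes of nonzero amplitude report this value in its row and in its column alike. An entry with
  two different values is no such observable.\<close>

lemma square_conflict_not_stabiliser:
  assumes "on_axis l P" "on_axis r Q"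
    and "\<forall>j<6. outcome_amp l r (square_words ! j) (as ! j) \<noteq> 0"
  shows "square_conflict as \<notin> {(None, None), (Some P, None), (None, Some Q), (Some P, Some Q)}"
proof -
  have nz: "outcome_amp l r [GenCZ] (as!0) \<noteq> 0" "outcome_amp l r [GenCZ, GenH1, GenH2] (as!1) \<noteq> 0"
    "outcome_amp l r [] (as!2) \<noteq> 0" "outcome_amp l r [GenCZ, GenH2] (as!3) \<noteq> 0"
    "outcome_amp l r [GenCZ, GenH1] (as!4) \<noteq> 0" "outcome_amp l r [GenCZ, GenH2, GenCZ] (as!5) \<noteq> 0"
    using assms(3)[rule_format, of 0] assms(3)[rule_format, of 1] assms(3)[rule_format, of 2]
      assms(3)[rule_format, of 3] assms(3)[rule_format, of 4] assms(3)[rule_format, of 5]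
    by (simp_all add: square_words_def)
  have AZ: "on_axis v AZ \<longleftrightarrow> (v False \<noteq> 0 \<and> v True = 0) \<or> (v False = 0 \<and> v True \<noteq> 0)" for v
    by (auto simp: on_axis_def ex_bool_eq)
  note nz = nz[unfolded outcome_amp_simps]
  have X1: "as!0!0 = as!3!0" if "P = AX"
    using assms(1) nz(1,4) that by (auto simp: on_axis_def sg_def split: if_splits)
  have X2: "as!0!1 = as!4!1" if "Q = AX"
    using assms(2) nz(1,5) that by (auto simp: on_axis_def sg_def split: if_splits)
  have Z1: "as!1!0 = as!4!0" if "P = AZ"
    using assms(1) nz(2,5) that by (auto simp: on_axis_def) metis+
  have Z2: "as!1!1 = as!3!1" if "Q = AZ"
    using assms(2) nz(2,4) that by (auto simp: on_axis_def) metis+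
  have XX: "(as!0!0 \<noteq> as!0!1) = as!5!0" if "P = AX" "Q = AX"
    using assms(1,2) nz(1,6) that
    by (cases "as!0!0"; cases "as!0!1"; cases "as!5!0"; cases "as!5!1") (auto simp: on_axis_def sg_def split: if_splits)
  have ZZ: "(as!1!0 \<noteq> as!1!1) = as!5!1" if "P = AZ" "Q = AZ"
    using assms(1,2) nz(2,6) that
    by (cases "as!1!0"; cases "as!1!1"; cases "as!5!0"; cases "as!5!1") (auto simp: AZ)
  have XZ: "as!2!0 = (as!3!0 \<noteq> as!3!1)" if "P = AX" "Q = AZ"
    using assms(1,2) nz(3,4) that
    by (cases "as!2!0"; cases "as!2!1"; cases "as!3!0"; cases "as!3!1") (auto simp: AZ, auto simp: on_axis_def sg_def split: if_splits)
  have ZX: "as!2!1 = (as!4!0 \<noteq> as!4!1)" if "P = AZ" "Q = AX"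
    using assms(1,2) nz(3,5) that
    by (cases "as!2!0"; cases "as!2!1"; cases "as!4!0"; cases "as!4!1") (auto simp: AZ, auto simp: on_axis_def sg_def split: if_splits)
  \<comment> \<open>The row yields YY as the product of XZ and ZX, the column yields it as minus the
    product of XX and ZZ. Hence different parities are the consistent case.\<close>
  have YY: "(as!2!0 \<noteq> as!2!1) \<noteq> (as!5!0 \<noteq> as!5!1)" if "P = AY" "Q = AY"
  proof -
    obtain s t where l: "l False \<noteq> 0" "l True = sg s * \<i> * l False"
      and r: "r False \<noteq> 0" "r True = sg t * \<i> * r False"
      using assms(1,2) \<open>P = AY\<close> \<open>Q = AY\<close> by (auto simp: on_axis_def)
    have "l False * r False * (1 + sg (as!2!1) * sg t * \<i> + sg (as!2!0) * sg s * \<i> + sg (as!2!0) * sg (as!2!1) * sg s * sg t) \<noteq> 0"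
      using nz(3) by (simp add: l r algebra_simps)
    then have a: "1 + sg (as!2!1) * sg t * \<i> + sg (as!2!0) * sg s * \<i> + sg (as!2!0) * sg (as!2!1) * sg s * sg t \<noteq> 0"
      by simp
    have "l False * r False * ((if as!5!1 then sg t * \<i> else 1) + sg (as!5!0) * sg s * \<i> * (if as!5!1 then 1 else sg t * \<i>)) \<noteq> 0"
    proof -
      have "l False * r (as!5!1) + sg (as!5!0) * l True * r (\<not> as!5!1) \<noteq> 0" using nz(6) by auto
      then show ?thesis by (cases "as!5!1") (simp_all add: l r algebra_simps)
    qed
    then have b: "(if as!5!1 then sg t * \<i> else 1) + sg (as!5!0) * sg s * \<i> * (if as!5!1 then 1 else sg t * \<i>) \<noteq> 0"
      by simp
    show ?thesis using a b
      by (cases s; cases t; cases "as!2!0"; cases "as!2!1"; cases "as!5!0"; cases "as!5!1") simp_all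
  qed
  \<comment> \<open>The cases follow the order of the tests in \<open>square_conflict\<close>; in
    the last one the eight agreements force the two parities for YY to be equal.\<close>
  consider  "\<not> (as!0!0 = as!3!0)"
    | "as!0!0 = as!3!0" "\<not> (as!0!1 = as!4!1)"
    | "as!0!0 = as!3!0" "as!0!1 = as!4!1" "\<not> ((as!0!0 \<noteq> as!0!1) = as!5!0)"
    | "as!0!0 = as!3!0" "as!0!1 = as!4!1" "(as!0!0 \<noteq> as!0!1) = as!5!0" "\<not> (as!1!0 = as!4!0)"
    | "as!0!0 = as!3!0" "as!0!1 = as!4!1" "(as!0!0 \<noteq> as!0!1) = as!5!0" "as!1!0 = as!4!0" "\<not> (as!1!1 = as!3!1)"
    | "as!0!0 = as!3!0" "as!0!1 = as!4!1" "(as!0!0 \<noteq> as!0!1) = as!5!0" "as!1!0 = as!4!0" "as!1!1 = as!3!1" "\<not> ((as!1!0 \<noteq> as!1!1) = as!5!1)"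
    | "as!0!0 = as!3!0" "as!0!1 = as!4!1" "(as!0!0 \<noteq> as!0!1) = as!5!0" "as!1!0 = as!4!0" "as!1!1 = as!3!1" "(as!1!0 \<noteq> as!1!1) = as!5!1" "\<not> (as!2!0 = (as!3!0 \<noteq> as!3!1))"
    | "as!0!0 = as!3!0" "as!0!1 = as!4!1" "(as!0!0 \<noteq> as!0!1) = as!5!0" "as!1!0 = as!4!0" "as!1!1 = as!3!1" "(as!1!0 \<noteq> as!1!1) = as!5!1" "as!2!0 = (as!3!0 \<noteq> as!3!1)" "\<not> (as!2!1 = (as!4!0 \<noteq> as!4!1))"
    | "as!0!0 = as!3!0" "as!0!1 = as!4!1" "(as!0!0 \<noteq> as!0!1) = as!5!0" "as!1!0 = as!4!0" "as!1!1 = as!3!1" "(as!1!0 \<noteq> as!1!1) = as!5!1" "as!2!0 = (as!3!0 \<noteq> as!3!1)" "as!2!1 = (as!4!0 \<noteq> as!4!1)"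
    by blast
  then show ?thesis
  proof cases
    case 1
    then show ?thesis using X1 by (auto simp: square_conflict_def)
  next
    case 2
    then show ?thesis using X2 by (auto simp: square_conflict_def)
  next
    case 3
    then show ?thesis using XX by (auto simp: square_conflict_def)
  next
    case 4
    then show ?thesis using Z1 by (auto simp: square_conflict_def)
  next
    case 5
    then show ?thesis using Z2 by (auto simp: square_conflict_def)
  next
    case 6
    then show ?thesis using ZZ by (auto simp: square_conflict_def)
  next
    case 7
    then show ?thesis using XZ by (auto simp: square_conflict_def)
  next
    case 8
    then show ?thesis using ZX by (auto simp: square_conflict_def)
  next
    case 9
    then have "square_conflict as = (Some AY, Some AY)" by (simp add: square_conflict_def)
    moreover have "(as!2!0 \<noteq> as!2!1) = (as!5!0 \<noteq> as!5!1)" using 9 by blast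
    ultimately show ?thesis using YY by auto
  qed
qed

section \<open>One rewinding experiment\<close>

text \<open>This is the rewinding: one round-1 transcript \<open>a\<close> is continued with every
  word. The history is threaded through, because an answer may depend on all earlier ones.\<close>

fun ask_words ::
  "orcl \<Rightarrow> nat \<Rightarrow> bool list \<Rightarrow> orc_history \<Rightarrow> cliff_gen list list \<Rightarrow> bool list list \<times> orc_history" where
  "ask_words R n a h [] = ([], h)"
| "ask_words R n a h (w # ws) =
     (let q = a @ word_code w; c = R h (GOrc2 n) q; r = ask_words R n a (h @ [(GOrc2 n, q, c)]) ws
      in (c # fst r, snd r))"

definition run_square :: "orcl \<Rightarrow> nat \<Rightarrow> orc_history \<Rightarrow> bool list \<Rightarrow> bool list list \<times> orc_history" where
  "run_square R n h q =
     (let ob = R h (GOrc1 n) q in ask_words R n (q @ ob) (h @ [(GOrc1 n, q, ob)]) square_words)"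

lemma rewind_orcl_round1:
  assumes "rewind_orcl R" "length q = 6 * n + 2"
  shows "valid_round1 n (take (3*n+1) q) (drop (3*n+1) q)
     (take (3*n+1) (R h (GOrc1 n) q)) (drop (3*n+1) (R h (GOrc1 n) q))"
    and "length (R h (GOrc1 n) q) = 6 * n + 2"
proof -
  show *: "valid_round1 n (take (3*n+1) q) (drop (3*n+1) q)
     (take (3*n+1) (R h (GOrc1 n) q)) (drop (3*n+1) (R h (GOrc1 n) q))"
    using assms by (simp add: rewind_orcl_def Let_def)
  then show "length (R h (GOrc1 n) q) = 6 * n + 2"
    by (auto simp: valid_round1_def)
qed

lemma rewind_orcl_round2:
  assumes R: "rewind_orcl R" and len: "length q = 6 * n + 2" "length ob = 6 * n + 2"
  shows "length (R h (GOrc2 n) (q @ ob @ word_code w)) = 2"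
    and "(GOrc1 n, q, ob) \<in> set h \<Longrightarrow>
      valid_round1 n (take (3*n+1) q) (drop (3*n+1) q) (take (3*n+1) ob) (drop (3*n+1) ob) \<Longrightarrow>
      valid_round2 n (take (3*n+1) q) (drop (3*n+1) q) (take (3*n+1) ob) (drop (3*n+1) ob) (word_mat w)
        (R h (GOrc2 n) (q @ ob @ word_code w) ! 0) (R h (GOrc2 n) (q @ ob @ word_code w) ! 1)"
proof -
  let ?q = "q @ ob @ word_code w"
  have l: "length ?q = 12 * n + 24" using len by simp
  have t: "take (6*n+2) ?q = q" "take (6*n+2) (drop (6*n+2) ?q) = ob" "drop (12*n+4) ?q = word_code w"
    using len by simp_all
  note R2 = conjunct2[OF R[unfolded rewind_orcl_def], rule_format, of ?q n h, OF l, unfolded Let_def t]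
  show "length (R h (GOrc2 n) ?q) = 2" using R2 by blast
  show "valid_round2 n (take (3*n+1) q) (drop (3*n+1) q) (take (3*n+1) ob) (drop (3*n+1) ob) (word_mat w)
        (R h (GOrc2 n) ?q ! 0) (R h (GOrc2 n) ?q ! 1)"
    if "(GOrc1 n, q, ob) \<in> set h"
      "valid_round1 n (take (3*n+1) q) (drop (3*n+1) q) (take (3*n+1) ob) (drop (3*n+1) ob)"
    using R2 that encodes_clifford_word by blast
qed

text \<open>The guarantee requires the round-1 pair to be in the history, and histories only
  grow.\<close>

lemma ask_words_valid:
  assumes R: "rewind_orcl R" and len: "length q = 6 * n + 2" "length ob = 6 * n + 2"
    and v: "valid_round1 n (take (3*n+1) q) (drop (3*n+1) q) (take (3*n+1) ob) (drop (3*n+1) ob)"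
    and "(GOrc1 n, q, ob) \<in> set h" "j < length ws"
  shows "valid_round2 n (take (3*n+1) q) (drop (3*n+1) q) (take (3*n+1) ob) (drop (3*n+1) ob) (word_mat (ws ! j))
        (fst (ask_words R n (q @ ob) h ws) ! j ! 0) (fst (ask_words R n (q @ ob) h ws) ! j ! 1)"
  using assms(5,6)
proof (induction ws arbitrary: h j)
  case (Cons w ws)
  show ?case
  proof (cases j)
    case 0
    then show ?thesis
      using rewind_orcl_round2(2)[OF R len Cons.prems(1) v, of w] by (simp add: Let_def)
  next
    case (Suc i)
    then show ?thesis
      using Cons.IH[of "h @ [(GOrc2 n, (q @ ob) @ word_code w, R h (GOrc2 n) ((q @ ob) @ word_code w))]" i] Cons.prems
      by (simp add: Let_def)
  qed
qed simp

lemma run_square_conflict: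
  assumes R: "rewind_orcl R" and len: "length A = 3 * n + 1" "length B = 3 * n + 1"
  shows "square_conflict (fst (run_square R n h (A @ B))) \<notin>
     {(None, None), (Some (word_axis A AX), None), (None, Some (word_axis B AX)),
      (Some (word_axis A AX), Some (word_axis B AX))}"
proof -
  let ?q = "A @ B"
  let ?ob = "R h (GOrc1 n) ?q"
  let ?OA = "take (3*n+1) ?ob" and ?OB = "drop (3*n+1) ?ob"
  let ?l = "chain_vec (\<lambda>_. 1) (zip A ?OA)" and ?r = "chain_vec (\<lambda>_. 1) (zip B ?OB)"
  have lq: "length ?q = 6 * n + 2" using len by simp
  note v1 = rewind_orcl_round1[OF R lq, of h]
  have t: "take (3*n+1) ?q = A" "drop (3*n+1) ?q = B" using len by simp_all
  have lo: "length ?OA = 3*n+1" "length ?OB = 3*n+1" using v1(2) by simp_all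
  \<comment> \<open>The end qubit of each half starts in the plus state, the X eigenvector with
    \<open>s = False\<close>.\<close>
  have ax: "on_axis (\<lambda>_. 1) AX"
    by (auto simp: on_axis_def intro!: exI[of _ False])
  have "on_axis ?l (word_axis A AX)" "on_axis ?r (word_axis B AX)"
    using len lo by (auto intro!: on_axis_chain ax)
  moreover have "outcome_amp ?l ?r (square_words ! j) (fst (run_square R n h ?q) ! j) \<noteq> 0" if "j < 6" for j
  proof -
    have "j < length square_words" using that by (simp add: square_words_def)
    then have "valid_round2 n A B ?OA ?OB (word_mat (square_words ! j))
        (fst (run_square R n h ?q) ! j ! 0) (fst (run_square R n h ?q) ! j ! 1)"
      using ask_words_valid[OF R lq v1(2) v1(1), of "h @ [(GOrc1 n, ?q, ?ob)]" j square_words]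
      unfolding t run_square_def Let_def by simp
    from valid_round2_amp[OF len lo this] show ?thesis
      by (simp add: outcome_amp_def)
  qed
  ultimately show ?thesis
    by (intro square_conflict_not_stabiliser) auto
qed

section \<open>Masked words\<close>

instance axis :: finite
proof
  have "(UNIV :: axis set) \<subseteq> {AX, AY, AZ}"
    using axis.exhaust by blast
  then show "finite (UNIV :: axis set)"
    by (rule finite_subset) simp
qed

lemma all_axis: "(\<forall>P. Q P) \<longleftrightarrow> Q AX \<and> Q AY \<and> Q AZ"
  by (metis axis.exhaust)

lemma word_axis_Nil [simp]: "word_axis [] P = P"
  and word_axis_Cons [simp]: "word_axis (a # w) P = word_axis w (axis_step a P)"
  and word_axis_append [simp]: "word_axis (u @ v) P = word_axis v (word_axis u P)"
  by (simp_all add: word_axis_def)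

text \<open>Two letters would give only four words for six permutations. A common length keeps the
  position of a block independent of its content.\<close>

definition perm_code :: "(axis \<Rightarrow> axis) \<Rightarrow> bool list" where
  "perm_code f = (SOME w. length w = 3 \<and> (\<forall>P. word_axis w P = f P))"

lemma perm_code:
  assumes "bij f"
  shows "length (perm_code f) = 3" "word_axis (perm_code f) P = f P"
proof -
  have inj: "f P = f Q \<longleftrightarrow> P = Q" for P Q
    using assms by (metis bij_pointE)
  have "\<exists>a b c. \<forall>P. word_axis [a, b, c] P = f P"
    using inj[of AX AY] inj[of AX AZ] inj[of AY AZ]
    by (cases "f AX"; cases "f AY"; cases "f AZ") (simp_all add: all_axis ex_bool_eq)
  then have "\<exists>w. length w = 3 \<and> (\<forall>P. word_axis w P = f P)"
    by (metis length_Cons list.size(3) numeral_3_eq_3)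
  from someI_ex[OF this] show "length (perm_code f) = 3" "word_axis (perm_code f) P = f P"
    by (simp_all add: perm_code_def)
qed

fun start_code :: "axis \<Rightarrow> bool list" where
  "start_code AX = [False, False, False]"
| "start_code AY = [True, True, False]"
| "start_code AZ = [True, True, True]"

lemma start_code: "length (start_code a) = 3" "word_axis (start_code a) AZ = a"
  by (cases a; simp)+

abbreviation branch :: "('a \<Rightarrow> 'a) \<Rightarrow> bool \<Rightarrow> 'a \<Rightarrow> 'a" where
  "branch \<kappa> v \<equiv> (if v then \<kappa> else id)"

text \<open>The first letter turns the initial axis \<open>AX\<close> into \<open>AZ\<close>; the first block reveals only
  where \<open>g ! 0\<close> sends \<open>AZ\<close>, and the later blocks telescope.\<close>
definition mask_word :: "(axis \<Rightarrow> axis) \<Rightarrow> bool list \<Rightarrow> (axis \<Rightarrow> axis) list \<Rightarrow> bool list" where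
  "mask_word \<kappa> vs g = False # start_code ((g ! 0) AZ) @
     concat (map (\<lambda>i. perm_code (g ! Suc i \<circ> branch \<kappa> (vs ! i) \<circ> inv (g ! i))) [0..<length vs])"

fun true_axis :: "(axis \<Rightarrow> axis) \<Rightarrow> bool list \<Rightarrow> nat \<Rightarrow> axis" where
  "true_axis \<kappa> vs 0 = AZ"
| "true_axis \<kappa> vs (Suc t) = branch \<kappa> (vs ! t) (true_axis \<kappa> vs t)"

definition masks :: "nat \<Rightarrow> (axis \<Rightarrow> axis) list set" where
  "masks N = {g. set g \<subseteq> {f. bij f} \<and> length g = Suc N}"

lemma masks_bij: "g \<in> masks N \<Longrightarrow> i \<le> N \<Longrightarrow> bij (g ! i)"
  using nth_mem[of i g] by (simp add: masks_def subset_iff)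

lemma last_masks: "g \<in> masks N \<Longrightarrow> last g = g ! N"
  by (cases g rule: rev_cases) (auto simp: masks_def nth_append)

lemma finite_masks: "finite (masks N)"
  unfolding masks_def by (rule finite_lists_length_eq) simp

lemma masks_nonempty: "masks N \<noteq> {}"
proof -
  have "replicate (Suc N) id \<in> masks N" by (auto simp: masks_def)
  then show ?thesis by blast
qed

lemma bij_block:
  assumes "bij \<kappa>" "g \<in> masks N" "i < N"
  shows "bij (g ! Suc i \<circ> branch \<kappa> v \<circ> inv (g ! i))"
  using assms masks_bij[of g N i] masks_bij[of g N "Suc i"]
  by (auto intro!: bij_comp bij_imp_bij_inv)

text \<open>For \<open>n = Suc (length vs)\<close> this is \<open>3 * n + 1\<close>, the number of
  measured qubits on one side.\<close>

lemma length_mask_word: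
  assumes "bij \<kappa>" "g \<in> masks (length vs)"
  shows "length (mask_word \<kappa> vs g) = 3 * length vs + 4"
proof -
  have "map length (map (\<lambda>i. perm_code (g ! Suc i \<circ> branch \<kappa> (vs ! i) \<circ> inv (g ! i))) [0..<length vs])
    = map (\<lambda>_. 3) [0..<length vs]"
    using bij_block[OF assms] perm_code(1) by (auto simp: comp_def)
  from arg_cong[OF this, of sum_list] show ?thesis
    by (simp add: mask_word_def length_concat start_code sum_list_triv del: map_map)
qed

lemma word_axis_mask_word:
  assumes "bij \<kappa>" "g \<in> masks (length vs)"
  shows "word_axis (mask_word \<kappa> vs g) AX = (g ! length vs) (true_axis \<kappa> vs (length vs))"
proof -
  have "word_axis (concat (map (\<lambda>i. perm_code (g ! Suc i \<circ> branch \<kappa> (vs ! i) \<circ> inv (g ! i))) [0..<t]))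
      ((g ! 0) AZ) = (g ! t) (true_axis \<kappa> vs t)" if "t \<le> length vs" for t
    using that
  proof (induction t)
    case (Suc t)
    have "inj (g ! t)"
      using masks_bij[OF assms(2), of t] Suc.prems by (simp add: bij_is_inj)
    then have "inv (g ! t) ((g ! t) P) = P" for P by simp
    moreover have "bij (g ! Suc t \<circ> branch \<kappa> (vs ! t) \<circ> inv (g ! t))"
      using bij_block[OF assms, of t] Suc.prems by simp
    ultimately show ?case
      using Suc by (simp add: perm_code(2) del: o_apply) simp
  qed simp
  from this[OF order_refl] show ?thesis
    by (simp add: mask_word_def start_code)
qed

section \<open>The hidden involution\<close>

text \<open>\<open>other P\<close> is the transposition of the axes that fixes
  \<open>P\<close>.\<close>

fun other :: "axis \<Rightarrow> axis \<Rightarrow> axis" where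
  "other AX AX = AX" | "other AX AY = AZ" | "other AX AZ = AY"
| "other AY AX = AZ" | "other AY AY = AY" | "other AY AZ = AX"
| "other AZ AX = AY" | "other AZ AY = AX" | "other AZ AZ = AZ"

lemma other_other [simp]: "other P (other P Q) = Q"
  by (cases P; cases Q) simp_all

lemma other_comp_self: "other P \<circ> other P = id"
  by (rule ext) simp

lemma bij_other: "bij (other P)"
  by (rule o_bij[OF other_comp_self other_comp_self])

lemma inv_other [simp]: "inv (other P) = other P"
  by (rule inv_unique_comp[OF other_comp_self other_comp_self])

lemma other_fix [simp]: "other P P = P"
  by (cases P) simp_all

text \<open>A transposition in S_3 is determined by its fixed point, and conjugation by
  \<open>\<kappa>\<close> carries the fixed point along.\<close>

lemma other_conj:
  assumes "bij \<kappa>"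
  shows "other (\<kappa> P) \<circ> \<kappa> = \<kappa> \<circ> other P"
proof
  fix Q
  have inj: "\<kappa> P = \<kappa> Q \<longleftrightarrow> P = Q" for P Q
    using assms by (metis bij_pointE)
  show "(other (\<kappa> P) \<circ> \<kappa>) Q = (\<kappa> \<circ> other P) Q"
    using inj[of AX AY] inj[of AX AZ] inj[of AY AZ]
    by (cases P; cases Q; cases "\<kappa> AX"; cases "\<kappa> AY"; cases "\<kappa> AZ"; simp)
qed

definition flip_mask :: "(axis \<Rightarrow> axis) \<Rightarrow> bool list \<Rightarrow> (axis \<Rightarrow> axis) list \<Rightarrow> (axis \<Rightarrow> axis) list" where
  "flip_mask \<kappa> vs g = map (\<lambda>i. g ! i \<circ> other (true_axis \<kappa> vs i)) [0..<length g]"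

lemma flip_mask_nth: "i < length g \<Longrightarrow> flip_mask \<kappa> vs g ! i = g ! i \<circ> other (true_axis \<kappa> vs i)"
  by (simp add: flip_mask_def)

lemma flip_mask_masks:
  assumes "g \<in> masks N"
  shows "flip_mask \<kappa> vs g \<in> masks N"
proof -
  have "bij (flip_mask \<kappa> vs g ! i)" if "i < Suc N" for i
    using that assms masks_bij[OF assms, of i] bij_other
    by (subst flip_mask_nth) (auto simp: masks_def intro!: bij_comp)
  moreover have "length (flip_mask \<kappa> vs g) = Suc N"
    using assms by (simp add: flip_mask_def masks_def)
  ultimately show ?thesis
    by (auto simp: masks_def set_conv_nth)
qed

lemma flip_mask_flip_mask [simp]: "flip_mask \<kappa> vs (flip_mask \<kappa> vs g) = g"
  by (rule nth_equalityI) (simp_all add: flip_mask_def comp_assoc other_comp_self)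

text \<open>Let t_i be the transposition fixing the true axis after i letters. By
  \<open>other_conj\<close>, t_(i+1) v_i = v_i t_i, so the two transpositions inserted into a block
  meet and cancel. At the start t_0 fixes \<open>AZ\<close>, the only point whose image under
  \<open>g ! 0\<close> the word reveals.\<close>

lemma mask_word_flip:
  assumes "bij \<kappa>" and g: "g \<in> masks (length vs)"
  shows "mask_word \<kappa> vs (flip_mask \<kappa> vs g) = mask_word \<kappa> vs g"
proof -
  have l: "length g = Suc (length vs)" using g by (simp add: masks_def)
  have *: "flip_mask \<kappa> vs g ! Suc i \<circ> branch \<kappa> (vs ! i) \<circ> inv (flip_mask \<kappa> vs g ! i) =
     g ! Suc i \<circ> branch \<kappa> (vs ! i) \<circ> inv (g ! i)" if "i < length vs" for i
  proof -
    have b: "bij (branch \<kappa> (vs ! i))" using assms(1) by simp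
    have i: "inv (g ! i \<circ> other (true_axis \<kappa> vs i)) = other (true_axis \<kappa> vs i) \<circ> inv (g ! i)"
      using masks_bij[OF g, of i] that by (subst o_inv_distrib) (simp_all add: bij_other)
    have "other (true_axis \<kappa> vs (Suc i)) \<circ> branch \<kappa> (vs ! i) = branch \<kappa> (vs ! i) \<circ> other (true_axis \<kappa> vs i)"
      using other_conj[OF b, of "true_axis \<kappa> vs i"] by simp
    then have "g ! Suc i \<circ> (other (true_axis \<kappa> vs (Suc i)) \<circ> branch \<kappa> (vs ! i)) \<circ> other (true_axis \<kappa> vs i) \<circ> inv (g ! i)
       = g ! Suc i \<circ> branch \<kappa> (vs ! i) \<circ> (other (true_axis \<kappa> vs i) \<circ> other (true_axis \<kappa> vs i)) \<circ> inv (g ! i)"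
      by (simp only: comp_assoc)
    then show ?thesis
      using that l by (simp only: flip_mask_nth i other_comp_self comp_assoc fun.map_id id_comp comp_id less_SucI Suc_less_eq)
  qed
  have "map (\<lambda>i. perm_code (flip_mask \<kappa> vs g ! Suc i \<circ> branch \<kappa> (vs ! i) \<circ> inv (flip_mask \<kappa> vs g ! i))) [0..<length vs]
      = map (\<lambda>i. perm_code (g ! Suc i \<circ> branch \<kappa> (vs ! i) \<circ> inv (g ! i))) [0..<length vs]"
    by (intro map_cong refl arg_cong[of _ _ perm_code] *) simp
  moreover have "(flip_mask \<kappa> vs g ! 0) AZ = (g ! 0) AZ"
    using l by (simp add: flip_mask_nth)
  ultimately show ?thesis
    unfolding mask_word_def by (simp only:)
qed

section \<open>One masked experiment\<close>

type_synonym sample = "(axis \<Rightarrow> axis) list \<times> (axis \<Rightarrow> axis) list"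

definition samples :: "nat \<Rightarrow> sample set" where
  "samples N = masks N \<times> masks N"

definition sample_query :: "(axis \<Rightarrow> axis) \<Rightarrow> bool list \<Rightarrow> sample \<Rightarrow> bool list" where
  "sample_query \<kappa> vs s = mask_word \<kappa> vs (fst s) @ mask_word \<kappa> vs (snd s)"

definition unmask :: "sample \<Rightarrow> axis option \<times> axis option \<Rightarrow> axis option \<times> axis option" where
  "unmask s \<sigma> = (map_option (inv (last (fst s))) (fst \<sigma>), map_option (inv (last (snd s))) (snd \<sigma>))"

text \<open>If the common axis is \<open>P\<close> and \<open>a \<noteq> P\<close>, then the average of
  \<open>weight a / weight P\<close> over the four conflicts that the involutions make indistinguishable
  is at most \<open>9/10\<close>, whatever conflict the oracle produces.\<close>
fun weight :: "axis \<Rightarrow> axis option \<times> axis option \<Rightarrow> real" where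
  "weight a (Some x, Some y) =
     (if x = a \<and> y = a then 1/10 else if x \<noteq> a \<and> y \<noteq> a \<and> x \<noteq> y then 4/5 else 1)"
| "weight a (Some x, None) = (if x = a then 4/5 else 1)"
| "weight a (None, Some y) = (if y = a then 4/5 else 1)"
| "weight a (None, None) = 1"

lemma weight_pos: "weight a \<sigma> > 0"
  by (cases "(a, \<sigma>)" rule: weight.cases) auto

text \<open>Let b be the third axis. The bound is attained on each kind of orbit. If only one half
  is involved, the ratios are 4/5 and 1, each twice. If one component is \<open>P\<close>, the same
  values arise, 4/5 coming from \<open>P\<close> paired with b. If neither is \<open>P\<close>, the
  pairs (a,a), (a,b), (b,a), (b,b) give 1/10 + 5/4 + 5/4 + 1: the mixed pairs raise the ratio, and
  the small weight 1/10 pays for them.\<close>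

lemma weight_average:
  assumes "a \<noteq> P" "\<sigma> \<notin> {(None, None), (Some P, None), (None, Some P), (Some P, Some P)}"
  shows "(\<Sum>(f, g)\<leftarrow>[(id, id), (other P, id), (id, other P), (other P, other P)].
     weight a (map_prod (map_option f) (map_option g) \<sigma>) / weight P (map_prod (map_option f) (map_option g) \<sigma>)) \<le> 18/5"
proof (cases "(a, \<sigma>)" rule: weight.cases)
  case (1 _ x y)
  then show ?thesis using assms by (cases P; cases a; cases x; cases y) simp_all
next
  case (2 _ x)
  then show ?thesis using assms by (cases P; cases a; cases x) simp_all
next
  case (3 _ x)
  then show ?thesis using assms by (cases P; cases a; cases x) simp_all
qed (use assms in simp)

lemma last_flip_mask:
  assumes "g \<in> masks N"
  shows "inv (last (flip_mask \<kappa> vs g)) = other (true_axis \<kappa> vs N) \<circ> inv (last g)"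
proof -
  have l: "length g = Suc N" using assms by (simp add: masks_def)
  then have "last (flip_mask \<kappa> vs g) = flip_mask \<kappa> vs g ! N"
    by (subst last_conv_nth) (auto simp: flip_mask_def)
  also have "\<dots> = last g \<circ> other (true_axis \<kappa> vs N)"
    using l last_masks[OF assms] by (subst flip_mask_nth) auto
  finally show ?thesis
    using masks_bij[OF assms, of N] last_masks[OF assms] by (simp add: o_inv_distrib bij_other)
qed

definition sample_conflict :: "orcl \<Rightarrow> (axis \<Rightarrow> axis) \<Rightarrow> bool list \<Rightarrow> orc_history \<Rightarrow> sample \<Rightarrow> axis option \<times> axis option" where
  "sample_conflict R \<kappa> vs h s =
     unmask s (square_conflict (fst (run_square R (Suc (length vs)) h (sample_query \<kappa> vs s))))"

text \<open>Pulls \<open>run_square_conflict\<close> back along the final masks, which carry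
  \<open>P\<close> to the actual axes of the two halves.\<close>

lemma sample_conflict_excludes:
  assumes R: "rewind_orcl R" and \<kappa>: "bij \<kappa>" and s: "s \<in> samples (length vs)"
  defines "P \<equiv> true_axis \<kappa> vs (length vs)"
  shows "sample_conflict R \<kappa> vs h s \<notin> {(None, None), (Some P, None), (None, Some P), (Some P, Some P)}"
proof -
  obtain g g' where sg: "s = (g, g')" "g \<in> masks (length vs)" "g' \<in> masks (length vs)"
    using s by (auto simp: samples_def)
  let ?\<sigma> = "square_conflict (fst (run_square R (Suc (length vs)) h (sample_query \<kappa> vs s)))"
  have l: "last g = g ! length vs" "last g' = g' ! length vs"
    using sg last_masks by blast+
  have b: "bij (last g)" "bij (last g')"
    unfolding l using sg masks_bij by blast+
  have "?\<sigma> \<notin> {(None, None), (Some (last g P), None), (None, Some (last g' P)), (Some (last g P), Some (last g' P))}"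
    using run_square_conflict[OF R, of "mask_word \<kappa> vs g" "Suc (length vs)" "mask_word \<kappa> vs g'" h]
      length_mask_word[OF \<kappa> sg(2)] length_mask_word[OF \<kappa> sg(3)]
      word_axis_mask_word[OF \<kappa> sg(2)] word_axis_mask_word[OF \<kappa> sg(3)]
    by (simp add: sample_query_def sg l P_def)
  moreover have "inv (last g) z = P \<longleftrightarrow> z = last g P" "inv (last g') z = P \<longleftrightarrow> z = last g' P" for z
    using b by (metis bij_inv_eq_iff)+
  ultimately show ?thesis
    by (cases ?\<sigma>) (auto simp: sample_conflict_def unmask_def sg)
qed

definition flip_sample :: "(axis \<Rightarrow> axis) \<Rightarrow> bool list \<Rightarrow> bool \<times> bool \<Rightarrow> sample \<Rightarrow> sample" where
  "flip_sample \<kappa> vs bb = map_prod (branch (flip_mask \<kappa> vs) (fst bb)) (branch (flip_mask \<kappa> vs) (snd bb))"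

text \<open>The oracle sees the same query after the same history and so answers the same; only the
  unmasking feels the flip.\<close>

lemma sample_conflict_flip:
  assumes \<kappa>: "bij \<kappa>" and s: "s \<in> samples (length vs)"
  defines "P \<equiv> true_axis \<kappa> vs (length vs)"
  shows "sample_conflict R \<kappa> vs h (flip_sample \<kappa> vs (b, c) s) =
    map_prod (map_option (branch (other P) b)) (map_option (branch (other P) c)) (sample_conflict R \<kappa> vs h s)"
proof -
  obtain g g' where sg: "s = (g, g')" "g \<in> masks (length vs)" "g' \<in> masks (length vs)"
    using s by (auto simp: samples_def)
  have "sample_query \<kappa> vs (flip_sample \<kappa> vs (b, c) s) = sample_query \<kappa> vs s"
    using mask_word_flip[OF \<kappa> sg(2)] mask_word_flip[OF \<kappa> sg(3)]
    by (simp add: sample_query_def flip_sample_def sg)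
  moreover have "inv (last (branch (flip_mask \<kappa> vs) b g)) = branch (other P) b \<circ> inv (last g)"
    "inv (last (branch (flip_mask \<kappa> vs) c g')) = branch (other P) c \<circ> inv (last g')"
    using last_flip_mask[OF sg(2)] last_flip_mask[OF sg(3)] by (simp_all add: P_def)
  ultimately show ?thesis
    by (simp add: sample_conflict_def unmask_def sg flip_sample_def option.map_comp)
qed

lemma flip_sample_bij: "bij_betw (flip_sample \<kappa> vs bb) (samples N) (samples N)"
proof -
  have "flip_sample \<kappa> vs bb \<in> samples N \<rightarrow> samples N"
    using flip_mask_masks by (auto simp: flip_sample_def samples_def)
  from bij_betwI[OF this this] show ?thesis
    by (auto simp: flip_sample_def)
qed

lemma finite_samples: "finite (samples N)" and samples_nonempty: "samples N \<noteq> {}"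
  using finite_masks masks_nonempty by (auto simp: samples_def)

text \<open>Flips permute the samples, so the sum can be averaged over the four flips and estimated
  pointwise by \<open>weight_average\<close>. The history \<open>h\<close> is arbitrary, as the
  iteration over adaptive runs requires.\<close>

lemma one_sample_bound:
  fixes vs :: "bool list"
  assumes R: "rewind_orcl R" and \<kappa>: "bij \<kappa>"
  defines "P \<equiv> true_axis \<kappa> vs (length vs)"
  assumes "a \<noteq> P"
  shows "(\<Sum>s\<in>samples (length vs). weight a (sample_conflict R \<kappa> vs h s) / weight P (sample_conflict R \<kappa> vs h s))
     \<le> 9/10 * card (samples (length vs))"
proof -
  let ?S = "samples (length vs)"
  define F where "F s = weight a (sample_conflict R \<kappa> vs h s) / weight P (sample_conflict R \<kappa> vs h s)" for s
  have "(\<Sum>s\<in>?S. F s) = (\<Sum>s\<in>?S. F (flip_sample \<kappa> vs bb s))" for bb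
    by (rule sum.reindex_bij_betw[OF flip_sample_bij, symmetric])
  then have "4 * (\<Sum>s\<in>?S. F s) = (\<Sum>s\<in>?S. F (flip_sample \<kappa> vs (False, False) s))
     + (\<Sum>s\<in>?S. F (flip_sample \<kappa> vs (True, False) s)) + (\<Sum>s\<in>?S. F (flip_sample \<kappa> vs (False, True) s))
     + (\<Sum>s\<in>?S. F (flip_sample \<kappa> vs (True, True) s))"
    by simp
  also have "\<dots> = (\<Sum>s\<in>?S. F (flip_sample \<kappa> vs (False, False) s) + F (flip_sample \<kappa> vs (True, False) s)
     + F (flip_sample \<kappa> vs (False, True) s) + F (flip_sample \<kappa> vs (True, True) s))"
    by (simp add: sum.distrib)
  also have "\<dots> \<le> (\<Sum>s\<in>?S. 18/5)"
  proof (rule sum_mono)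
    fix s assume s: "s \<in> ?S"
    show "F (flip_sample \<kappa> vs (False, False) s) + F (flip_sample \<kappa> vs (True, False) s)
     + F (flip_sample \<kappa> vs (False, True) s) + F (flip_sample \<kappa> vs (True, True) s) \<le> 18/5"
      using weight_average[OF \<open>a \<noteq> P\<close> sample_conflict_excludes[OF R \<kappa> s, of h, folded P_def]]
      unfolding F_def sample_conflict_flip[OF \<kappa> s, folded P_def] by simp
  qed
  finally show ?thesis
    by (simp add: F_def)
qed

section \<open>Repeated experiments\<close>

definition lists_len :: "'a set \<Rightarrow> nat \<Rightarrow> 'a list set" where
  "lists_len S m = {xs. set xs \<subseteq> S \<and> length xs = m}"

lemma lists_len_0 [simp]: "lists_len S 0 = {[]}"
  by (auto simp: lists_len_def)

lemma finite_lists_len: "finite S \<Longrightarrow> finite (lists_len S m)"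
  unfolding lists_len_def by (rule finite_lists_length_eq)

lemma card_lists_len: "finite S \<Longrightarrow> card (lists_len S m) = card S ^ m"
  unfolding lists_len_def by (rule card_lists_length_eq)

lemma sum_lists_len_Suc:
  "(\<Sum>xs\<in>lists_len S (Suc m). f xs) = (\<Sum>x\<in>S. \<Sum>xs\<in>lists_len S m. f (x # xs))"
proof -
  have "bij_betw (\<lambda>(x, xs). x # xs) (S \<times> lists_len S m) (lists_len S (Suc m))"
    by (auto simp: bij_betw_def inj_on_def lists_len_def image_def length_Suc_conv)
  from sum.reindex_bij_betw[OF this, of f, symmetric] show ?thesis
    by (simp add: sum.cartesian_product split_def)
qed

fun run_samples ::
  "orcl \<Rightarrow> (axis \<Rightarrow> axis) \<Rightarrow> bool list \<Rightarrow> orc_history \<Rightarrow> sample list \<Rightarrow> bool list list list \<times> orc_history" where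
  "run_samples R \<kappa> vs h [] = ([], h)"
| "run_samples R \<kappa> vs h (s # ss) =
     (let r = run_square R (Suc (length vs)) h (sample_query \<kappa> vs s);
          r' = run_samples R \<kappa> vs (snd r) ss
      in (fst r # fst r', snd r'))"

definition likelihood :: "axis \<Rightarrow> sample list \<Rightarrow> bool list list list \<Rightarrow> real" where
  "likelihood a ss as = (\<Prod>p\<leftarrow>zip ss as. weight a (unmask (fst p) (square_conflict (snd p))))"

lemma likelihood_simps [simp]:
  "likelihood a [] as = 1"
  "likelihood a (s # ss) (c # as) = weight a (unmask s (square_conflict c)) * likelihood a ss as"
  by (simp_all add: likelihood_def)

lemma likelihood_pos: "likelihood a ss as > 0"
proof -
  have "0 < (\<Prod>p\<leftarrow>ps. weight a (unmask (fst p) (square_conflict (snd p))))" for ps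
    by (induction ps) (simp_all add: weight_pos)
  then show ?thesis unfolding likelihood_def .
qed

definition accepts :: "sample list \<Rightarrow> bool list list list \<Rightarrow> bool" where
  "accepts ss as \<longleftrightarrow> (\<forall>a. a \<noteq> AZ \<longrightarrow> likelihood a ss as < likelihood AZ ss as)"

text \<open>Given the first sample, the rest is a run from another history, for which the induction
  hypothesis holds as well; adaptivity of the oracle costs nothing.\<close>

lemma likelihood_ratio_bound:
  fixes vs :: "bool list"
  assumes R: "rewind_orcl R" and \<kappa>: "bij \<kappa>"
  defines "P \<equiv> true_axis \<kappa> vs (length vs)" and "S \<equiv> samples (length vs)"
  assumes "a \<noteq> P"
  shows "(\<Sum>ss\<in>lists_len S m. likelihood a ss (fst (run_samples R \<kappa> vs h ss)) /
            likelihood P ss (fst (run_samples R \<kappa> vs h ss))) \<le> (9/10) ^ m * card S ^ m"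
proof (induction m arbitrary: h)
  case (Suc m)
  let ?L = "\<lambda>h ss. likelihood a ss (fst (run_samples R \<kappa> vs h ss)) / likelihood P ss (fst (run_samples R \<kappa> vs h ss))"
  let ?w = "\<lambda>s. weight a (sample_conflict R \<kappa> vs h s) / weight P (sample_conflict R \<kappa> vs h s)"
  let ?h = "\<lambda>s. snd (run_square R (Suc (length vs)) h (sample_query \<kappa> vs s))"
  have "(\<Sum>ss\<in>lists_len S (Suc m). ?L h ss) = (\<Sum>s\<in>S. ?w s * (\<Sum>ss\<in>lists_len S m. ?L (?h s) ss))"
    by (simp add: sum_lists_len_Suc Let_def sum_distrib_left sample_conflict_def)
  also have "\<dots> \<le> (\<Sum>s\<in>S. ?w s * ((9/10) ^ m * card S ^ m))"
    by (intro sum_mono mult_left_mono Suc.IH) (simp add: weight_pos less_imp_le)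
  also have "\<dots> = (\<Sum>s\<in>S. ?w s) * ((9/10) ^ m * card S ^ m)"
    by (simp add: sum_distrib_right)
  also have "\<dots> \<le> (9/10 * card S) * ((9/10) ^ m * card S ^ m)"
    using one_sample_bound[OF R \<kappa>, of a vs h] assms by (intro mult_right_mono) simp_all
  finally show ?case by (simp add: mult_ac)
qed simp

lemma markov_card:
  fixes B :: real
  assumes "finite S" "\<And>x. x \<in> S \<Longrightarrow> f x \<ge> 0" "(\<Sum>x\<in>S. f x) \<le> B"
  shows "card {x \<in> S. f x \<ge> 1} \<le> B"
proof -
  have "real (card {x \<in> S. f x \<ge> 1}) = (\<Sum>x\<in>{x \<in> S. f x \<ge> 1}. 1)" by simp
  also have "\<dots> \<le> (\<Sum>x\<in>{x \<in> S. f x \<ge> 1}. f x)" by (rule sum_mono) simp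
  also have "\<dots> \<le> (\<Sum>x\<in>S. f x)" by (rule sum_mono2) (use assms in auto)
  finally show ?thesis using assms(3) by simp
qed

text \<open>An error forces some wrong axis to be at least as likely as \<open>P\<close>. Markov's
  inequality for each of the two wrong axes gives the factor 2.\<close>

lemma accepts_error:
  fixes vs :: "bool list"
  assumes R: "rewind_orcl R" and \<kappa>: "bij \<kappa>"
  defines "P \<equiv> true_axis \<kappa> vs (length vs)" and "S \<equiv> samples (length vs)"
  shows "card {ss \<in> lists_len S m. accepts ss (fst (run_samples R \<kappa> vs h ss)) \<noteq> (P = AZ)}
    \<le> 2 * (9/10) ^ m * card S ^ m"
proof -
  let ?L = "\<lambda>a ss. likelihood a ss (fst (run_samples R \<kappa> vs h ss))"
  let ?B = "\<lambda>a. {ss \<in> lists_len S m. ?L a ss / ?L P ss \<ge> 1}"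
  have fin: "finite (lists_len S m)"
    unfolding S_def by (intro finite_lists_len finite_samples)
  have c: "real (card (?B a)) \<le> (9/10) ^ m * card S ^ m" if "a \<noteq> P" for a
  proof (rule markov_card[OF fin])
    show "0 \<le> ?L a ss / ?L P ss" for ss
      by (simp add: likelihood_pos less_imp_le)
    show "(\<Sum>ss\<in>lists_len S m. ?L a ss / ?L P ss) \<le> (9/10) ^ m * card S ^ m"
      using likelihood_ratio_bound[OF R \<kappa>, where a = a and vs = vs and m = m and h = h] that
      by (simp add: P_def S_def)
  qed
  define Q1 Q2 where "Q1 = (case P of AX \<Rightarrow> AY | _ \<Rightarrow> AX)" and "Q2 = (case P of AZ \<Rightarrow> AY | _ \<Rightarrow> AZ)"
  have Q: "Q1 \<noteq> P" "Q2 \<noteq> P" by (cases P; simp add: Q1_def Q2_def)+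
  have Q12: "a = Q1 \<or> a = Q2" if "a \<noteq> P" for a
    using that by (cases P; cases a; simp add: Q1_def Q2_def)
  have "{ss \<in> lists_len S m. accepts ss (fst (run_samples R \<kappa> vs h ss)) \<noteq> (P = AZ)} \<subseteq> ?B Q1 \<union> ?B Q2"
  proof
    fix ss assume ss: "ss \<in> {ss \<in> lists_len S m. accepts ss (fst (run_samples R \<kappa> vs h ss)) \<noteq> (P = AZ)}"
    show "ss \<in> ?B Q1 \<union> ?B Q2"
    proof (rule ccontr)
      assume "ss \<notin> ?B Q1 \<union> ?B Q2"
      then have less: "?L a ss < ?L P ss" if "a \<noteq> P" for a
        using Q12[OF that] ss by (auto simp: not_le divide_less_eq likelihood_pos)
      have "accepts ss (fst (run_samples R \<kappa> vs h ss)) = (P = AZ)"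
        unfolding accepts_def using less less_asym[OF less[of AZ]] by blast
      then show False using ss by simp
    qed
  qed
  then have "card {ss \<in> lists_len S m. accepts ss (fst (run_samples R \<kappa> vs h ss)) \<noteq> (P = AZ)} \<le> card (?B Q1 \<union> ?B Q2)"
    using fin by (intro card_mono) auto
  also have "\<dots> \<le> card (?B Q1) + card (?B Q2)" by (rule card_Un_le)
  finally show ?thesis using c[OF Q(1)] c[OF Q(2)] by linarith
qed

section \<open>Residues modulo 3 and 2 read off the orbit of \<open>AZ\<close>\<close>

lemma true_axis_funpow: "t \<le> length vs \<Longrightarrow> true_axis \<kappa> vs t = (\<kappa> ^^ length (filter id (take t vs))) AZ"
  by (induction t) (auto simp: take_Suc_conv_app_nth)

lemma bij_axis_step: "bij (axis_step b)"
proof -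
  have "inj (axis_step b)"
  proof (rule injI)
    show "axis_step b x = axis_step b y \<Longrightarrow> x = y" for x y
      by (cases b; cases x; cases y) simp_all
  qed
  then show ?thesis
    by (simp add: bij_def finite_UNIV_inj_surj)
qed

lemma axis_step_True_pow: "(axis_step True ^^ c) AZ = AZ \<longleftrightarrow> c mod 3 = 0"
proof -
  have "(axis_step True ^^ c) AZ = (if c mod 3 = 0 then AZ else if c mod 3 = 1 then AX else AY)"
    by (induction c) (auto simp: mod_Suc)
  then show ?thesis by simp
qed

lemma axis_step_False_pow: "(axis_step False ^^ c) AZ = AZ \<longleftrightarrow> c mod 2 = 0"
proof -
  have "(axis_step False ^^ c) AZ = (if c mod 2 = 0 then AZ else AX)"
    by (induction c) (auto simp: mod_Suc)
  then show ?thesis by simp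
qed

section \<open>Simulating a \<open>MOD\<^sub>6\<close> circuit\<close>

type_synonym chunk = "sample list \<times> sample list"

definition chunks :: "nat \<Rightarrow> nat \<Rightarrow> chunk set" where
  "chunks N m = lists_len (samples N) m \<times> lists_len (samples N) m"

text \<open>Divisibility by 6 is split into divisibility by 3 and by 2, tested by the 3-cycle and by
  the transposition; the second test starts from the history left by the first.\<close>

definition sim_mod6 :: "orcl \<Rightarrow> bool list \<Rightarrow> orc_history \<Rightarrow> chunk \<Rightarrow> bool \<times> orc_history" where
  "sim_mod6 R vs h c =
     (let r = run_samples R (axis_step True) vs h (fst c);
          r' = run_samples R (axis_step False) vs (snd r) (snd c)
      in (accepts (fst c) (fst r) \<and> accepts (snd c) (fst r'), snd r'))"

lemma finite_chunks: "finite (chunks N m)"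
  unfolding chunks_def by (intro finite_cartesian_product finite_lists_len finite_samples)

lemma card_chunks: "card (chunks N m) = card (samples N) ^ m * card (samples N) ^ m"
  by (simp add: chunks_def card_lists_len finite_samples card_cartesian_product)

lemma chunks_nonempty: "chunks N m \<noteq> {}"
  using card_chunks[of N m] finite_samples[of N] samples_nonempty[of N] by (auto simp: card_gt_0_iff)

lemma sim_mod6_error:
  assumes R: "rewind_orcl R"
  shows "card {c \<in> chunks (length vs) m. fst (sim_mod6 R vs h c) \<noteq> (length (filter id vs) mod 6 = 0)}
     \<le> 4 * (9/10) ^ m * card (chunks (length vs) m)"
proof -
  let ?S = "samples (length vs)"
  let ?L = "lists_len ?S m"
  let ?n = "length (filter id vs)"
  let ?B = "\<lambda>b h. {ss \<in> ?L. accepts ss (fst (run_samples R (axis_step b) vs h ss)) \<noteq> (true_axis (axis_step b) vs (length vs) = AZ)}"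
  let ?h = "\<lambda>ss. snd (run_samples R (axis_step True) vs h ss)"
  have fin: "finite ?L" by (intro finite_lists_len finite_samples)
  have m6: "(?n mod 6 = 0) \<longleftrightarrow> ?n mod 3 = 0 \<and> ?n mod 2 = 0" by presburger
  \<comment> \<open>The bad set of the second test depends, through the history, on the samples of
    the first; hence \<open>Sigma\<close> instead of a product.\<close>
  have "{c \<in> chunks (length vs) m. fst (sim_mod6 R vs h c) \<noteq> (?n mod 6 = 0)} \<subseteq>
     ?B True h \<times> ?L \<union> Sigma ?L (\<lambda>ss. ?B False (?h ss))"
    unfolding m6 by (auto simp: chunks_def sim_mod6_def Let_def true_axis_funpow axis_step_True_pow axis_step_False_pow)
  then have "card {c \<in> chunks (length vs) m. fst (sim_mod6 R vs h c) \<noteq> (?n mod 6 = 0)} \<le>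
     card (?B True h \<times> ?L \<union> Sigma ?L (\<lambda>ss. ?B False (?h ss)))"
    using fin by (intro card_mono) auto
  also have "\<dots> \<le> card (?B True h \<times> ?L) + card (Sigma ?L (\<lambda>ss. ?B False (?h ss)))"
    by (rule card_Un_le)
  also have "card (Sigma ?L (\<lambda>ss. ?B False (?h ss))) = (\<Sum>ss\<in>?L. card (?B False (?h ss)))"
    using fin by (intro card_SigmaI) auto
  finally have "card {c \<in> chunks (length vs) m. fst (sim_mod6 R vs h c) \<noteq> (?n mod 6 = 0)} \<le>
     card (?B True h \<times> ?L) + (\<Sum>ss\<in>?L. card (?B False (?h ss)))" .
  then have "real (card {c \<in> chunks (length vs) m. fst (sim_mod6 R vs h c) \<noteq> (?n mod 6 = 0)}) \<le>
     real (card (?B True h \<times> ?L) + (\<Sum>ss\<in>?L. card (?B False (?h ss))))"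
    by (simp only: of_nat_le_iff)
  also have "\<dots> = real (card (?B True h)) * card ?L + (\<Sum>ss\<in>?L. real (card (?B False (?h ss))))"
    by (simp only: of_nat_add of_nat_sum of_nat_mult card_cartesian_product)
  also have "\<dots> \<le> (2 * (9/10) ^ m * card ?S ^ m) * card ?L + (\<Sum>ss\<in>?L. 2 * (9/10) ^ m * card ?S ^ m)"
    using accepts_error[OF R bij_axis_step, where vs = vs and m = m]
    by (intro add_mono sum_mono mult_right_mono) (simp_all add: of_nat_power)
  also have "\<dots> = 4 * (9/10) ^ m * card (chunks (length vs) m)"
    by (simp add: card_chunks card_lists_len finite_samples algebra_simps)
  finally show ?thesis .
qed

definition gate_wire_val :: "bool list \<Rightarrow> bool list \<Rightarrow> wire \<Rightarrow> bool" where
  "gate_wire_val x vals w = (case w of WIn i \<Rightarrow> x ! i | WRnd j \<Rightarrow> False | WGate g j \<Rightarrow> vals ! g)"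

text \<open>Zeros do not change the count, so gates of any fan-in up to \<open>N\<close> share one
  sample space and one oracle size.\<close>

definition pad :: "nat \<Rightarrow> bool list \<Rightarrow> bool list" where
  "pad N vs = map (\<lambda>i. i < length vs \<and> vs ! i) [0..<N]"

lemma length_pad [simp]: "length (pad N vs) = N"
  by (simp add: pad_def)

lemma count_pad:
  assumes "length vs \<le> N"
  shows "length (filter id (pad N vs)) = length (filter id vs)"
proof -
  have "pad N vs = vs @ replicate (N - length vs) False"
    using assms by (intro nth_equalityI) (auto simp: pad_def nth_append)
  then show ?thesis by simp
qed

definition exact_gate :: "gkind \<Rightarrow> bool list \<Rightarrow> bool" where
  "exact_gate k vs = (case k of GAnd \<Rightarrow> \<forall>v\<in>set vs. v | GOr \<Rightarrow> \<exists>v\<in>set vs. v | GNot \<Rightarrow> \<not> hd vs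
     | _ \<Rightarrow> length (filter id vs) mod 6 = 0)"

definition exact_step :: "bool list \<Rightarrow> bool list \<Rightarrow> gkind \<times> wire list \<Rightarrow> bool list" where
  "exact_step x vals gt = vals @ [exact_gate (fst gt) (map (gate_wire_val x vals) (snd gt))]"

definition sim_step :: "orcl \<Rightarrow> nat \<Rightarrow> bool list \<Rightarrow> bool list \<times> orc_history \<Rightarrow>
    (gkind \<times> wire list) \<times> chunk \<Rightarrow> bool list \<times> orc_history" where
  "sim_step R N x st gc = (let k = fst (fst gc); vs = map (gate_wire_val x (fst st)) (snd (fst gc)) in
     if k = GMod6
     then (let r = sim_mod6 R (pad N vs) (snd st) (snd gc) in (fst st @ [fst r], snd r))
     else (fst st @ [exact_gate k vs], snd st))"

lemma sim_step_error:
  assumes R: "rewind_orcl R" and "length (snd gt) \<le> N"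
  shows "card {c \<in> chunks N m. fst (sim_step R N x (vals, h) (gt, c)) \<noteq> exact_step x vals gt}
     \<le> 4 * (9/10) ^ m * card (chunks N m)"
proof (cases "fst gt = GMod6")
  case True
  let ?vs = "map (gate_wire_val x vals) (snd gt)"
  have "{c \<in> chunks N m. fst (sim_step R N x (vals, h) (gt, c)) \<noteq> exact_step x vals gt} =
    {c \<in> chunks N m. fst (sim_mod6 R (pad N ?vs) h c) \<noteq> (length (filter id (pad N ?vs)) mod 6 = 0)}"
    using True assms(2) by (subst count_pad) (auto simp: sim_step_def exact_step_def exact_gate_def Let_def)
  then show ?thesis
    using sim_mod6_error[OF R, where vs = "pad N ?vs" and m = m and h = h] by simp
qed (auto simp: sim_step_def exact_step_def)

text \<open>A sequential union bound: either the first gate errs, or the remaining gates run on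
  exact values from some other history, to which the induction hypothesis applies.\<close>

lemma sim_error:
  assumes R: "rewind_orcl R" and "\<forall>gt\<in>set gts. length (snd gt) \<le> N"
  shows "card {cs \<in> lists_len (chunks N m) (length gts).
       fst (foldl (sim_step R N x) (vals, h) (zip gts cs)) \<noteq> foldl (exact_step x) vals gts}
     \<le> length gts * (4 * (9/10) ^ m) * card (chunks N m) ^ length gts"
  using assms(2)
proof (induction gts arbitrary: vals h)
  case (Cons gt gts)
  let ?C = "chunks N m"
  let ?L = "lists_len ?C (length gts)"
  let ?\<epsilon> = "4 * (9/10) ^ m :: real"
  let ?step = "\<lambda>c. sim_step R N x (vals, h) (gt, c)"
  let ?v = "exact_step x vals gt"
  let ?bad = "\<lambda>c. fst (?step c) \<noteq> ?v"
  let ?final = "foldl (exact_step x) vals (gt # gts)"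
  have fin: "finite ?C" "finite ?L" by (simp_all add: finite_chunks finite_lists_len)
  have "real (card {cs \<in> lists_len ?C (length (gt # gts)).
       fst (foldl (sim_step R N x) (vals, h) (zip (gt # gts) cs)) \<noteq> ?final}) =
     (\<Sum>cs\<in>lists_len ?C (Suc (length gts)). of_bool (fst (foldl (sim_step R N x) (vals, h) (zip (gt # gts) cs)) \<noteq> ?final))"
    by (simp add: finite_lists_len finite_chunks Int_def)
  also have "\<dots> = (\<Sum>c\<in>?C. \<Sum>cs\<in>?L. of_bool (fst (foldl (sim_step R N x) (?step c) (zip gts cs)) \<noteq> ?final))"
    by (simp add: sum_lists_len_Suc)
  also have "\<dots> \<le> (\<Sum>c\<in>?C. of_bool (?bad c) * real (card ?L) + length gts * ?\<epsilon> * card ?C ^ length gts)"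
  proof (rule sum_mono)
    fix c assume "c \<in> ?C"
    show "(\<Sum>cs\<in>?L. of_bool (fst (foldl (sim_step R N x) (?step c) (zip gts cs)) \<noteq> ?final))
       \<le> of_bool (?bad c) * real (card ?L) + length gts * ?\<epsilon> * card ?C ^ length gts"
    proof (cases "?bad c")
      case True
      have "(\<Sum>cs\<in>?L. of_bool (fst (foldl (sim_step R N x) (?step c) (zip gts cs)) \<noteq> ?final)) \<le> (\<Sum>cs\<in>?L. 1 :: real)"
        by (rule sum_mono) simp
      also have "\<dots> = real (card ?L)" by simp
      also have "\<dots> \<le> of_bool (?bad c) * real (card ?L) + length gts * ?\<epsilon> * card ?C ^ length gts"
        using True by simp
      finally show ?thesis .
    next
      case False
      then have "?step c = (?v, snd (?step c))" by (simp add: prod_eq_iff)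
      then have "(\<Sum>cs\<in>?L. of_bool (fst (foldl (sim_step R N x) (?step c) (zip gts cs)) \<noteq> ?final)) =
        real (card {cs \<in> ?L. fst (foldl (sim_step R N x) (?v, snd (?step c)) (zip gts cs)) \<noteq> foldl (exact_step x) ?v gts})"
        using fin by (simp add: Int_def)
      also have "\<dots> \<le> length gts * ?\<epsilon> * card ?C ^ length gts"
        using Cons.prems by (intro Cons.IH) simp
      finally show ?thesis using False by simp
    qed
  qed
  also have "\<dots> = real (card {c \<in> ?C. ?bad c}) * real (card ?L) + card ?C * (length gts * ?\<epsilon> * card ?C ^ length gts)"
    using fin by (simp add: sum.distrib Int_def flip: sum_distrib_right)
  also have "\<dots> \<le> (?\<epsilon> * card ?C) * card ?L + card ?C * (length gts * ?\<epsilon> * card ?C ^ length gts)"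
  proof -
    have "real (card {c \<in> ?C. ?bad c}) \<le> ?\<epsilon> * card ?C"
      using Cons.prems by (intro sim_step_error[OF R]) simp
    then show ?thesis by (rule add_right_mono[OF mult_right_mono]) simp
  qed
  also have "\<dots> = length (gt # gts) * ?\<epsilon> * card ?C ^ length (gt # gts)"
    by (simp add: card_lists_len finite_chunks algebra_simps)
  finally show ?case .
qed simp

section \<open>Hard-wiring good samples\<close>

text \<open>Since circuits may be non-uniform, few uniformly random indices into a fixed table of
  samples suffice: a union bound over all inputs shows that a good table exists.\<close>
lemma good_table:
  fixes bad :: "'x \<Rightarrow> 'w \<Rightarrow> bool"
  assumes fin: "finite X" "finite \<Omega>" "\<Omega> \<noteq> {}" "finite I"
    and X: "card X < 2 ^ card I"
    and bad: "\<And>x. x \<in> X \<Longrightarrow> 64 * card {\<omega> \<in> \<Omega>. bad x \<omega>} \<le> card \<Omega>"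
  obtains G where "G \<in> I \<rightarrow> \<Omega>" "\<And>x. x \<in> X \<Longrightarrow> 3 * card {i \<in> I. bad x (G i)} \<le> card I"
proof -
  let ?K = "card I"
  \<comment> \<open>An exponential moment with base 64 = 4^3. If more than a third of the indices
    are bad, the product of \<open>f\<close> over the indices is at least \<open>4 ^ ?K\<close>,
    while its mean over all tables is at most \<open>2 ^ ?K\<close>. Fewer than
    \<open>2 ^ ?K\<close> inputs therefore cannot spoil every table.\<close>
  define f where "f x \<omega> = (if bad x \<omega> then 64 else 1 :: nat)" for x \<omega>
  have f: "(\<Sum>\<omega>\<in>\<Omega>. f x \<omega>) \<le> 2 * card \<Omega>" if "x \<in> X" for x
  proof -
    have "(\<Sum>\<omega>\<in>\<Omega>. f x \<omega>) \<le> (\<Sum>\<omega>\<in>\<Omega>. 1 + 64 * of_bool (bad x \<omega>))"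
      by (rule sum_mono) (simp add: f_def)
    also have "\<dots> = card \<Omega> + 64 * card {\<omega> \<in> \<Omega>. bad x \<omega>}"
    proof -
      have "(\<Sum>\<omega>\<in>\<Omega>. of_bool (bad x \<omega>)) = card {\<omega> \<in> \<Omega>. bad x \<omega>}"
        using fin(2) by (simp add: Int_def)
      then show ?thesis
        by (simp only: sum.distrib card_eq_sum flip: sum_distrib_left)
    qed
    finally show ?thesis using bad[OF that] by linarith
  qed
  have "\<exists>G\<in>I \<rightarrow>\<^sub>E \<Omega>. \<forall>x\<in>X. 3 * card {i \<in> I. bad x (G i)} \<le> ?K"
  proof (rule ccontr)
    assume neg: "\<not> ?thesis"
    have "4 ^ ?K * card \<Omega> ^ ?K = (\<Sum>G\<in>I \<rightarrow>\<^sub>E \<Omega>. 4 ^ ?K)"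
      using fin by (simp add: card_PiE)
    also have "\<dots> \<le> (\<Sum>G\<in>I \<rightarrow>\<^sub>E \<Omega>. \<Sum>x\<in>X. \<Prod>i\<in>I. f x (G i))"
    proof (rule sum_mono)
      fix G assume "G \<in> I \<rightarrow>\<^sub>E \<Omega>"
      then obtain x where x: "x \<in> X" "?K < 3 * card {i \<in> I. bad x (G i)}"
        using neg by (auto simp: not_le)
      have "(4::nat) ^ ?K \<le> 4 ^ (3 * card {i \<in> I. bad x (G i)})"
        using x(2) by (intro power_increasing) auto
      also have "\<dots> = (\<Prod>i\<in>{i \<in> I. bad x (G i)}. 64)"
        by (simp add: power_mult)
      also have "\<dots> = (\<Prod>i\<in>I. f x (G i))"
        unfolding f_def using fin(4) by (simp add: prod.If_cases Int_def)
      also have "\<dots> \<le> (\<Sum>x\<in>X. \<Prod>i\<in>I. f x (G i))"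
        using fin(1) x(1) by (intro member_le_sum) auto
      finally show "4 ^ ?K \<le> (\<Sum>x\<in>X. \<Prod>i\<in>I. f x (G i))" .
    qed
    also have "\<dots> = (\<Sum>x\<in>X. \<Sum>G\<in>I \<rightarrow>\<^sub>E \<Omega>. \<Prod>i\<in>I. f x (G i))"
      by (rule sum.swap)
    also have "\<dots> = (\<Sum>x\<in>X. (\<Sum>\<omega>\<in>\<Omega>. f x \<omega>) ^ ?K)"
      using prod_sum_PiE[of I "\<lambda>_. \<Omega>" "\<lambda>i \<omega>. f _ \<omega>"] fin by simp
    also have "\<dots> \<le> (\<Sum>x\<in>X. (2 * card \<Omega>) ^ ?K)"
      using f by (intro sum_mono power_mono) simp_all
    also have "\<dots> = card X * 2 ^ ?K * card \<Omega> ^ ?K"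
      by (simp add: power_mult_distrib)
    also have "\<dots> < 2 ^ ?K * 2 ^ ?K * card \<Omega> ^ ?K"
      using X fin by (simp add: card_gt_0_iff)
    also have "\<dots> = 4 ^ ?K * card \<Omega> ^ ?K"
      using power_mult_distrib[of "2::nat" 2 ?K] by simp
    finally show False by simp
  qed
  then obtain G where G: "G \<in> I \<rightarrow>\<^sub>E \<Omega>" "\<forall>x\<in>X. 3 * card {i \<in> I. bad x (G i)} \<le> ?K"
    by blast
  show thesis
  proof (rule that)
    show "G \<in> I \<rightarrow> \<Omega>" using G(1) by (simp add: PiE_def)
    show "3 * card {i \<in> I. bad x (G i)} \<le> ?K" if "x \<in> X" for x using G(2) that by blast
  qed
qed

section \<open>Building circuits incrementally\<close>

type_synonym gate_list = "(gkind \<times> wire list) list"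
type_synonym bfun = "bool list \<Rightarrow> bool list \<Rightarrow> bool"

definition gates_size :: "gate_list \<Rightarrow> nat" where
  "gates_size gs = length gs + sum_list (map (length \<circ> snd) gs)"

lemma gates_size_simps [simp]:
  "gates_size [] = 0" "gates_size (gs @ gs') = gates_size gs + gates_size gs'"
  "gates_size (gt # gs) = Suc (length (snd gt)) + gates_size gs"
  by (simp_all add: gates_size_def)

lemma gate_depths_snoc:
  "gate_depths (gs @ [gt]) =
     gate_depths gs @ [Suc (foldr max (map (wire_depth (gate_depths gs)) (snd gt)) 0)]"
  by (simp add: gate_depths_def)

lemma length_gate_depths [simp]: "length (gate_depths gs) = length gs"
  by (induction gs rule: rev_induct) (simp_all add: gate_depths_snoc, simp add: gate_depths_def)

lemma gate_depths_append: "\<exists>ds. gate_depths (gs @ gs') = gate_depths gs @ ds"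
proof (induction gs' rule: rev_induct)
  case (snoc gt gs')
  then show ?case by (metis append_assoc gate_depths_snoc)
qed simp

lemma foldr_max_le: "foldr max ds 0 \<le> (d::nat) \<longleftrightarrow> (\<forall>e\<in>set ds. e \<le> d)"
  by (induction ds) auto

locale circuit_builder =
  fixes R :: orcl and k r D :: nat
  assumes rewind: "rewind_orcl R"
begin

definition run_gates :: "gate_list \<Rightarrow> bool list \<Rightarrow> bool list \<Rightarrow> bool list list \<times> orc_history" where
  "run_gates gs x \<rho> = foldl (gate_step R x \<rho>) ([], []) gs"

abbreviation "outs gs x \<rho> \<equiv> fst (run_gates gs x \<rho>)"
abbreviation "hist gs x \<rho> \<equiv> snd (run_gates gs x \<rho>)"

lemma run_gates_snoc: "run_gates (gs @ [gt]) x \<rho> = gate_step R x \<rho> (run_gates gs x \<rho>) gt"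
  by (simp add: run_gates_def)

lemma fst_gate_step: "\<exists>out. fst (gate_step R x \<rho> st gt) = fst st @ [out]"
  by (simp add: gate_step_def Let_def split: gkind.split)

lemma length_outs [simp]: "length (outs gs x \<rho>) = length gs"
proof (induction gs rule: rev_induct)
  case (snoc gt gs)
  then show ?case using fst_gate_step[of x \<rho> "run_gates gs x \<rho>" gt] by (auto simp: run_gates_snoc)
qed (simp add: run_gates_def)

lemma outs_append: "\<exists>os. outs (gs @ gs') x \<rho> = outs gs x \<rho> @ os"
proof (induction gs' rule: rev_induct)
  case (snoc gt gs')
  then show ?case using fst_gate_step[of x \<rho> "run_gates (gs @ gs') x \<rho>" gt]
    by (metis append_assoc run_gates_snoc)
qed simp

definition ok_gates :: "gate_list \<Rightarrow> bool" where
  "ok_gates gs \<longleftrightarrow>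
     (\<forall>g<length gs. in_arity_ok (fst (gs ! g)) (snd (gs ! g)) \<and>
        (\<forall>w\<in>set (snd (gs ! g)). wf_wire k r (take g gs) w)) \<and>
     (\<forall>gt\<in>set gs. fst gt \<noteq> GMod6) \<and> (\<forall>d\<in>set (gate_depths gs). d \<le> D)"

definition valid_inputs :: "bool list \<Rightarrow> bool list \<Rightarrow> bool" where
  "valid_inputs x \<rho> \<longleftrightarrow> length x = k \<and> length \<rho> = r"

definition carries :: "gate_list \<Rightarrow> nat \<Rightarrow> bfun \<Rightarrow> wire \<Rightarrow> bool" where
  "carries gs d f w \<longleftrightarrow> wf_wire k r gs w \<and> wire_depth (gate_depths gs) w \<le> d \<and>
     (\<forall>x \<rho>. valid_inputs x \<rho> \<longrightarrow> wire_val x \<rho> (outs gs x \<rho>) w = f x \<rho>)"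

definition avail :: "gate_list \<Rightarrow> nat \<Rightarrow> bfun \<Rightarrow> bool" where
  "avail gs d f \<longleftrightarrow> (\<exists>w. carries gs d f w)"

definition extends :: "nat \<Rightarrow> gate_list \<Rightarrow> gate_list \<Rightarrow> bool" where
  "extends s gs gs' \<longleftrightarrow> ok_gates gs' \<and> (\<exists>\<delta>. gs' = gs @ \<delta> \<and> gates_size \<delta> \<le> s)"

text \<open>Oracle answers depend on the whole query history, so gates may be inserted in front of an
  oracle gate only if they leave the history unchanged.\<close>
definition silent :: "gate_list \<Rightarrow> gate_list \<Rightarrow> bool" where
  "silent gs gs' \<longleftrightarrow> (\<forall>x \<rho>. hist gs' x \<rho> = hist gs x \<rho>)"

lemma extends_refl: "ok_gates gs \<Longrightarrow> extends 0 gs gs"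
  by (simp add: extends_def)

lemma extends_ok: "extends s gs gs' \<Longrightarrow> ok_gates gs'"
  by (simp add: extends_def)

lemma extends_trans: "extends s gs gs' \<Longrightarrow> extends s' gs' gs'' \<Longrightarrow> extends (s + s') gs gs''"
  by (fastforce simp: extends_def)

lemma extends_mono: "extends s gs gs' \<Longrightarrow> s \<le> s' \<Longrightarrow> extends s' gs gs'"
  by (fastforce simp: extends_def)

lemma silent_refl: "silent gs gs"
  and silent_trans: "silent gs gs' \<Longrightarrow> silent gs' gs'' \<Longrightarrow> silent gs gs''"
  by (simp_all add: silent_def)

text \<open>Gates are only ever appended, so outputs and depths of earlier gates persist.\<close>

lemma carries_extends:
  assumes "carries gs d f w" "extends s gs gs'"
  shows "carries gs' d f w"
proof -
  obtain \<delta> where gs': "gs' = gs @ \<delta>" using assms(2) by (auto simp: extends_def)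
  obtain ds where ds: "gate_depths gs' = gate_depths gs @ ds"
    using gate_depths_append gs' by blast
  show ?thesis
  proof (cases w)
    case (WGate g j)
    then have g: "g < length gs" using assms(1) by (simp add: carries_def wf_wire_def)
    have "outs gs' x \<rho> ! g = outs gs x \<rho> ! g" for x \<rho>
      using outs_append[of gs \<delta> x \<rho>] g by (auto simp: gs' nth_append)
    then show ?thesis
      using assms(1) g WGate ds
      by (auto simp: carries_def wf_wire_def wire_depth_def wire_val_def gs' nth_append)
  qed (use assms(1) in \<open>simp_all add: carries_def wf_wire_def wire_depth_def wire_val_def\<close>)
qed

lemma avail_extends: "avail gs d f \<Longrightarrow> extends s gs gs' \<Longrightarrow> avail gs' d f"
  unfolding avail_def using carries_extends by blast

lemma avail_mono: "avail gs d f \<Longrightarrow> d \<le> d' \<Longrightarrow> avail gs d' f"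
  by (fastforce simp: avail_def carries_def)

lemma avail_cong: "avail gs d f \<Longrightarrow> (\<And>x \<rho>. valid_inputs x \<rho> \<Longrightarrow> f x \<rho> = f' x \<rho>) \<Longrightarrow> avail gs d f'"
  by (fastforce simp: avail_def carries_def)

lemma avail_input: "i < k \<Longrightarrow> avail gs d (\<lambda>x \<rho>. x ! i)"
  unfolding avail_def by (rule exI[of _ "WIn i"]) (simp add: carries_def wf_wire_def wire_depth_def wire_val_def)

lemma avail_random: "j < r \<Longrightarrow> avail gs d (\<lambda>x \<rho>. \<rho> ! j)"
  unfolding avail_def by (rule exI[of _ "WRnd j"]) (simp add: carries_def wf_wire_def wire_depth_def wire_val_def)

lemma avail_wires:
  assumes "\<forall>f\<in>set fs. avail gs d f"
  obtains ws where "list_all2 (carries gs d) fs ws"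
  using assms
proof (induction fs arbitrary: thesis)
  case (Cons f fs)
  obtain ws where "list_all2 (carries gs d) fs ws" using Cons by auto
  moreover obtain w where "carries gs d f w" using Cons.prems by (auto simp: avail_def)
  ultimately show ?case using Cons.prems(1)[of "w # ws"] by simp
qed simp

lemma carries_wire_vals:
  assumes "list_all2 (carries gs d) fs ws" "valid_inputs x \<rho>"
  shows "map (wire_val x \<rho> (outs gs x \<rho>)) ws = map (\<lambda>f. f x \<rho>) fs"
  using assms(1) by (induction rule: list_all2_induct) (use assms(2) in \<open>auto simp: carries_def\<close>)

lemma extends_gate:
  assumes ok: "ok_gates gs" and ws: "list_all2 (carries gs d) fs ws"
    and K: "K \<noteq> GMod6" "in_arity_ok K ws" and d: "d < D"
  shows "extends (Suc (length fs)) gs (gs @ [(K, ws)])"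
proof -
  have w: "wf_wire k r gs w" "wire_depth (gate_depths gs) w \<le> d" if "w \<in> set ws" for w
    using ws that by (auto simp: list_all2_conv_all_nth carries_def in_set_conv_nth)
  have l: "length ws = length fs" using ws by (simp add: list_all2_lengthD)
  have "ok_gates (gs @ [(K, ws)])"
    unfolding ok_gates_def
  proof (intro conjI allI impI)
    fix g assume "g < length (gs @ [(K, ws)])"
    then consider "g < length gs" | "g = length gs" by fastforce
    then have "in_arity_ok (fst ((gs @ [(K, ws)]) ! g)) (snd ((gs @ [(K, ws)]) ! g)) \<and>
       (\<forall>w\<in>set (snd ((gs @ [(K, ws)]) ! g)). wf_wire k r (take g (gs @ [(K, ws)])) w)"
      using ok K w by cases (auto simp: ok_gates_def nth_append)
    then show "in_arity_ok (fst ((gs @ [(K, ws)]) ! g)) (snd ((gs @ [(K, ws)]) ! g))"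
      "\<forall>w\<in>set (snd ((gs @ [(K, ws)]) ! g)). wf_wire k r (take g (gs @ [(K, ws)])) w"
      by auto
  next
    show "\<forall>gt\<in>set (gs @ [(K, ws)]). fst gt \<noteq> GMod6" using ok K by (auto simp: ok_gates_def)
    have "foldr max (map (wire_depth (gate_depths gs)) ws) 0 \<le> d"
      unfolding foldr_max_le using w(2) by auto
    then show "\<forall>d\<in>set (gate_depths (gs @ [(K, ws)])). d \<le> D"
      using ok d by (auto simp: gate_depths_snoc ok_gates_def)
  qed
  then show ?thesis using l by (simp add: extends_def)
qed

lemma carries_new_gate:
  assumes ws: "list_all2 (carries gs d) fs ws" and j: "j < out_arity K"
    and f: "\<And>x \<rho>. valid_inputs x \<rho> \<Longrightarrow> outs (gs @ [(K, ws)]) x \<rho> ! length gs ! j = f x \<rho>"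
  shows "carries (gs @ [(K, ws)]) (Suc d) f (WGate (length gs) j)"
proof -
  have "wire_depth (gate_depths gs) w \<le> d" if "w \<in> set ws" for w
    using ws that by (auto simp: list_all2_conv_all_nth carries_def in_set_conv_nth)
  then have "foldr max (map (wire_depth (gate_depths gs)) ws) 0 \<le> d"
    unfolding foldr_max_le by auto
  then show ?thesis
    using j f by (simp add: carries_def wf_wire_def wire_depth_def wire_val_def gate_depths_snoc nth_append)
qed

lemma logic_gate:
  assumes ok: "ok_gates gs" and fs: "\<forall>f\<in>set fs. avail gs d f" and d: "d < D"
    and K: "K \<in> {GAnd, GOr, GNot}" "K = GNot \<Longrightarrow> length fs = 1"
  obtains gs' where "extends (Suc (length fs)) gs gs'" "silent gs gs'"
    "avail gs' (Suc d) (\<lambda>x \<rho>. exact_gate K (map (\<lambda>f. f x \<rho>) fs))"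
proof -
  obtain ws where ws: "list_all2 (carries gs d) fs ws" using avail_wires[OF fs] .
  then have l: "length ws = length fs" by (simp add: list_all2_lengthD)
  let ?gs = "gs @ [(K, ws)]"
  have "extends (Suc (length fs)) gs ?gs"
    using K l by (intro extends_gate[OF ok ws _ _ d]) auto
  moreover have "silent gs ?gs"
    using K by (auto simp: silent_def run_gates_snoc gate_step_def Let_def)
  moreover have "carries ?gs (Suc d) (\<lambda>x \<rho>. exact_gate K (map (\<lambda>f. f x \<rho>) fs)) (WGate (length gs) 0)"
    using K by (intro carries_new_gate[OF ws])
      (auto simp: run_gates_snoc gate_step_def exact_gate_def Let_def carries_wire_vals[OF ws] nth_append)
  ultimately show thesis using that by (auto simp: avail_def)
qed

subsection \<open>Depth-three circuits\<close>

text \<open>Quantifying over all silent extensions makes these functions composable: several can be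
  built one after the other without invalidating each other.\<close>

definition buildable :: "gate_list \<Rightarrow> nat \<Rightarrow> nat \<Rightarrow> bfun \<Rightarrow> bool" where
  "buildable gs d s f \<longleftrightarrow> (\<forall>gs1 s1. extends s1 gs gs1 \<longrightarrow> silent gs gs1 \<longrightarrow>
     (\<exists>gs2. extends s gs1 gs2 \<and> silent gs1 gs2 \<and> avail gs2 d f))"

lemma buildable_avail: "avail gs d f \<Longrightarrow> buildable gs d 0 f"
  unfolding buildable_def by (meson avail_extends extends_refl extends_ok silent_refl)

lemma buildable_mono: "buildable gs d s f \<Longrightarrow> d \<le> d' \<Longrightarrow> s \<le> s' \<Longrightarrow> buildable gs d' s' f"
  unfolding buildable_def by (meson avail_mono extends_mono)

lemma buildable_cong:
  assumes b: "buildable gs d s f" and eq: "\<And>x \<rho>. valid_inputs x \<rho> \<Longrightarrow> f x \<rho> = f' x \<rho>"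
  shows "buildable gs d s f'"
proof -
  have "avail gs2 d f \<Longrightarrow> avail gs2 d f'" for gs2 using avail_cong[OF _ eq] .
  then show ?thesis using b unfolding buildable_def by meson
qed

lemma buildable_extends: "buildable gs d s f \<Longrightarrow> extends s' gs gs' \<Longrightarrow> silent gs gs' \<Longrightarrow> buildable gs' d s f"
  unfolding buildable_def by (meson extends_trans silent_trans)

lemma buildable_all:
  assumes "ok_gates gs" "\<forall>f\<in>set fs. buildable gs d s f"
  obtains gs' where "extends (length fs * s) gs gs'" "silent gs gs'" "\<forall>f\<in>set fs. avail gs' d f"
  using assms
proof (induction fs arbitrary: thesis)
  case Nil
  show ?case using Nil.prems(1)[of gs] Nil.prems(2) by (simp add: extends_refl silent_refl)
next
  case (Cons f fs)
  obtain gs1 where 1: "extends (length fs * s) gs gs1" "silent gs gs1" "\<forall>f\<in>set fs. avail gs1 d f"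
    using Cons by auto
  obtain gs2 where 2: "extends s gs1 gs2" "silent gs1 gs2" "avail gs2 d f"
    using Cons.prems(3) 1 unfolding buildable_def by (meson list.set_intros(1))
  show ?case
  proof (rule Cons.prems(1))
    show "extends (length (f # fs) * s) gs gs2"
      using extends_trans[OF 1(1) 2(1)] by (simp add: add.commute)
    show "silent gs gs2" using 1 2 silent_trans by blast
    show "\<forall>f\<in>set (f # fs). avail gs2 d f" using 1 2 avail_extends by auto
  qed
qed

lemma buildable_gate:
  assumes fs: "\<forall>f\<in>set fs. buildable gs d s f" and d: "d < D"
    and K: "K \<in> {GAnd, GOr, GNot}" "K = GNot \<Longrightarrow> length fs = 1"
  shows "buildable gs (Suc d) (length fs * s + Suc (length fs)) (\<lambda>x \<rho>. exact_gate K (map (\<lambda>f. f x \<rho>) fs))"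
  unfolding buildable_def
proof (intro allI impI)
  fix gs1 s1 assume 1: "extends s1 gs gs1" "silent gs gs1"
  then have "\<forall>f\<in>set fs. buildable gs1 d s f" using fs buildable_extends by blast
  then obtain gs2 where 2: "extends (length fs * s) gs1 gs2" "silent gs1 gs2" "\<forall>f\<in>set fs. avail gs2 d f"
    using buildable_all[OF extends_ok[OF 1(1)]] by blast
  obtain gs3 where 3: "extends (Suc (length fs)) gs2 gs3" "silent gs2 gs3"
    "avail gs3 (Suc d) (\<lambda>x \<rho>. exact_gate K (map (\<lambda>f. f x \<rho>) fs))"
    using logic_gate[OF extends_ok[OF 2(1)] 2(3) d K] by blast
  show "\<exists>gs2. extends (length fs * s + Suc (length fs)) gs1 gs2 \<and> silent gs1 gs2 \<and>
      avail gs2 (Suc d) (\<lambda>x \<rho>. exact_gate K (map (\<lambda>f. f x \<rho>) fs))"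
    using extends_trans[OF 2(1) 3(1)] silent_trans[OF 2(2) 3(2)] 3(3) by blast
qed

definition determined :: "bfun list \<Rightarrow> bfun \<Rightarrow> bool" where
  "determined fs f \<longleftrightarrow> (\<forall>x \<rho> x' \<rho>'. valid_inputs x \<rho> \<longrightarrow> valid_inputs x' \<rho>' \<longrightarrow>
     (\<forall>g\<in>set fs. g x \<rho> = g x' \<rho>') \<longrightarrow> f x \<rho> = f x' \<rho>')"

text \<open>A disjunctive normal form with one conjunction of literals for each value pattern of
  \<open>fs\<close> that occurs with \<open>f\<close> true. Negations, conjunctions and the
  disjunction take one layer each.\<close>

lemma buildable_determined:
  assumes fs: "\<forall>f\<in>set fs. avail gs d f" and det: "determined fs f" and d: "d + 2 < D"
  shows "buildable gs (d + 3) (3 * 4 ^ length fs) f"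
proof -
  let ?m = "length fs"
  define lit where "lit p i = (\<lambda>x \<rho>. (fs ! i) x \<rho> = p ! i)" for p :: "bool list" and i
  define T where "T = {p. length p = ?m \<and> (\<exists>x \<rho>. valid_inputs x \<rho> \<and> map (\<lambda>f. f x \<rho>) fs = p \<and> f x \<rho>)}"
  have lit: "buildable gs (Suc d) 2 (lit p i)" if "i < ?m" for p i
  proof (cases "p ! i")
    case True
    have "buildable gs d 0 (fs ! i)" using fs that by (intro buildable_avail) auto
    then have "buildable gs (Suc d) 2 (fs ! i)" by (rule buildable_mono) auto
    then show ?thesis by (rule buildable_cong) (simp add: lit_def True)
  next
    case False
    have "buildable gs d 0 (fs ! i)" using fs that by (intro buildable_avail) auto
    then have "buildable gs (Suc d) 2 (\<lambda>x \<rho>. exact_gate GNot (map (\<lambda>f. f x \<rho>) [fs ! i]))"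
      using buildable_gate[of "[fs ! i]" gs d 0 GNot] d by (simp add: numeral_2_eq_2)
    then show ?thesis by (rule buildable_cong) (simp add: lit_def False exact_gate_def)
  qed
  let ?term = "\<lambda>p x \<rho>. exact_gate GAnd (map (\<lambda>f. f x \<rho>) (map (lit p) [0..<?m]))"
  have "buildable gs (Suc (Suc d)) (length (map (lit p) [0..<?m]) * 2 + Suc (length (map (lit p) [0..<?m]))) (?term p)" for p
    using lit d by (intro buildable_gate) auto
  then have trm: "buildable gs (Suc (Suc d)) (3 * ?m + 1) (?term p)" for p
    by (rule buildable_mono) auto
  have finT: "finite {p :: bool list. set p \<subseteq> UNIV \<and> length p = ?m}"
    by (rule finite_lists_length_eq) simp
  have "T \<subseteq> {p. set p \<subseteq> UNIV \<and> length p = ?m}" by (auto simp: T_def)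
  with finT have fT: "finite T" and cT: "card T \<le> 2 ^ ?m"
    using card_mono[OF finT] card_lists_length_eq[of "UNIV :: bool set" ?m] by (auto intro: finite_subset)
  obtain ps where ps: "set ps = T" "distinct ps" using finite_distinct_list[OF fT] by blast
  then have lps: "length ps \<le> 2 ^ ?m" using cT by (metis distinct_card)
  have bld: "buildable gs (Suc (Suc (Suc d))) (length (map ?term ps) * (3 * ?m + 1) + Suc (length (map ?term ps)))
      (\<lambda>x \<rho>. exact_gate GOr (map (\<lambda>f. f x \<rho>) (map ?term ps)))"
    using trm d by (intro buildable_gate) auto
  \<comment> \<open>There are at most \<open>2 ^ ?m\<close> conjunctions, and
    \<open>?m + 1 \<le> 2 ^ ?m\<close> absorbs the linear cost of each.\<close>
  have "length (map ?term ps) * (3 * ?m + 1) + Suc (length (map ?term ps)) \<le> 3 * 4 ^ ?m"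
  proof -
    have m: "?m + 1 \<le> 2 ^ ?m" by (simp add: Suc_le_eq)
    have "length (map ?term ps) * (3 * ?m + 1) + Suc (length (map ?term ps)) = length ps * (3 * ?m + 2) + 1"
      by simp
    also have "\<dots> \<le> 2 ^ ?m * (3 * ?m + 2) + 2 ^ ?m"
      using lps by (intro add_mono mult_right_mono) auto
    also have "\<dots> = 3 * (2 ^ ?m * (?m + 1))" by (simp add: algebra_simps)
    also have "\<dots> \<le> 3 * (2 ^ ?m * 2 ^ ?m)" using m by (intro mult_left_mono) auto
    also have "\<dots> = 3 * 4 ^ ?m" using power_mult_distrib[of "2::nat" 2 ?m] by simp
    finally show ?thesis .
  qed
  from buildable_mono[OF bld _ this]
  have "buildable gs (d + 3) (3 * 4 ^ ?m) (\<lambda>x \<rho>. exact_gate GOr (map (\<lambda>f. f x \<rho>) (map ?term ps)))"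
    by simp
  then show ?thesis
  proof (rule buildable_cong)
    fix x \<rho> assume v: "valid_inputs x \<rho>"
    have t: "?term p x \<rho> \<longleftrightarrow> map (\<lambda>f. f x \<rho>) fs = p" if "length p = ?m" for p
    proof -
      have "?term p x \<rho> \<longleftrightarrow> (\<forall>i<?m. (fs ! i) x \<rho> = p ! i)"
        unfolding exact_gate_def by (simp add: lit_def) (metis atLeastLessThan_iff le0)
      also have "\<dots> \<longleftrightarrow> map (\<lambda>f. f x \<rho>) fs = p"
        unfolding list_eq_iff_nth_eq using that by simp
      finally show ?thesis .
    qed
    have "exact_gate GOr (map (\<lambda>f. f x \<rho>) (map ?term ps)) \<longleftrightarrow> (\<exists>p\<in>T. ?term p x \<rho>)"
      by (simp add: exact_gate_def ps(1))
    also have "\<dots> \<longleftrightarrow> (\<exists>p\<in>T. map (\<lambda>f. f x \<rho>) fs = p)"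
      using t by (auto simp: T_def)
    also have "\<dots> \<longleftrightarrow> f x \<rho>"
    proof
      assume "\<exists>p\<in>T. map (\<lambda>f. f x \<rho>) fs = p"
      then obtain x' \<rho>' where *: "valid_inputs x' \<rho>'" "map (\<lambda>f. f x' \<rho>') fs = map (\<lambda>f. f x \<rho>) fs" "f x' \<rho>'"
        by (auto simp: T_def)
      then have "\<forall>g\<in>set fs. g x \<rho> = g x' \<rho>'" by (metis map_eq_conv)
      then show "f x \<rho>" using det v * unfolding determined_def by blast
    next
      assume "f x \<rho>"
      then show "\<exists>p\<in>T. map (\<lambda>f. f x \<rho>) fs = p" using v by (auto simp: T_def)
    qed
    finally show "exact_gate GOr (map (\<lambda>f. f x \<rho>) (map ?term ps)) = f x \<rho>" .
  qed
qed

end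

context circuit_builder
begin

subsection \<open>Oracle gates\<close>

lemma oracle_gate:
  assumes ok: "ok_gates gs" and fs: "\<forall>f\<in>set fs. avail gs d f" and d: "d < D"
    and K: "K = GOrc1 n \<and> length fs = 6 * n + 2 \<or> K = GOrc2 n \<and> length fs = 12 * n + 24"
  obtains gs' where "extends (Suc (length fs)) gs gs'"
    "\<And>x \<rho>. valid_inputs x \<rho> \<Longrightarrow> hist gs' x \<rho> = hist gs x \<rho> @
       [(K, map (\<lambda>f. f x \<rho>) fs, R (hist gs x \<rho>) K (map (\<lambda>f. f x \<rho>) fs))]"
    "\<And>j. j < out_arity K \<Longrightarrow> avail gs' (Suc d) (\<lambda>x \<rho>. R (hist gs x \<rho>) K (map (\<lambda>f. f x \<rho>) fs) ! j)"
proof -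
  obtain ws where ws: "list_all2 (carries gs d) fs ws" using avail_wires[OF fs] .
  then have l: "length ws = length fs" by (simp add: list_all2_lengthD)
  let ?gs = "gs @ [(K, ws)]"
  have step: "run_gates ?gs x \<rho> = (outs gs x \<rho> @ [R (hist gs x \<rho>) K (map (\<lambda>f. f x \<rho>) fs)],
     hist gs x \<rho> @ [(K, map (\<lambda>f. f x \<rho>) fs, R (hist gs x \<rho>) K (map (\<lambda>f. f x \<rho>) fs))])"
    if "valid_inputs x \<rho>" for x \<rho>
    using K by (auto simp: run_gates_snoc gate_step_def Let_def carries_wire_vals[OF ws that])
  have "extends (Suc (length fs)) gs ?gs"
    using K l by (intro extends_gate[OF ok ws _ _ d]) auto
  moreover have "carries ?gs (Suc d) (\<lambda>x \<rho>. R (hist gs x \<rho>) K (map (\<lambda>f. f x \<rho>) fs) ! j) (WGate (length gs) j)"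
    if "j < out_arity K" for j
    using that by (intro carries_new_gate[OF ws]) (simp_all add: step nth_append)
  ultimately show thesis using that[of ?gs] step by (auto simp: avail_def)
qed

text \<open>Constant wires supply the tableau bits of round-2 queries and the zeros of
  \<open>pad\<close>.\<close>

definition has_consts :: "gate_list \<Rightarrow> nat \<Rightarrow> bool" where
  "has_consts gs d \<longleftrightarrow> (\<forall>b. avail gs d (\<lambda>_ _. b))"

lemma has_consts_extends: "has_consts gs d \<Longrightarrow> extends s gs gs' \<Longrightarrow> has_consts gs' d"
  unfolding has_consts_def using avail_extends by blast

lemma has_consts_mono: "has_consts gs d \<Longrightarrow> d \<le> d' \<Longrightarrow> has_consts gs d'"
  unfolding has_consts_def using avail_mono by blast

text \<open>No query uses the answer to another one, so all the gates lie in a single layer. Only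
  their order in the gate list, which is the order of the history, is sequential.\<close>

lemma ask_words_circuit:
  assumes "ok_gates gs" "\<forall>f\<in>set as. avail gs d f" "has_consts gs d" "length as = 12 * n + 4" and d: "d < D"
  shows "\<exists>gs'. extends (length ws * (12 * n + 25)) gs gs' \<and>
    (\<forall>x \<rho>. valid_inputs x \<rho> \<longrightarrow> hist gs' x \<rho> = snd (ask_words R n (map (\<lambda>f. f x \<rho>) as) (hist gs x \<rho>) ws)) \<and>
    (\<forall>j<length ws. \<forall>l<2. avail gs' (Suc d)
       (\<lambda>x \<rho>. fst (ask_words R n (map (\<lambda>f. f x \<rho>) as) (hist gs x \<rho>) ws) ! j ! l))"
  using assms(1-4)
proof (induction ws arbitrary: gs)
  case Nil
  then show ?case by (intro exI[of _ gs]) (simp add: extends_refl)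
next
  case (Cons w ws)
  let ?fs = "as @ map (\<lambda>b _ _. b) (word_code w)"
  let ?q = "\<lambda>x \<rho>. map (\<lambda>f. f x \<rho>) ?fs"
  let ?a = "\<lambda>x \<rho>. map (\<lambda>f. f x \<rho>) as"
  have q: "?q x \<rho> = ?a x \<rho> @ word_code w" for x \<rho> by (simp add: comp_def)
  have fs: "\<forall>f\<in>set ?fs. avail gs d f" using Cons.prems by (auto simp: has_consts_def)
  have lfs: "length ?fs = 12 * n + 24" using Cons.prems by simp
  obtain gs1 where 1: "extends (Suc (length ?fs)) gs gs1"
    "\<And>x \<rho>. valid_inputs x \<rho> \<Longrightarrow> hist gs1 x \<rho> = hist gs x \<rho> @ [(GOrc2 n, ?q x \<rho>, R (hist gs x \<rho>) (GOrc2 n) (?q x \<rho>))]"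
    "\<And>j. j < out_arity (GOrc2 n) \<Longrightarrow> avail gs1 (Suc d) (\<lambda>x \<rho>. R (hist gs x \<rho>) (GOrc2 n) (?q x \<rho>) ! j)"
    using oracle_gate[OF Cons.prems(1) fs d, of "GOrc2 n" n] lfs by blast
  obtain gs2 where 2: "extends (length ws * (12 * n + 25)) gs1 gs2"
    "\<And>x \<rho>. valid_inputs x \<rho> \<Longrightarrow> hist gs2 x \<rho> = snd (ask_words R n (?a x \<rho>) (hist gs1 x \<rho>) ws)"
    "\<And>j l. j < length ws \<Longrightarrow> l < 2 \<Longrightarrow> avail gs2 (Suc d)
       (\<lambda>x \<rho>. fst (ask_words R n (?a x \<rho>) (hist gs1 x \<rho>) ws) ! j ! l)"
    using Cons.IH[of gs1] Cons.prems extends_ok[OF 1(1)] has_consts_extends[OF _ 1(1)] avail_extends[OF _ 1(1)]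
    by blast
  show ?case
  proof (intro exI[of _ gs2] conjI allI impI)
    show "extends (length (w # ws) * (12 * n + 25)) gs gs2"
      by (rule extends_mono[OF extends_trans[OF 1(1) 2(1)]]) (use lfs in simp)
    show "hist gs2 x \<rho> = snd (ask_words R n (?a x \<rho>) (hist gs x \<rho>) (w # ws))" if "valid_inputs x \<rho>" for x \<rho>
      using 2(2)[OF that] 1(2)[OF that] q by (simp add: Let_def)
    fix j l :: nat assume j: "j < length (w # ws)" and l: "l < 2"
    show "avail gs2 (Suc d) (\<lambda>x \<rho>. fst (ask_words R n (?a x \<rho>) (hist gs x \<rho>) (w # ws)) ! j ! l)"
    proof (cases j)
      case 0
      have "avail gs2 (Suc d) (\<lambda>x \<rho>. R (hist gs x \<rho>) (GOrc2 n) (?q x \<rho>) ! l)"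
        using avail_extends[OF 1(3) 2(1)] l by simp
      then show ?thesis by (rule avail_cong) (simp add: 0 Let_def comp_def)
    next
      case (Suc i)
      then have "avail gs2 (Suc d) (\<lambda>x \<rho>. fst (ask_words R n (?a x \<rho>) (hist gs1 x \<rho>) ws) ! i ! l)"
        using 2(3) j l by simp
      then show ?thesis by (rule avail_cong) (simp add: Suc 1(2) Let_def comp_def)
    qed
  qed
qed

text \<open>Two oracle layers. Counting input wires, the round-1 gate costs 6n + 3 and each of the
  six round-2 gates costs 12n + 25.\<close>

lemma run_square_circuit:
  assumes ok: "ok_gates gs" and qs: "\<forall>f\<in>set qs. avail gs d f" "length qs = 6 * n + 2"
    and c: "has_consts gs d" and d: "Suc d < D"
  obtains gs' where "extends (78 * n + 153) gs gs'"
    "\<And>x \<rho>. valid_inputs x \<rho> \<Longrightarrow> hist gs' x \<rho> = snd (run_square R n (hist gs x \<rho>) (map (\<lambda>f. f x \<rho>) qs))"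
    "\<And>j l. j < 6 \<Longrightarrow> l < 2 \<Longrightarrow> avail gs' (d + 2)
       (\<lambda>x \<rho>. fst (run_square R n (hist gs x \<rho>) (map (\<lambda>f. f x \<rho>) qs)) ! j ! l)"
proof -
  let ?q = "\<lambda>x \<rho>. map (\<lambda>f. f x \<rho>) qs"
  let ?o = "\<lambda>x \<rho>. R (hist gs x \<rho>) (GOrc1 n) (?q x \<rho>)"
  obtain gs1 where 1: "extends (Suc (length qs)) gs gs1"
    "\<And>x \<rho>. valid_inputs x \<rho> \<Longrightarrow> hist gs1 x \<rho> = hist gs x \<rho> @ [(GOrc1 n, ?q x \<rho>, ?o x \<rho>)]"
    "\<And>j. j < out_arity (GOrc1 n) \<Longrightarrow> avail gs1 (Suc d) (\<lambda>x \<rho>. ?o x \<rho> ! j)"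
    using oracle_gate[OF ok qs(1) Suc_lessD[OF d], of "GOrc1 n" n] qs(2) by blast
  have lo: "length (?o x \<rho>) = 6 * n + 2" for x \<rho>
    using qs(2) by (intro rewind_orcl_round1(2)[OF rewind]) simp
  let ?as = "qs @ map (\<lambda>j x \<rho>. ?o x \<rho> ! j) [0..<6 * n + 2]"
  have as: "map (\<lambda>f. f x \<rho>) ?as = ?q x \<rho> @ ?o x \<rho>" for x \<rho>
    using map_nth[of "?o x \<rho>"] lo[of x \<rho>] by (simp add: comp_def del: upt_Suc)
  have "\<forall>f\<in>set ?as. avail gs1 (Suc d) f"
    using 1(3) avail_mono[OF avail_extends[OF _ 1(1)], of d _ "Suc d"] qs(1) by auto
  moreover have "has_consts gs1 (Suc d)"
    using has_consts_mono[OF has_consts_extends[OF c 1(1)], of "Suc d"] by simp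
  ultimately obtain gs2 where 2: "extends (length square_words * (12 * n + 25)) gs1 gs2"
    "\<And>x \<rho>. valid_inputs x \<rho> \<Longrightarrow> hist gs2 x \<rho> = snd (ask_words R n (?q x \<rho> @ ?o x \<rho>) (hist gs1 x \<rho>) square_words)"
    "\<And>j l. j < length square_words \<Longrightarrow> l < 2 \<Longrightarrow> avail gs2 (Suc (Suc d))
       (\<lambda>x \<rho>. fst (ask_words R n (?q x \<rho> @ ?o x \<rho>) (hist gs1 x \<rho>) square_words) ! j ! l)"
    using ask_words_circuit[OF extends_ok[OF 1(1)], of ?as "Suc d" n square_words] qs(2) d
    unfolding as by auto
  have sw: "length square_words = 6" by (simp add: square_words_def)
  have "extends (78 * n + 153) gs gs2"
    by (rule extends_mono[OF extends_trans[OF 1(1) 2(1)]]) (use qs(2) sw in simp)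
  moreover have "hist gs2 x \<rho> = snd (run_square R n (hist gs x \<rho>) (?q x \<rho>))" if "valid_inputs x \<rho>" for x \<rho>
    using 2(2)[OF that] 1(2)[OF that] by (simp add: run_square_def Let_def)
  moreover have "avail gs2 (d + 2) (\<lambda>x \<rho>. fst (run_square R n (hist gs x \<rho>) (?q x \<rho>)) ! j ! l)" if "j < 6" "l < 2" for j l
  proof -
    have "avail gs2 (Suc (Suc d)) (\<lambda>x \<rho>. fst (ask_words R n (?q x \<rho> @ ?o x \<rho>) (hist gs1 x \<rho>) square_words) ! j ! l)"
      using 2(3) that sw by simp
    then show ?thesis by (rule avail_cong[OF avail_mono]) (simp_all add: 1(2) run_square_def Let_def)
  qed
  ultimately show thesis using that by blast
qed

end

section \<open>Which bits the queries and the verdicts depend on\<close>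

lemma nth_concat_blocks:
  assumes "\<And>i. i < N \<Longrightarrow> length (F i) = b" "p < N * b"
  shows "concat (map F [0..<N]) ! p = F (p div b) ! (p mod b)"
  using assms
proof (induction N)
  case (Suc N)
  have l: "length (concat (map F [0..<N])) = N * b"
  proof -
    have "map length (map F [0..<N]) = map (\<lambda>_. b) [0..<N]"
      using Suc.prems(1) by simp
    from arg_cong[OF this, of sum_list] show ?thesis
      by (simp add: length_concat sum_list_triv del: map_map)
  qed
  show ?case
  proof (cases "p < N * b")
    case True
    then show ?thesis using Suc by (simp add: nth_append l)
  next
    case False
    then have d: "p div b = N"
      using Suc.prems(2) by (intro div_nat_eqI) (auto simp: mult.commute)
    then have "p mod b = p - N * b"
      using minus_div_mult_eq_mod[of p b] by simp
    with d show ?thesis using False by (simp add: nth_append l)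
  qed
qed simp

text \<open>For fixed masks a block involves a single letter, so each query bit needs only one input
  bit besides the sample; this keeps its normal form small. For \<open>p < 4\<close> the truncated
  difference yields index 0, while the bit comes from the fixed prefix.\<close>

lemma mask_word_nth_cong:
  assumes \<kappa>: "bij \<kappa>" and g: "g \<in> masks N" and l: "length vs = N" "length vs' = N" and p: "p < 3 * N + 4"
    and eq: "vs ! ((p - 4) div 3) = vs' ! ((p - 4) div 3)"
  shows "mask_word \<kappa> vs g ! p = mask_word \<kappa> vs' g ! p"
proof (cases "p < 4")
  case True
  have "mask_word \<kappa> us g ! p = (False # start_code ((g ! 0) AZ)) ! p" for us
    using nth_append[of "False # start_code ((g ! 0) AZ)" _ p] True start_code(1)[of "(g ! 0) AZ"]
    by (simp add: mask_word_def)
  then show ?thesis by simp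
next
  case False
  have *: "mask_word \<kappa> us g ! p = perm_code (g ! Suc ((p - 4) div 3) \<circ> branch \<kappa> (us ! ((p - 4) div 3)) \<circ> inv (g ! ((p - 4) div 3))) ! ((p - 4) mod 3)"
    if "length us = N" for us
  proof -
    have len: "length (perm_code (g ! Suc i \<circ> branch \<kappa> (us ! i) \<circ> inv (g ! i))) = 3" if "i < N" for i
      using bij_block[OF \<kappa> g that] by (rule perm_code(1))
    have "mask_word \<kappa> us g ! p = concat (map (\<lambda>i. perm_code (g ! Suc i \<circ> branch \<kappa> (us ! i) \<circ> inv (g ! i))) [0..<N]) ! (p - 4)"
      using nth_append[of "False # start_code ((g ! 0) AZ)" _ p] False start_code(1)[of "(g ! 0) AZ"] that
      by (simp add: mask_word_def)
    then show ?thesis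
      using nth_concat_blocks[where b = 3 and N = N and p = "p - 4" and F = "\<lambda>i. perm_code (g ! Suc i \<circ> branch \<kappa> (us ! i) \<circ> inv (g ! i))"] len p False
      by simp
  qed
  show ?thesis using *[OF l(1)] *[OF l(2)] eq by simp
qed

lemma square_conflict_cong:
  assumes "\<And>j l. j < 6 \<Longrightarrow> l < 2 \<Longrightarrow> as ! j ! l = as' ! j ! l"
  shows "square_conflict as = square_conflict as'"
proof -
  have "as!0!0 = as'!0!0" "as!0!1 = as'!0!1" "as!1!0 = as'!1!0" "as!1!1 = as'!1!1"
    "as!2!0 = as'!2!0" "as!2!1 = as'!2!1" "as!3!0 = as'!3!0" "as!3!1 = as'!3!1"
    "as!4!0 = as'!4!0" "as!4!1 = as'!4!1" "as!5!0 = as'!5!0" "as!5!1 = as'!5!1"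
    by (rule assms; simp)+
  then show ?thesis unfolding square_conflict_def by (simp only:)
qed

lemma accepts_cong:
  assumes "length as = length as'"
    and "\<And>i j l. i < length as \<Longrightarrow> j < 6 \<Longrightarrow> l < 2 \<Longrightarrow> as ! i ! j ! l = as' ! i ! j ! l"
  shows "accepts ss as = accepts ss as'"
proof -
  have m: "map square_conflict as = map square_conflict as'"
    using assms by (intro nth_equalityI) (auto intro!: square_conflict_cong)
  have "likelihood a ss as = (\<Prod>p\<leftarrow>zip ss (map square_conflict as). weight a (unmask (fst p) (snd p)))" for a as
    by (simp add: likelihood_def zip_map2 comp_def split_def)
  then show ?thesis using m by (simp add: accepts_def)
qed

lemma length_run_samples [simp]: "length (fst (run_samples R \<kappa> vs h ss)) = length ss"
  by (induction ss arbitrary: h) (simp_all add: Let_def)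

context circuit_builder
begin

subsection \<open>Simulating the gates\<close>

definition random_bits :: "bfun list" where
  "random_bits = map (\<lambda>j x \<rho>. \<rho> ! j) [0..<r]"

lemma length_random_bits [simp]: "length random_bits = r"
  by (simp add: random_bits_def)

lemma random_bits_avail: "f \<in> set random_bits \<Longrightarrow> avail gs d f"
  by (auto simp: random_bits_def avail_random)

lemma random_bits_determine:
  assumes "valid_inputs x \<rho>" "valid_inputs x' \<rho>'" "\<forall>g\<in>set random_bits. g x \<rho> = g x' \<rho>'"
  shows "\<rho> = \<rho>'"
  using assms by (intro nth_equalityI) (auto simp: valid_inputs_def random_bits_def)

text \<open>The samples depend on the random bits alone, so a query bit is determined by
  \<open>r\<close> random bits and one bit of \<open>vs\<close>. Different experiments do not use
  each other's answers; hence the depth, three layers for the queries and two for the oracle, does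
  not grow with \<open>m\<close>.\<close>

lemma run_samples_circuit:
  assumes \<kappa>: "bij \<kappa>" and N: "N \<ge> 1" and d: "d + 4 < D"
    and len: "\<And>x \<rho>. valid_inputs x \<rho> \<Longrightarrow> length (vs x \<rho>) = N"
    and "ok_gates gs" "has_consts gs d" "\<And>i. i < N \<Longrightarrow> avail gs d (\<lambda>x \<rho>. vs x \<rho> ! i)"
    and "\<And>x \<rho>. valid_inputs x \<rho> \<Longrightarrow> ss \<rho> \<in> lists_len (samples N) m"
  shows "\<exists>gs'. extends (m * ((6 * N + 8) * (3 * 4 ^ (r + 1)) + (78 * N + 231))) gs gs' \<and>
    (\<forall>x \<rho>. valid_inputs x \<rho> \<longrightarrow> hist gs' x \<rho> = snd (run_samples R \<kappa> (vs x \<rho>) (hist gs x \<rho>) (ss \<rho>))) \<and>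
    (\<forall>i<m. \<forall>j<6. \<forall>l<2. avail gs' (d + 5)
       (\<lambda>x \<rho>. fst (run_samples R \<kappa> (vs x \<rho>) (hist gs x \<rho>) (ss \<rho>)) ! i ! j ! l))"
  using assms(5-)
proof (induction m arbitrary: gs ss)
  case 0
  then show ?case by (intro exI[of _ gs]) (simp add: extends_refl)
next
  case (Suc m)
  let ?s = "\<lambda>\<rho>. hd (ss \<rho>)" and ?ss = "\<lambda>\<rho>. tl (ss \<rho>)"
  have s: "ss \<rho> = ?s \<rho> # ?ss \<rho>" "?s \<rho> \<in> samples N" "?ss \<rho> \<in> lists_len (samples N) m"
    if "valid_inputs x \<rho>" for x \<rho>
    using Suc.prems(4)[OF that] by (cases "ss \<rho>"; auto simp: lists_len_def)+
  define q where "q j = (\<lambda>x \<rho>. sample_query \<kappa> (vs x \<rho>) (?s \<rho>) ! j)" for j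
  have lw: "length (mask_word \<kappa> (vs x \<rho>) (fst (?s \<rho>))) = 3 * N + 4"
    "length (mask_word \<kappa> (vs x \<rho>) (snd (?s \<rho>))) = 3 * N + 4"
    if "valid_inputs x \<rho>" for x \<rho>
    using s(2)[OF that] length_mask_word[OF \<kappa>] len[OF that] by (auto simp: samples_def)
  have qb: "buildable gs (d + 3) (3 * 4 ^ (r + 1)) (q j)" if j: "j < 6 * N + 8" for j
  proof -
    define p where "p = (if j < 3 * N + 4 then j else j - (3 * N + 4))"
    have p: "p < 3 * N + 4" using j by (auto simp: p_def)
    let ?i = "(p - 4) div 3"
    \<comment> \<open>\<open>N \<ge> 1\<close> covers the prefix positions, whose truncated index is
      0.\<close>
    have i: "?i < N" using p N by (auto simp: less_mult_imp_div_less)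
    let ?fs = "random_bits @ [\<lambda>x \<rho>. vs x \<rho> ! ?i]"
    have "determined ?fs (q j)"
      unfolding determined_def
    proof (intro allI impI)
      fix x \<rho> x' \<rho>' assume v: "valid_inputs x \<rho>" "valid_inputs x' \<rho>'"
        and eq: "\<forall>g\<in>set ?fs. g x \<rho> = g x' \<rho>'"
      have "\<rho> = \<rho>'" using random_bits_determine[OF v] eq by simp
      moreover have "vs x \<rho> ! ?i = vs x' \<rho>' ! ?i" using eq by simp
      ultimately have "mask_word \<kappa> (vs x \<rho>) g ! p = mask_word \<kappa> (vs x' \<rho>') g ! p" if "g \<in> masks N" for g
        using mask_word_nth_cong[OF \<kappa> that len[OF v(1)] len[OF v(2)] p] by simp
      then show "q j x \<rho> = q j x' \<rho>'"
        using s(2)[OF v(1)] lw(1)[OF v(1)] lw(1)[OF v(2)] \<open>\<rho> = \<rho>'\<close>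
        by (auto simp: q_def sample_query_def nth_append p_def samples_def split: if_splits)
    qed
    moreover have "\<forall>f\<in>set ?fs. avail gs d f"
      using random_bits_avail Suc.prems(3)[OF i] by auto
    ultimately show ?thesis
      using buildable_determined[of ?fs gs d "q j"] d by simp
  qed
  let ?qs = "map q [0..<6 * N + 8]"
  \<comment> \<open>All query bits of the experiment are computed before its round-1 gate, leaving
    the history untouched.\<close>
  obtain gs1 where 1: "extends (length ?qs * (3 * 4 ^ (r + 1))) gs gs1" "silent gs gs1"
    "\<forall>f\<in>set ?qs. avail gs1 (d + 3) f"
    using buildable_all[OF Suc.prems(1), of ?qs "d + 3" "3 * 4 ^ (r + 1)"] qb by auto
  have qs: "map (\<lambda>f. f x \<rho>) ?qs = sample_query \<kappa> (vs x \<rho>) (?s \<rho>)" if "valid_inputs x \<rho>" for x \<rho>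
    using lw[OF that] by (intro nth_equalityI) (simp_all add: q_def sample_query_def del: upt_Suc)
  have c1: "has_consts gs1 (d + 3)"
    using has_consts_mono[OF has_consts_extends[OF Suc.prems(2) 1(1)], of "d + 3"] by simp
  let ?run = "\<lambda>x \<rho>. run_square R (Suc N) (hist gs x \<rho>) (sample_query \<kappa> (vs x \<rho>) (?s \<rho>))"
  obtain gs2 where 2: "extends (78 * Suc N + 153) gs1 gs2"
    "\<And>x \<rho>. valid_inputs x \<rho> \<Longrightarrow> hist gs2 x \<rho> = snd (run_square R (Suc N) (hist gs1 x \<rho>) (map (\<lambda>f. f x \<rho>) ?qs))"
    "\<And>j l. j < 6 \<Longrightarrow> l < 2 \<Longrightarrow> avail gs2 (d + 3 + 2)
       (\<lambda>x \<rho>. fst (run_square R (Suc N) (hist gs1 x \<rho>) (map (\<lambda>f. f x \<rho>) ?qs)) ! j ! l)"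
    using run_square_circuit[OF extends_ok[OF 1(1)] 1(3) _ c1, of "Suc N"] d
    by (auto simp del: upt_Suc)
  have h1: "hist gs1 x \<rho> = hist gs x \<rho>" for x \<rho> using 1(2) by (simp add: silent_def)
  have h2: "hist gs2 x \<rho> = snd (?run x \<rho>)" if "valid_inputs x \<rho>" for x \<rho>
    using 2(2)[OF that] qs[OF that] h1 by simp
  have e2: "extends (length ?qs * (3 * 4 ^ (r + 1)) + (78 * Suc N + 153)) gs gs2"
    by (rule extends_trans[OF 1(1) 2(1)])
  have "has_consts gs2 d" using has_consts_extends[OF Suc.prems(2) e2] .
  moreover have "avail gs2 d (\<lambda>x \<rho>. vs x \<rho> ! i)" if "i < N" for i
    using avail_extends[OF Suc.prems(3)[OF that] e2] .
  ultimately obtain gs3 where 3: "extends (m * ((6 * N + 8) * (3 * 4 ^ (r + 1)) + (78 * N + 231))) gs2 gs3"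
    "\<And>x \<rho>. valid_inputs x \<rho> \<Longrightarrow> hist gs3 x \<rho> = snd (run_samples R \<kappa> (vs x \<rho>) (hist gs2 x \<rho>) (?ss \<rho>))"
    "\<And>i j l. i < m \<Longrightarrow> j < 6 \<Longrightarrow> l < 2 \<Longrightarrow> avail gs3 (d + 5)
       (\<lambda>x \<rho>. fst (run_samples R \<kappa> (vs x \<rho>) (hist gs2 x \<rho>) (?ss \<rho>)) ! i ! j ! l)"
    using Suc.IH[of gs2 ?ss] extends_ok[OF e2] s(3) by blast
  have unf: "run_samples R \<kappa> (vs x \<rho>) (hist gs x \<rho>) (ss \<rho>) =
     (fst (?run x \<rho>) # fst (run_samples R \<kappa> (vs x \<rho>) (hist gs2 x \<rho>) (?ss \<rho>)),
      snd (run_samples R \<kappa> (vs x \<rho>) (hist gs2 x \<rho>) (?ss \<rho>)))" if "valid_inputs x \<rho>" for x \<rho>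
    by (subst s(1)[OF that]) (simp add: Let_def h2[OF that] len[OF that])
  show ?case
  proof (intro exI[of _ gs3] conjI allI impI)
    show "extends (Suc m * ((6 * N + 8) * (3 * 4 ^ (r + 1)) + (78 * N + 231))) gs gs3"
      by (rule extends_mono[OF extends_trans[OF e2 3(1)]]) (simp del: upt_Suc)
    show "hist gs3 x \<rho> = snd (run_samples R \<kappa> (vs x \<rho>) (hist gs x \<rho>) (ss \<rho>))" if "valid_inputs x \<rho>" for x \<rho>
      using 3(2)[OF that] unf[OF that] by simp
    fix i j l :: nat assume i: "i < Suc m" and j: "j < 6" and l: "l < 2"
    show "avail gs3 (d + 5) (\<lambda>x \<rho>. fst (run_samples R \<kappa> (vs x \<rho>) (hist gs x \<rho>) (ss \<rho>)) ! i ! j ! l)"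
    proof (cases i)
      case 0
      show ?thesis
        by (rule avail_cong[OF avail_mono[OF avail_extends[OF 2(3)[OF j l] 3(1)]]])
          (simp, simp only: 0 unf qs h1 fst_conv nth_Cons_0)
    next
      case (Suc i')
      then show ?thesis
        using i by (intro avail_cong[OF 3(3)[OF _ j l, of i']]) (simp_all add: unf)
    qed
  qed
qed

definition mod6_cost :: "nat \<Rightarrow> nat \<Rightarrow> nat" where
  "mod6_cost N m = 2 * (m * ((6 * N + 8) * (3 * 4 ^ (r + 1)) + (78 * N + 231))) + 3 * 4 ^ (r + 24 * m)"

text \<open>The verdict is determined by the random bits, which select the masks for the unmasking,
  and by twelve answer bits for each of the 2m experiments. With \<open>r\<close> and
  \<open>m\<close> logarithmic its normal form is polynomial. The eight layers are three for the
  queries, two for the oracle and three for the verdict.\<close>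

lemma mod6_circuit:
  assumes N: "N \<ge> 1" and d: "d + 7 < D"
    and len: "\<And>x \<rho>. valid_inputs x \<rho> \<Longrightarrow> length (vs x \<rho>) = N"
    and ok: "ok_gates gs" and c: "has_consts gs d" and vs: "\<And>i. i < N \<Longrightarrow> avail gs d (\<lambda>x \<rho>. vs x \<rho> ! i)"
    and ch: "\<And>x \<rho>. valid_inputs x \<rho> \<Longrightarrow> ch \<rho> \<in> chunks N m"
  obtains gs' where "extends (mod6_cost N m) gs gs'"
    "\<And>x \<rho>. valid_inputs x \<rho> \<Longrightarrow> hist gs' x \<rho> = snd (sim_mod6 R (vs x \<rho>) (hist gs x \<rho>) (ch \<rho>))"
    "avail gs' (d + 8) (\<lambda>x \<rho>. fst (sim_mod6 R (vs x \<rho>) (hist gs x \<rho>) (ch \<rho>)))"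
proof -
  let ?c = "m * ((6 * N + 8) * (3 * 4 ^ (r + 1)) + (78 * N + 231))"
  let ?run1 = "\<lambda>x \<rho>. run_samples R (axis_step True) (vs x \<rho>) (hist gs x \<rho>) (fst (ch \<rho>))"
  let ?run2 = "\<lambda>x \<rho>. run_samples R (axis_step False) (vs x \<rho>) (snd (?run1 x \<rho>)) (snd (ch \<rho>))"
  have ch1: "fst (ch \<rho>) \<in> lists_len (samples N) m" and ch2: "snd (ch \<rho>) \<in> lists_len (samples N) m"
    if "valid_inputs x \<rho>" for x \<rho>
    using ch[OF that] by (auto simp: chunks_def)
  have d4: "d + 4 < D" using d by simp
  obtain gs1 where 1: "extends ?c gs gs1"
    "\<And>x \<rho>. valid_inputs x \<rho> \<Longrightarrow> hist gs1 x \<rho> = snd (?run1 x \<rho>)"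
    "\<And>i j l. i < m \<Longrightarrow> j < 6 \<Longrightarrow> l < 2 \<Longrightarrow> avail gs1 (d + 5) (\<lambda>x \<rho>. fst (?run1 x \<rho>) ! i ! j ! l)"
    using run_samples_circuit[where \<kappa> = "axis_step True" and N = N and d = d and vs = vs and gs = gs
        and ss = "\<lambda>\<rho>. fst (ch \<rho>)" and m = m] bij_axis_step N d4 len ok c vs ch1 by blast
  have vs1: "avail gs1 d (\<lambda>x \<rho>. vs x \<rho> ! i)" if "i < N" for i
    using avail_extends[OF vs[OF that] 1(1)] .
  obtain gs2 where 2: "extends ?c gs1 gs2"
    "\<And>x \<rho>. valid_inputs x \<rho> \<Longrightarrow> hist gs2 x \<rho> =
       snd (run_samples R (axis_step False) (vs x \<rho>) (hist gs1 x \<rho>) (snd (ch \<rho>)))"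
    "\<And>i j l. i < m \<Longrightarrow> j < 6 \<Longrightarrow> l < 2 \<Longrightarrow> avail gs2 (d + 5)
       (\<lambda>x \<rho>. fst (run_samples R (axis_step False) (vs x \<rho>) (hist gs1 x \<rho>) (snd (ch \<rho>))) ! i ! j ! l)"
    using run_samples_circuit[where \<kappa> = "axis_step False" and N = N and d = d and vs = vs and gs = gs1
        and ss = "\<lambda>\<rho>. snd (ch \<rho>)" and m = m]
      bij_axis_step N d4 len extends_ok[OF 1(1)] has_consts_extends[OF c 1(1)] vs1 ch2 by blast
  define ix where "ix = List.product [0..<m] (List.product [0..<6] [0..<2::nat])"
  define ans where "ans run = map (\<lambda>(i, j, l) x \<rho>. fst (run x \<rho>) ! i ! j ! l) ix"
    for run :: "bool list \<Rightarrow> bool list \<Rightarrow> bool list list list \<times> orc_history"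
  let ?fs = "random_bits @ ans ?run1 @ ans ?run2"
  let ?f = "\<lambda>x \<rho>. fst (sim_mod6 R (vs x \<rho>) (hist gs x \<rho>) (ch \<rho>))"
  have six: "set ix = {(i, j, l). i < m \<and> j < 6 \<and> l < 2}" by (auto simp: ix_def)
  have sans: "f \<in> set (ans run) \<longleftrightarrow>
      (\<exists>i j l. i < m \<and> j < 6 \<and> l < 2 \<and> f = (\<lambda>x \<rho>. fst (run x \<rho>) ! i ! j ! l))" for f run
    by (force simp: ans_def six image_iff)
  have "length (ans run) = 12 * m" for run by (simp add: ans_def ix_def)
  then have lfs: "length ?fs = r + 24 * m" by simp
  have "avail gs2 (d + 5) f" if "f \<in> set (ans ?run1)" for f
    using that avail_extends[OF 1(3) 2(1)] unfolding sans by blast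
  moreover have "avail gs2 (d + 5) f" if f: "f \<in> set (ans ?run2)" for f
  proof -
    obtain i j l where f: "f = (\<lambda>x \<rho>. fst (?run2 x \<rho>) ! i ! j ! l)" and ijl: "i < m" "j < 6" "l < 2"
      using f unfolding sans by blast
    show ?thesis unfolding f
      by (rule avail_cong[OF 2(3)[OF ijl]]) (simp add: 1(2))
  qed
  ultimately have av: "\<forall>f\<in>set ?fs. avail gs2 (d + 5) f" using random_bits_avail by auto
  have det: "determined ?fs ?f"
    unfolding determined_def
  proof (intro allI impI)
    fix x \<rho> x' \<rho>' assume v: "valid_inputs x \<rho>" "valid_inputs x' \<rho>'"
      and eq: "\<forall>g\<in>set ?fs. g x \<rho> = g x' \<rho>'"
    have \<rho>: "\<rho> = \<rho>'" using random_bits_determine[OF v] eq by simp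
    have lc: "length (fst (ch \<rho>)) = m" "length (snd (ch \<rho>)) = m"
      using ch1[OF v(1)] ch2[OF v(1)] by (auto simp: lists_len_def)
    have e: "fst (run x \<rho>) ! i ! j ! l = fst (run x' \<rho>') ! i ! j ! l"
      if "set (ans run) \<subseteq> set ?fs" "i < m" "j < 6" "l < 2" for run i j l
    proof -
      have "(\<lambda>x \<rho>. fst (run x \<rho>) ! i ! j ! l) \<in> set (ans run)"
        unfolding sans by (rule exI[of _ i], rule exI[of _ j], rule exI[of _ l]) (use that in simp)
      with that(1) eq show ?thesis by (meson subsetD)
    qed
    have "accepts (fst (ch \<rho>)) (fst (?run1 x \<rho>)) = accepts (fst (ch \<rho>)) (fst (?run1 x' \<rho>'))"
      using e[of ?run1] lc \<rho> by (intro accepts_cong) auto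
    moreover have "accepts (snd (ch \<rho>)) (fst (?run2 x \<rho>)) = accepts (snd (ch \<rho>)) (fst (?run2 x' \<rho>'))"
      using e[of ?run2] lc \<rho> by (intro accepts_cong) auto
    ultimately show "?f x \<rho> = ?f x' \<rho>'" using \<rho> by (simp add: sim_mod6_def Let_def)
  qed
  have "buildable gs2 (d + 5 + 3) (3 * 4 ^ length ?fs) ?f"
    by (rule buildable_determined[OF av det]) (use d in simp)
  then have "buildable gs2 (d + 8) (3 * 4 ^ (r + 24 * m)) ?f"
    by (rule buildable_mono) (simp, simp only: lfs order_refl)
  then obtain gs3 where 3: "extends (3 * 4 ^ (r + 24 * m)) gs2 gs3" "silent gs2 gs3" "avail gs3 (d + 8) ?f"
    unfolding buildable_def using extends_refl[OF extends_ok[OF 2(1)]] silent_refl[of gs2] by blast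
  show thesis
  proof (rule that)
    show "extends (mod6_cost N m) gs gs3"
      by (rule extends_mono[OF extends_trans[OF extends_trans[OF 1(1) 2(1)] 3(1)]]) (simp add: mod6_cost_def)
    show "hist gs3 x \<rho> = snd (sim_mod6 R (vs x \<rho>) (hist gs x \<rho>) (ch \<rho>))" if "valid_inputs x \<rho>" for x \<rho>
      using 3(2) 2(2)[OF that] 1(2)[OF that] by (simp add: silent_def sim_mod6_def Let_def)
    show "avail gs3 (d + 8) ?f" by (rule 3(3))
  qed
qed

end

context circuit_builder
begin

text \<open>The empty conjunction is true and the empty disjunction is false.\<close>

lemma consts_circuit:
  assumes "0 < D"
  obtains gs where "extends 2 [] gs" "silent [] gs" "has_consts gs 1"
proof -
  have ok: "ok_gates []" by (simp add: ok_gates_def gate_depths_def)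
  obtain gs1 where 1: "extends 1 [] gs1" "silent [] gs1" "avail gs1 1 (\<lambda>_ _. True)"
    using logic_gate[OF ok, of "[]" 0 GAnd] assms by (auto simp: exact_gate_def)
  obtain gs2 where 2: "extends 1 gs1 gs2" "silent gs1 gs2" "avail gs2 1 (\<lambda>_ _. False)"
    using logic_gate[OF extends_ok[OF 1(1)], of "[]" 0 GOr] assms by (auto simp: exact_gate_def)
  have "has_consts gs2 1"
    unfolding has_consts_def using avail_extends[OF 1(3) 2(1)] 2(3) by (metis (full_types))
  then show thesis
    using that extends_trans[OF 1(1) 2(1)] silent_trans[OF 1(2) 2(2)] by (simp add: numeral_2_eq_2)
qed

end

section \<open>Prefixes of the simulated circuit\<close>

lemma gate_depths_take: "t \<le> length gs \<Longrightarrow> p < t \<Longrightarrow> gate_depths (take t gs) ! p = gate_depths gs ! p"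
  using gate_depths_append[of "take t gs" "drop t gs"] by (auto simp: nth_append)

lemma gate_depths_nth:
  assumes "t < length gs"
  shows "gate_depths gs ! t = Suc (foldr max (map (wire_depth (gate_depths (take t gs))) (snd (gs ! t))) 0)"
  using gate_depths_take[of "Suc t" gs t] assms
  by (simp add: take_Suc_conv_app_nth gate_depths_snoc nth_append)

definition sim_prefix ::
  "orcl \<Rightarrow> nat \<Rightarrow> gate_list \<Rightarrow> nat \<Rightarrow> bool list \<Rightarrow> chunk list \<Rightarrow> bool list \<times> orc_history" where
  "sim_prefix R N gts t x cs = foldl (sim_step R N x) ([], []) (zip (take t gts) cs)"

lemma sim_prefix_0 [simp]: "sim_prefix R N gts 0 x cs = ([], [])"
  by (simp add: sim_prefix_def)

lemma sim_prefix_Suc: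
  assumes "t < length gts" "length cs = length gts"
  shows "sim_prefix R N gts (Suc t) x cs = sim_step R N x (sim_prefix R N gts t x cs) (gts ! t, cs ! t)"
proof -
  have z: "zip (take t gts) cs = take t (zip gts cs)" for t
    by (rule nth_equalityI) auto
  have "zip (take (Suc t) gts) cs = zip (take t gts) cs @ [(gts ! t, cs ! t)]"
    unfolding z using assms by (simp add: take_Suc_conv_app_nth)
  then show ?thesis by (simp add: sim_prefix_def)
qed

lemma length_sim_prefix:
  assumes "t \<le> length gts" "length cs = length gts"
  shows "length (fst (sim_prefix R N gts t x cs)) = t"
  using assms(1)
proof (induction t)
  case (Suc t)
  then show ?case using sim_prefix_Suc[of t gts cs R N x] assms(2) by (simp add: sim_step_def Let_def)
qed simp

context circuit_builder
begin

text \<open>Gates are replaced in their original order, so the oracle history is that of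
  \<open>sim_prefix\<close>. The depth follows the given circuit instead: ten levels are reserved
  for each of its layers, above one level of constants.\<close>

lemma sim_circuit:
  assumes wf: "\<forall>g<length gts. in_arity_ok (fst (gts ! g)) (snd (gts ! g)) \<and>
      (\<forall>w\<in>set (snd (gts ! g)). wf_wire k 0 (take g gts) w)"
    and kinds: "\<forall>gt\<in>set gts. fst gt \<in> {GAnd, GOr, GNot, GMod6} \<and> length (snd gt) \<le> N"
    and N: "N \<ge> 1" and D: "0 < D" "\<forall>e\<in>set (gate_depths gts). 10 * e + 2 \<le> D"
    and G: "\<And>x \<rho>. valid_inputs x \<rho> \<Longrightarrow> G \<rho> \<in> lists_len (chunks N m) (length gts)"
    and t: "t \<le> length gts"
  shows "\<exists>gs. extends (2 + t * (N + 1 + mod6_cost N m)) [] gs \<and> has_consts gs 1 \<and>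
    (\<forall>x \<rho>. valid_inputs x \<rho> \<longrightarrow> hist gs x \<rho> = snd (sim_prefix R N gts t x (G \<rho>))) \<and>
    (\<forall>p<t. avail gs (1 + 10 * gate_depths gts ! p) (\<lambda>x \<rho>. fst (sim_prefix R N gts t x (G \<rho>)) ! p))"
  using t
proof (induction t)
  case 0
  obtain gs where "extends 2 [] gs" "silent [] gs" "has_consts gs 1"
    using consts_circuit[OF D(1)] .
  then show ?case by (intro exI[of _ gs]) (simp add: silent_def run_gates_def)
next
  case (Suc t)
  let ?S = "\<lambda>t x \<rho>. sim_prefix R N gts t x (G \<rho>)"
  let ?ds = "gate_depths gts"
  let ?K = "fst (gts ! t)" and ?ws = "snd (gts ! t)"
  let ?cost = "N + 1 + mod6_cost N m"
  have t: "t < length gts" using Suc.prems by simp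
  obtain gs where IH: "extends (2 + t * ?cost) [] gs" "has_consts gs 1"
    "\<And>x \<rho>. valid_inputs x \<rho> \<Longrightarrow> hist gs x \<rho> = snd (?S t x \<rho>)"
    "\<And>p. p < t \<Longrightarrow> avail gs (1 + 10 * ?ds ! p) (\<lambda>x \<rho>. fst (?S t x \<rho>) ! p)"
    using Suc by auto
  have lG: "length (G \<rho>) = length gts" if "valid_inputs x \<rho>" for x \<rho>
    using G[OF that] by (simp add: lists_len_def)
  have len: "length (fst (?S t x \<rho>)) = t" if "valid_inputs x \<rho>" for x \<rho>
    using length_sim_prefix lG[OF that] t by simp
  have step: "?S (Suc t) x \<rho> = sim_step R N x (?S t x \<rho>) (gts ! t, G \<rho> ! t)" if "valid_inputs x \<rho>" for x \<rho>
    using sim_prefix_Suc[OF t lG[OF that]] .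
  obtain e where e: "?ds ! t = Suc e" using gate_depths_nth[OF t] by simp
  then have "foldr max (map (wire_depth (gate_depths (take t gts))) ?ws) 0 \<le> e"
    using gate_depths_nth[OF t] by simp
  then have ewire: "wire_depth (gate_depths (take t gts)) w \<le> e" if "w \<in> set ?ws" for w
    unfolding foldr_max_le using that by auto
  have De: "10 * Suc e + 2 \<le> D"
    using D(2) t e by (metis length_gate_depths nth_mem)
  \<comment> \<open>The level by which all inputs of the gate are available; replacing the gate adds
    at most eight of the ten reserved levels.\<close>
  define d where "d = 1 + 10 * e"
  define val where "val w = (\<lambda>x \<rho>. gate_wire_val x (fst (?S t x \<rho>)) w)" for w
  have val: "avail gs d (val w)" if w: "w \<in> set ?ws" for w
  proof -
    have wfw: "wf_wire k 0 (take t gts) w" using wf t w by blast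
    show ?thesis
    proof (cases w)
      case (WIn i)
      then show ?thesis using wfw avail_input[of i gs d]
        by (simp add: wf_wire_def val_def gate_wire_val_def)
    next
      case (WRnd j)
      then show ?thesis using wfw by (simp add: wf_wire_def)
    next
      case (WGate g j)
      then have g: "g < t" using wfw by (simp add: wf_wire_def)
      moreover have "?ds ! g \<le> e"
        using ewire[OF w] WGate g t gate_depths_take[of t gts g] by (simp add: wire_depth_def)
      ultimately show ?thesis
        using avail_mono[OF IH(4)[OF g], of d] WGate by (simp add: val_def gate_wire_val_def d_def)
    qed
  qed
  have lws: "length ?ws \<le> N" and K: "?K \<in> {GAnd, GOr, GNot, GMod6}" and ar: "in_arity_ok ?K ?ws"
    using kinds wf t nth_mem[OF t] by auto
  have "\<exists>gs'. extends ?cost gs gs' \<and>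
     (\<forall>x \<rho>. valid_inputs x \<rho> \<longrightarrow> hist gs' x \<rho> = snd (?S (Suc t) x \<rho>)) \<and>
     avail gs' (1 + 10 * Suc e) (\<lambda>x \<rho>. fst (?S (Suc t) x \<rho>) ! t)"
  proof (cases "?K = GMod6")
    case False
    then have K': "?K \<in> {GAnd, GOr, GNot}" using K by auto
    have dD: "d < D" using De by (simp add: d_def)
    have "\<forall>f\<in>set (map val ?ws). avail gs d f" using val by auto
    moreover have "?K = GNot \<Longrightarrow> length (map val ?ws) = 1" using ar by simp
    ultimately obtain gs' where gs': "extends (Suc (length (map val ?ws))) gs gs'" "silent gs gs'"
      "avail gs' (Suc d) (\<lambda>x \<rho>. exact_gate ?K (map (\<lambda>f. f x \<rho>) (map val ?ws)))"
      using logic_gate[OF extends_ok[OF IH(1)] _ dD K'] by blast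
    show ?thesis
    proof (intro exI[of _ gs'] conjI allI impI)
      show "extends ?cost gs gs'" by (rule extends_mono[OF gs'(1)]) (use lws in simp)
      show "hist gs' x \<rho> = snd (?S (Suc t) x \<rho>)" if "valid_inputs x \<rho>" for x \<rho>
        using gs'(2) IH(3)[OF that] step[OF that] False by (simp add: silent_def sim_step_def Let_def)
      show "avail gs' (1 + 10 * Suc e) (\<lambda>x \<rho>. fst (?S (Suc t) x \<rho>) ! t)"
      proof (rule avail_cong[OF avail_mono[OF gs'(3)]])
        show "exact_gate ?K (map (\<lambda>f. f x \<rho>) (map val ?ws)) = fst (?S (Suc t) x \<rho>) ! t"
          if v: "valid_inputs x \<rho>" for x \<rho>
          using step[OF v] len[OF v] False
          by (simp add: sim_step_def Let_def nth_append val_def comp_def)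
      qed (simp add: d_def)
    qed
  next
    case True
    define vs where "vs = (\<lambda>x \<rho>. pad N (map (gate_wire_val x (fst (?S t x \<rho>))) ?ws))"
    have dD: "d + 7 < D" using De by (simp add: d_def)
    have c: "has_consts gs d" by (rule has_consts_mono[OF IH(2)]) (simp add: d_def)
    have vs: "avail gs d (\<lambda>x \<rho>. vs x \<rho> ! i)" if "i < N" for i
    proof (cases "i < length ?ws")
      case True
      have "avail gs d (val (?ws ! i))" using val True by simp
      then show ?thesis by (rule avail_cong) (simp add: vs_def pad_def val_def True that)
    next
      case False
      have "avail gs d (\<lambda>_ _. False)" using c by (simp add: has_consts_def)
      then show ?thesis by (rule avail_cong) (simp add: vs_def pad_def False that)
    qed
    have ch: "G \<rho> ! t \<in> chunks N m" if "valid_inputs x \<rho>" for x \<rho>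
      using G[OF that] t by (auto simp: lists_len_def)
    obtain gs' where gs': "extends (mod6_cost N m) gs gs'"
      "\<And>x \<rho>. valid_inputs x \<rho> \<Longrightarrow> hist gs' x \<rho> = snd (sim_mod6 R (vs x \<rho>) (hist gs x \<rho>) (G \<rho> ! t))"
      "avail gs' (d + 8) (\<lambda>x \<rho>. fst (sim_mod6 R (vs x \<rho>) (hist gs x \<rho>) (G \<rho> ! t)))"
      using mod6_circuit[where vs = vs and ch = "\<lambda>\<rho>. G \<rho> ! t" and gs = gs and N = N and m = m and d = d]
        N dD extends_ok[OF IH(1)] c vs ch by (auto simp: vs_def)
    have st: "?S (Suc t) x \<rho> = (fst (?S t x \<rho>) @ [fst (sim_mod6 R (vs x \<rho>) (hist gs x \<rho>) (G \<rho> ! t))],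
        snd (sim_mod6 R (vs x \<rho>) (hist gs x \<rho>) (G \<rho> ! t)))" if "valid_inputs x \<rho>" for x \<rho>
      using step[OF that] True IH(3)[OF that] by (simp add: sim_step_def Let_def vs_def)
    show ?thesis
    proof (intro exI[of _ gs'] conjI allI impI)
      show "extends ?cost gs gs'" by (rule extends_mono[OF gs'(1)]) simp
      show "hist gs' x \<rho> = snd (?S (Suc t) x \<rho>)" if "valid_inputs x \<rho>" for x \<rho>
        using gs'(2)[OF that] st[OF that] by simp
      show "avail gs' (1 + 10 * Suc e) (\<lambda>x \<rho>. fst (?S (Suc t) x \<rho>) ! t)"
      proof (rule avail_cong[OF avail_mono[OF gs'(3)]])
        show "fst (sim_mod6 R (vs x \<rho>) (hist gs x \<rho>) (G \<rho> ! t)) = fst (?S (Suc t) x \<rho>) ! t"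
          if v: "valid_inputs x \<rho>" for x \<rho>
          using st[OF v] len[OF v] by (simp add: nth_append)
      qed (simp add: d_def)
    qed
  qed
  then obtain gs' where gs': "extends ?cost gs gs'"
    "\<And>x \<rho>. valid_inputs x \<rho> \<Longrightarrow> hist gs' x \<rho> = snd (?S (Suc t) x \<rho>)"
    "avail gs' (1 + 10 * Suc e) (\<lambda>x \<rho>. fst (?S (Suc t) x \<rho>) ! t)"
    by blast
  show ?case
  proof (intro exI[of _ gs'] conjI allI impI)
    show "extends (2 + Suc t * ?cost) [] gs'"
      by (rule extends_mono[OF extends_trans[OF IH(1) gs'(1)]]) simp
    show "has_consts gs' 1" by (rule has_consts_extends[OF IH(2) gs'(1)])
    show "hist gs' x \<rho> = snd (?S (Suc t) x \<rho>)" if "valid_inputs x \<rho>" for x \<rho>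
      using gs'(2)[OF that] .
    fix p assume p: "p < Suc t"
    show "avail gs' (1 + 10 * ?ds ! p) (\<lambda>x \<rho>. fst (?S (Suc t) x \<rho>) ! p)"
    proof (cases "p = t")
      case True
      then show ?thesis using gs'(3) e by simp
    next
      case False
      then have p: "p < t" using p by simp
      show ?thesis
      proof (rule avail_cong[OF avail_extends[OF IH(4)[OF p] gs'(1)]])
        show "fst (?S t x \<rho>) ! p = fst (?S (Suc t) x \<rho>) ! p" if v: "valid_inputs x \<rho>" for x \<rho>
          using step[OF v] len[OF v] p by (simp add: sim_step_def Let_def nth_append)
      qed
    qed
  qed
qed

end

section \<open>Assembling the theorem\<close>

text \<open>Without oracle gates the evaluation is independent of \<open>R\<close> and every gate
  has one output bit. \<open>wf_wire k 0\<close> rules out random wires, for which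
  \<open>gate_wire_val\<close> has a default value.\<close>

lemma exact_run:
  assumes "\<forall>gt\<in>set gts. fst gt \<in> {GAnd, GOr, GNot, GMod6}"
    and "\<forall>g<length gts. \<forall>w\<in>set (snd (gts ! g)). wf_wire k 0 (take g gts) w"
  shows "fst (foldl (gate_step R x \<rho>) ([], []) gts) = map (\<lambda>v. [v]) (foldl (exact_step x) [] gts) \<and>
    length (foldl (exact_step x) [] gts) = length gts"
  using assms
proof (induction gts rule: rev_induct)
  case (snoc gt gts)
  let ?st = "foldl (gate_step R x \<rho>) ([], []) gts" and ?v = "foldl (exact_step x) [] gts"
  have "\<forall>g<length gts. \<forall>w\<in>set (snd (gts ! g)). wf_wire k 0 (take g gts) w"
    using snoc.prems(2) by (auto simp: nth_append dest!: spec)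
  then have IH: "fst ?st = map (\<lambda>v. [v]) ?v" "length ?v = length gts"
    using snoc by auto
  have "wire_val x \<rho> (fst ?st) w = gate_wire_val x ?v w" if "w \<in> set (snd gt)" for w
  proof -
    have wfw: "wf_wire k 0 gts w"
      using snoc.prems(2)[rule_format, of "length gts" w] that by simp
    have kinds: "out_arity (fst (gts ! g)) = 1" if "g < length gts" for g
      using snoc.prems(1) nth_mem[OF that] by fastforce
    show ?thesis
      using wfw IH kinds by (cases w) (auto simp: wf_wire_def wire_val_def gate_wire_val_def)
  qed
  then have m: "map (wire_val x \<rho> (fst ?st)) (snd gt) = map (gate_wire_val x ?v) (snd gt)" by simp
  have "fst (gate_step R x \<rho> ?st gt) = fst ?st @ [[exact_gate (fst gt) (map (wire_val x \<rho> (fst ?st)) (snd gt))]]"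
    using snoc.prems(1) by (auto simp: gate_step_def exact_gate_def Let_def)
  then have "fst (foldl (gate_step R x \<rho>) ([], []) (gts @ [gt])) = map (\<lambda>v. [v]) (foldl (exact_step x) [] (gts @ [gt]))"
    unfolding m using IH by (simp add: exact_step_def)
  moreover have "length (foldl (exact_step x) [] (gts @ [gt])) = length (gts @ [gt])"
    using IH by (simp add: exact_step_def)
  ultimately show ?case by blast
qed simp

section \<open>Rounding to powers of two and polynomial bounds\<close>

lemma exists_pow2:
  assumes "1 \<le> a"
  obtains u where "a \<le> 2 ^ u" "2 ^ u \<le> 2 * (a::nat)"
proof -
  have ex: "\<exists>u. a \<le> 2 ^ u" using less_exp[of a] less_imp_le by blast
  define u where "u = (LEAST u. a \<le> 2 ^ u)"
  have u: "a \<le> 2 ^ u" unfolding u_def using ex by (rule LeastI_ex)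
  moreover have "2 ^ u \<le> 2 * a"
  proof (cases u)
    case 0
    then show ?thesis using assms by simp
  next
    case (Suc u')
    then have "\<not> a \<le> 2 ^ u'" using not_less_Least[of u' "\<lambda>u. a \<le> 2 ^ u"] by (simp add: u_def)
    then show ?thesis by (simp add: Suc)
  qed
  ultimately show thesis using that by blast
qed

definition poly_bounded :: "(nat \<Rightarrow> nat) \<Rightarrow> bool" where
  "poly_bounded f \<longleftrightarrow> (\<exists>c. \<forall>k. f k \<le> c * (k + 1) ^ c)"

lemma poly_bounded_const: "poly_bounded (\<lambda>_. a)"
  unfolding poly_bounded_def by (rule exI[of _ a]) simp

lemma poly_bounded_Suc: "poly_bounded (\<lambda>k. k + 1)"
  unfolding poly_bounded_def by (rule exI[of _ 1]) simp

lemma poly_bounded_add: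
  assumes "poly_bounded f" "poly_bounded g"
  shows "poly_bounded (\<lambda>k. f k + g k)"
proof -
  obtain a b where ab: "\<forall>k. f k \<le> a * (k + 1) ^ a" "\<forall>k. g k \<le> b * (k + 1) ^ b"
    using assms by (auto simp: poly_bounded_def)
  have "f k + g k \<le> (a + b) * (k + 1) ^ (a + b)" for k
  proof -
    have "f k + g k \<le> a * (k + 1) ^ a + b * (k + 1) ^ b" by (intro add_mono) (use ab in auto)
    also have "\<dots> \<le> a * (k + 1) ^ (a + b) + b * (k + 1) ^ (a + b)"
      by (intro add_mono mult_left_mono power_increasing) simp_all
    finally show ?thesis by (simp add: distrib_right)
  qed
  then show ?thesis unfolding poly_bounded_def by blast
qed

lemma poly_bounded_mult:
  assumes "poly_bounded f" "poly_bounded g"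
  shows "poly_bounded (\<lambda>k. f k * g k)"
proof -
  obtain a b where ab: "\<forall>k. f k \<le> a * (k + 1) ^ a" "\<forall>k. g k \<le> b * (k + 1) ^ b"
    using assms by (auto simp: poly_bounded_def)
  have "f k * g k \<le> (a * b + (a + b)) * (k + 1) ^ (a * b + (a + b))" for k
  proof -
    have "f k * g k \<le> (a * (k + 1) ^ a) * (b * (k + 1) ^ b)" using ab by (intro mult_mono) auto
    also have "\<dots> = (a * b) * (k + 1) ^ (a + b)" by (simp add: power_add)
    also have "\<dots> \<le> (a * b + (a + b)) * (k + 1) ^ (a * b + (a + b))"
      by (intro mult_mono power_increasing) auto
    finally show ?thesis .
  qed
  then show ?thesis unfolding poly_bounded_def by blast
qed

lemma poly_bounded_power: "poly_bounded f \<Longrightarrow> poly_bounded (\<lambda>k. f k ^ e)"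
  by (induction e) (auto intro: poly_bounded_const poly_bounded_mult)

text \<open>\<open>Q\<close> bounds \<open>2 ^ r\<close> and \<open>U\<close> bounds
  \<open>2 ^ u\<close> for the parameters of \<open>simulate_circuit\<close>, where
  \<open>m = 7 * u\<close>. The exponent 336 is 2 * 24 * 7, as
  \<open>4 ^ (24 * m) = (2 ^ u) ^ 336\<close>.\<close>

definition sim_size_bound :: "nat \<Rightarrow> nat \<Rightarrow> nat" where
  "sim_size_bound s k =
    (let N = s + 1; U = 512 * (s + 1); Q = 2 * (k + 1) in
     2 + s * (N + 1 + (2 * (7 * U * ((6 * N + 8) * (3 * (4 * Q ^ 2)) + (78 * N + 231))) + 3 * (Q ^ 2 * U ^ 336))) + Q)"

lemma poly_bounded_sim_size: "poly_bounded (\<lambda>k. sim_size_bound (c * (k + 1) ^ c) k)"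
  unfolding sim_size_bound_def Let_def
  by (intro poly_bounded_add poly_bounded_mult poly_bounded_power poly_bounded_const poly_bounded_Suc)

lemma sim_size_bound_mono: "s \<le> s' \<Longrightarrow> sim_size_bound s k \<le> sim_size_bound s' k"
  unfolding sim_size_bound_def Let_def
  by (intro add_mono mult_mono power_mono order_refl) simp_all

lemma simulate_circuit:
  assumes R: "rewind_orcl R" and wf: "wf_circuit k C"
    and kinds: "\<forall>gt\<in>set (gates C). fst gt \<in> {GAnd, GOr, GNot, GMod6}" and nr: "nrand C = 0"
  obtains C' where "wf_circuit k C'" "\<forall>gt\<in>set (gates C'). fst gt \<noteq> GMod6"
    "circ_size C' \<le> sim_size_bound (circ_size C) k" "circ_depth C' \<le> 10 * circ_depth C + 12"
    "\<And>x. length x = k \<Longrightarrow> 2 * 2 ^ nrand C' \<le>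
       3 * card {\<rho>. length \<rho> = nrand C' \<and> circ_eval R x \<rho> C' = circ_eval (\<lambda>_ _ _. []) x [] C}"
proof -
  let ?gts = "gates C"
  define s where "s = circ_size C"
  define N where "N = s + 1"
  \<comment> \<open>256 = 64 * 4: \<open>good_table\<close> wants error at most 1/64, and each of at
    most \<open>s + 1\<close> gates contributes \<open>4 * (9/10) ^ m\<close>.\<close>
  obtain u where u: "256 * (s + 1) \<le> 2 ^ u" "2 ^ u \<le> 2 * (256 * (s + 1))"
    using exists_pow2[of "256 * (s + 1)"] by auto
  \<comment> \<open>The union bound over \<open>2 ^ k\<close> inputs needs a table with more than
    \<open>k\<close> entries.\<close>
  obtain r where r: "k + 1 \<le> 2 ^ r" "2 ^ r \<le> 2 * (k + 1)"
    using exists_pow2[of "k + 1"] by auto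
  \<comment> \<open>(9/10)^7 < 1/2, so every seven experiments halve the error and \<open>m\<close>
    of them absorb the factor \<open>2 ^ u\<close>.\<close>
  define m where "m = 7 * u"
  define D where "D = 10 * circ_depth C + 12"
  interpret circuit_builder R k r D by unfold_locales (rule R)
  have lg: "length ?gts \<le> s" by (simp add: s_def circ_size_def)
  have lw: "length (snd gt) \<le> N" if "gt \<in> set ?gts" for gt
  proof -
    have "length (snd gt) \<le> sum_list (map (length \<circ> snd) ?gts)"
      using that by (intro member_le_sum_list) auto
    then show ?thesis by (simp add: N_def s_def circ_size_def)
  qed
  let ?\<Omega> = "lists_len (chunks N m) (length ?gts)"
  let ?I = "{\<rho> :: bool list. length \<rho> = r}"
  let ?X = "{x :: bool list. length x = k}"
  let ?exact = "\<lambda>x. foldl (exact_step x) [] ?gts"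
  define bad where "bad x \<omega> \<longleftrightarrow> fst (foldl (sim_step R N x) ([], []) (zip ?gts \<omega>)) \<noteq> ?exact x" for x \<omega>
  have cl: "finite {x :: bool list. length x = n}" "card {x :: bool list. length x = n} = 2 ^ n" for n
    using finite_lists_length_eq[of "UNIV :: bool set" n] card_lists_length_eq[of "UNIV :: bool set" n] by auto
  have fin\<Omega>: "finite ?\<Omega>" by (intro finite_lists_len finite_chunks)
  have ne: "?\<Omega> \<noteq> {}"
  proof -
    obtain c where "c \<in> chunks N m" using chunks_nonempty by blast
    then have "replicate (length ?gts) c \<in> ?\<Omega>" by (auto simp: lists_len_def)
    then show ?thesis by blast
  qed
  have "64 * card {\<omega> \<in> ?\<Omega>. bad x \<omega>} \<le> card ?\<Omega>" for x
  proof -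
    have "(9/10 :: real) ^ m \<le> (1/2) ^ u"
      unfolding m_def power_mult by (intro power_mono) (simp_all add: eval_nat_numeral)
    then have "256 * real (s + 1) * (9/10) ^ m \<le> real (256 * (s + 1)) * (1/2) ^ u"
      by (simp add: mult_left_mono)
    also have "\<dots> \<le> real (2 ^ u) * (1/2) ^ u"
      by (intro mult_right_mono) (use u(1) in \<open>simp_all only: of_nat_le_iff, simp\<close>)
    also have "\<dots> = 1" by (simp add: power_divide)
    finally have 1: "256 * real (s + 1) * (9/10) ^ m \<le> 1" .
    have "real (card {\<omega> \<in> ?\<Omega>. bad x \<omega>}) \<le> length ?gts * (4 * (9/10) ^ m) * card (chunks N m) ^ length ?gts"
      unfolding bad_def using sim_error[OF R, of ?gts N m x "[]" "[]"] lw by blast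
    also have "\<dots> \<le> real (s + 1) * (4 * (9/10) ^ m) * card (chunks N m) ^ length ?gts"
      using lg by (intro mult_right_mono) auto
    finally have "64 * real (card {\<omega> \<in> ?\<Omega>. bad x \<omega>}) \<le>
        64 * (real (s + 1) * (4 * (9/10) ^ m) * card (chunks N m) ^ length ?gts)"
      by (rule mult_left_mono) simp
    also have "\<dots> = (256 * real (s + 1) * (9/10) ^ m) * card ?\<Omega>"
      by (simp add: card_lists_len finite_chunks)
    also have "\<dots> \<le> 1 * real (card ?\<Omega>)" by (intro mult_right_mono 1) simp
    finally show ?thesis by linarith
  qed
  moreover have "card ?X < 2 ^ card ?I"
    unfolding cl using r(1) by (intro power_strict_increasing) auto
  ultimately obtain G where G: "G \<in> ?I \<rightarrow> ?\<Omega>"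
    and Gbad: "\<And>x. x \<in> ?X \<Longrightarrow> 3 * card {\<rho> \<in> ?I. bad x (G \<rho>)} \<le> card ?I"
    using good_table[of ?X ?\<Omega> ?I bad] cl fin\<Omega> ne by blast
  have De: "10 * e + 2 \<le> D" if "e \<in> set (gate_depths ?gts)" for e
    using that foldr_max_le[of "gate_depths ?gts" "circ_depth C"] by (auto simp: D_def circ_depth_def)
  have "\<exists>gs. extends (2 + length ?gts * (N + 1 + mod6_cost N m)) [] gs \<and> has_consts gs 1 \<and>
    (\<forall>x \<rho>. valid_inputs x \<rho> \<longrightarrow> hist gs x \<rho> = snd (sim_prefix R N ?gts (length ?gts) x (G \<rho>))) \<and>
    (\<forall>p<length ?gts. avail gs (1 + 10 * gate_depths ?gts ! p) (\<lambda>x \<rho>. fst (sim_prefix R N ?gts (length ?gts) x (G \<rho>)) ! p))"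
  proof (rule sim_circuit)
    show "\<forall>g<length ?gts. in_arity_ok (fst (?gts ! g)) (snd (?gts ! g)) \<and>
      (\<forall>w\<in>set (snd (?gts ! g)). wf_wire k 0 (take g ?gts) w)"
      using wf nr by (simp add: wf_circuit_def)
    show "G \<rho> \<in> ?\<Omega>" if "valid_inputs x \<rho>" for x \<rho>
      using G that by (auto simp: valid_inputs_def)
  qed (use kinds lw De in \<open>auto simp: N_def D_def\<close>)
  then obtain gs where gs: "extends (2 + length ?gts * (N + 1 + mod6_cost N m)) [] gs"
    "\<And>p. p < length ?gts \<Longrightarrow> avail gs (1 + 10 * gate_depths ?gts ! p)
        (\<lambda>x \<rho>. fst (sim_prefix R N ?gts (length ?gts) x (G \<rho>)) ! p)"
    by blast
  let ?val = "\<lambda>x \<rho>. gate_wire_val x (fst (sim_prefix R N ?gts (length ?gts) x (G \<rho>))) (cout C)"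
  have wfo: "wf_wire k 0 ?gts (cout C)" using wf nr by (simp add: wf_circuit_def)
  have "\<exists>d. avail gs d ?val"
  proof (cases "cout C")
    case (WIn i)
    then show ?thesis using wfo avail_input[of i gs] by (auto simp: wf_wire_def gate_wire_val_def)
  next
    case (WRnd j)
    then show ?thesis using wfo by (simp add: wf_wire_def)
  next
    case (WGate g j)
    then show ?thesis using wfo gs(2)[of g] by (auto simp: wf_wire_def gate_wire_val_def)
  qed
  then obtain d w where w: "carries gs d ?val w" by (auto simp: avail_def)
  define C' where "C' = \<lparr>gates = gs, nrand = r, cout = w\<rparr>"
  have ok: "ok_gates gs" by (rule extends_ok[OF gs(1)])
  have size: "gates_size gs \<le> 2 + length ?gts * (N + 1 + mod6_cost N m)"
    using gs(1) by (auto simp: extends_def)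
  show thesis
  proof (rule that[of C'])
    show "wf_circuit k C'"
      using ok w by (auto simp: wf_circuit_def C'_def ok_gates_def carries_def)
    show "\<forall>gt\<in>set (gates C'). fst gt \<noteq> GMod6"
      using ok by (auto simp: C'_def ok_gates_def)
    show "circ_depth C' \<le> 10 * circ_depth C + 12"
    proof -
      have "\<forall>e\<in>set (gate_depths gs). e \<le> D" using ok by (simp add: ok_gates_def)
      then have "foldr max (gate_depths gs) 0 \<le> D" by (simp add: foldr_max_le)
      then show ?thesis
        unfolding circ_depth_def[of C'] D_def[symmetric] by (simp add: C'_def)
    qed
    show "circ_size C' \<le> sim_size_bound (circ_size C) k"
    proof -
      have U: "(2::nat) ^ u \<le> 512 * (s + 1)" using u(2) by simp
      have "u \<le> 2 ^ u" using less_exp[of u] by (rule less_imp_le)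
      then have m: "m \<le> 7 * (512 * (s + 1))" using U unfolding m_def by linarith
      have p1: "(4::nat) ^ (r + 1) \<le> 4 * (2 * (k + 1)) ^ 2"
      proof -
        have "(4::nat) ^ (r + 1) = 4 * (2 ^ r) ^ 2" by (simp add: power2_eq_square flip: power_mult_distrib)
        then show ?thesis using power_mono[OF r(2), of 2] by simp
      qed
      have p2: "(4::nat) ^ (r + 24 * m) \<le> (2 * (k + 1)) ^ 2 * (512 * (s + 1)) ^ 336"
      proof -
        have "(4::nat) ^ (r + 24 * m) = 2 ^ (2 * (r + 24 * m))"
          using power_mult[of "2::nat" 2 "r + 24 * m"] by simp
        also have "\<dots> = 2 ^ (r * 2 + u * 336)" by (simp add: m_def algebra_simps)
        also have "\<dots> = (2 ^ r) ^ 2 * (2 ^ u) ^ 336" by (simp only: power_add power_mult)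
        also have "\<dots> \<le> (2 * (k + 1)) ^ 2 * (512 * (s + 1)) ^ 336"
          using r(2) U by (intro mult_mono power_mono) auto
        finally show ?thesis .
      qed
      have "r \<le> 2 ^ r" using less_exp[of r] by (rule less_imp_le)
      then have r': "r \<le> 2 * (k + 1)" using r(2) by linarith
      have "circ_size C' = gates_size gs + r" by (simp add: circ_size_def C'_def gates_size_def)
      also have "\<dots> \<le> 2 + length ?gts * (N + 1 + mod6_cost N m) + r" using size by simp
      also have "\<dots> \<le> sim_size_bound s k"
        unfolding sim_size_bound_def Let_def mod6_cost_def N_def
        by (intro add_mono mult_mono order_refl lg m p1 p2 r') simp_all
      finally show ?thesis by (simp add: s_def)
    qed
    fix x :: "bool list" assume x: "length x = k"
    \<comment> \<open>At an index that is not bad every simulated gate value is exact, hence so is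
      the output.\<close>
    have ev: "circ_eval R x \<rho> C' = circ_eval (\<lambda>_ _ _. []) x [] C" if "length \<rho> = r" "\<not> bad x (G \<rho>)" for \<rho>
    proof -
      have v: "valid_inputs x \<rho>" using x that by (simp add: valid_inputs_def)
      have "circ_eval R x \<rho> C' = wire_val x \<rho> (outs gs x \<rho>) w"
        by (simp add: circ_eval_def C'_def run_gates_def)
      also have "\<dots> = ?val x \<rho>" using w v by (simp add: carries_def)
      also have "\<dots> = gate_wire_val x (?exact x) (cout C)"
        using that(2) by (simp add: bad_def sim_prefix_def)
      also have "\<dots> = circ_eval (\<lambda>_ _ _. []) x [] C"
      proof -
        have w2: "\<forall>g<length ?gts. \<forall>w\<in>set (snd (?gts ! g)). wf_wire k 0 (take g ?gts) w"
          using wf nr by (simp add: wf_circuit_def)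
        note er = exact_run[OF kinds w2, of "\<lambda>_ _ _. []" x "[]"]
        have ka: "out_arity (fst (?gts ! g)) = 1" if "g < length ?gts" for g
          using kinds nth_mem[OF that] by fastforce
        show ?thesis
          using wfo ka er by (cases "cout C")
            (auto simp: circ_eval_def gate_wire_val_def wire_val_def wf_wire_def)
      qed
      finally show ?thesis .
    qed
    let ?good = "{\<rho>. length \<rho> = nrand C' \<and> circ_eval R x \<rho> C' = circ_eval (\<lambda>_ _ _. []) x [] C}"
    let ?bad = "{\<rho> \<in> ?I. bad x (G \<rho>)}"
    have nr': "nrand C' = r" by (simp add: C'_def)
    have "?I \<subseteq> ?good \<union> ?bad" using ev nr' by auto
    then have "card ?I \<le> card (?good \<union> ?bad)"
      using cl(1)[of r] nr' by (intro card_mono) auto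
    also have "\<dots> \<le> card ?good + card ?bad" by (rule card_Un_le)
    finally have "2 ^ r \<le> card ?good + card ?bad" using cl by simp
    moreover have "3 * card ?bad \<le> 2 ^ r" using Gbad[of x] x cl by simp
    ultimately show "2 * 2 ^ nrand C' \<le> 3 * card ?good" unfolding nr' by linarith
  qed
qed

theorem mainTheorem3:
  fixes R :: orcl
  assumes "rewind_orcl R"
  shows "AC0_6 \<subseteq> BPAC0_orcl R"
proof
  fix L assume "L \<in> AC0_6"
  then obtain F c d where F: "\<forall>k. wf_circuit k (F k) \<and>
      (\<forall>gt\<in>set (gates (F k)). fst gt \<in> {GAnd, GOr, GNot, GMod6}) \<and>
      nrand (F k) = 0 \<and> circ_size (F k) \<le> c * (k + 1) ^ c \<and> circ_depth (F k) \<le> d \<and>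
      (\<forall>x. length x = k \<longrightarrow> (circ_eval (\<lambda>_ _ _. []) x [] (F k) \<longleftrightarrow> x \<in> L))"
    unfolding AC0_6_def by blast
  obtain c' where c': "\<And>k. sim_size_bound (c * (k + 1) ^ c) k \<le> c' * (k + 1) ^ c'"
    using poly_bounded_sim_size[of c] by (auto simp: poly_bounded_def)
  \<comment> \<open>All requirements for one input length, with constants independent of
    \<open>k\<close>, so that a non-uniform family can be chosen pointwise.\<close>
  define P where "P k C' \<longleftrightarrow> wf_circuit k C' \<and> (\<forall>gt\<in>set (gates C'). fst gt \<noteq> GMod6) \<and>
      circ_size C' \<le> c' * (k + 1) ^ c' \<and> circ_depth C' \<le> 10 * d + 12 \<and>
      (\<forall>x. length x = k \<longrightarrow> 2 * 2 ^ nrand C' \<le>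
         3 * card {\<rho>. length \<rho> = nrand C' \<and> (circ_eval R x \<rho> C' \<longleftrightarrow> x \<in> L)})" for k C'
  have "\<exists>C'. P k C'" for k
  proof -
    note Fk = F[rule_format, of k]
    obtain C' where C': "wf_circuit k C'" "\<forall>gt\<in>set (gates C'). fst gt \<noteq> GMod6"
      "circ_size C' \<le> sim_size_bound (circ_size (F k)) k" "circ_depth C' \<le> 10 * circ_depth (F k) + 12"
      "\<And>x. length x = k \<Longrightarrow> 2 * 2 ^ nrand C' \<le>
         3 * card {\<rho>. length \<rho> = nrand C' \<and> circ_eval R x \<rho> C' = circ_eval (\<lambda>_ _ _. []) x [] (F k)}"
      using simulate_circuit[OF assms, of k "F k"] Fk by blast
    have "circ_size C' \<le> c' * (k + 1) ^ c'"
      using C'(3) sim_size_bound_mono[of "circ_size (F k)" "c * (k + 1) ^ c" k] c'[of k] Fk by linarith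
    moreover have "circ_depth C' \<le> 10 * d + 12" using C'(4) Fk by linarith
    moreover have "2 * 2 ^ nrand C' \<le> 3 * card {\<rho>. length \<rho> = nrand C' \<and> (circ_eval R x \<rho> C' \<longleftrightarrow> x \<in> L)}"
      if "length x = k" for x
      using C'(5)[OF that] Fk that by simp
    ultimately show ?thesis using C'(1,2) by (auto simp: P_def)
  qed
  then obtain F' where F': "\<And>k. P k (F' k)" by metis
  show "L \<in> BPAC0_orcl R"
    unfolding BPAC0_orcl_def
    by (rule CollectI, rule exI[of _ F'], rule exI[of _ c'], rule exI[of _ "10 * d + 12"], rule allI,
        rule F'[unfolded P_def])
qed

end
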